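(* Let $R$ be a commutative ring, $\alpha,z,\zeta\in R^\times$ with $\zeta^{-1}-\zeta=z$, and $n\ge 2$. For every oriented link $\Gamma$, the HOMFLY-PT polynomial $\phi_{\alpha,z}(\Gamma)$ with parameters $\alpha,z$ is computed via $\mathbf{MOY}_{\alpha,\zeta}$ by the identity $$Z_{\alpha,\zeta}(\Gamma)=\phi_{\alpha,z}(\Gamma)\,\emptyset$$ in $\mathrm{End}_{\mathbf{MOY}_{\alpha,\zeta}}(\emptyset)$.
   Context: All categories are enriched in $R$-modules. Diagrams are read bottom to top, up to plane isotopy; $\circ$ is stacking (left factor on top), $\otimes$ juxtaposition. **Tangles and HOMFLY-PT.** $\mathbf{TD}$: objects are finite sequences of $\uparrow,\downarrow$; morphisms are $R$-linear combinations of oriented plane tangle diagrams modulo all oriented Reidemeister moves. $X_+$ (resp. $X_-$) is the crossing of two upward strands with over-strand running from bottom left to top right (resp. bottom right to top left). $\mathbf{HOMFLY\text{-}PT}_{\alpha,z}$ is the quotient of $\mathbf{TD}$ by the tensor ideal generated by $\alpha X_+-\alpha^{-1}X_--z\,\mathrm{id}_{\uparrow\uparrow}$ and $\bigcirc-\frac{\alpha-\alpha^{-1}}{z}\emptyset$, with $\bigcirc$ the unknot. One has $\mathrm{End}(\emptyset)\cong R$ in $\mathbf{HOMFLY\text{-}PT}_{\alpha,z}$, and $\phi_{\alpha,z}(\Gamma)\in R$ is defined by $[\Gamma]=\phi_{\alpha,z}(\Gamma)[\emptyset]$ there. **$\mathbf{MOY}_{\alpha,\zeta}$.** $\mathbf{TrPD}$: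 objects are finite sequences of $\uparrow^1,\downarrow^1$; morphisms are $R$-linear combinations of oriented plane trivalent graphs with edges labelled in $\{1,2\}$, boundary edges labelled 1, such that at each vertex the sum of incoming labels equals the sum of outgoing labels. It is rigid monoidal; morphisms are generated by identities, caps $\overrightarrow{ev}:\uparrow^1\downarrow^1\to\emptyset$, $\overleftarrow{ev}:\downarrow^1\uparrow^1\to\emptyset$, cups $\overrightarrow{coev}:\emptyset\to\uparrow^1\downarrow^1$, $\overleftarrow{coev}:\emptyset\to\downarrow^1\uparrow^1$, the graph $S:\uparrow^1\uparrow^1\to\uparrow^1\uparrow^1$ (two 1-edges merge into a 2-edge which splits into two 1-edges) and its dual $S^\vee$ (reversed orientations). Write $\mathrm{id}=\mathrm{id}_{\uparrow^1}$, $\mathrm{id}^\vee=\mathrm{id}_{\downarrow^1}$. Put $[k]_{\alpha,\zeta}=\dfrac{\alpha^{-1}(-\zeta)^{k-n}-\alpha(-\zeta)^{n-k}}{\zeta-\zeta^{-1}}$. $\mathbf{MOY}_{\alpha,\zeta}$ is the quotient of $\mathbf{TrPD}$ by the tensor ideal generated by the following relations and their duals (all orientations reversed): (1) the circle labelled 1 equals $[n]_{\alpha,\zeta}\,\emptyset$; (2) $S\circ S=-(\zeta+\zeta^{-1})S$; (3) $(\overleftarrow{ev}\otimes\mathrm{id})\circ(\mathrm{id}^\vee\otimes S)\circ(\overleftarrow{coev}\otimes\mathrm{id})=[n-1]_{\alpha,\zeta}\,\mathrm{id}$; (4) $(\mathrm{id}\otimes\overrightarrow{ev}\otimes\mathrm{id}^\vee)\circ(S\otimes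 S^\vee)\circ(\mathrm{id}\otimes\overrightarrow{coev}\otimes\mathrm{id}^\vee)=\overrightarrow{coev}\circ\overrightarrow{ev}+[n-2]_{\alpha,\zeta}\,\mathrm{id}\otimes\mathrm{id}^\vee$; (5) $(S\otimes\mathrm{id})(\mathrm{id}\otimes S)(S\otimes\mathrm{id})+\mathrm{id}\otimes S=(\mathrm{id}\otimes S)(S\otimes\mathrm{id})(\mathrm{id}\otimes S)+S\otimes\mathrm{id}$. $Z_{\alpha,\zeta}:\mathbf{TD}\to\mathbf{MOY}_{\alpha,\zeta}$ is the rigid braided monoidal functor with $\uparrow\mapsto\uparrow^1$, cups and caps to cups and caps, $X_+\mapsto\alpha^{-1}(\zeta^{-1}\mathrm{id}_{\uparrow^1\uparrow^1}+S)$, $X_-\mapsto\alpha(\zeta\,\mathrm{id}_{\uparrow^1\uparrow^1}+S)$. *)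

theory Defs
  imports "HOL-Library.Poly_Mapping"
begin

section \<open>Sliced plane diagrams\<close>

text \<open>
  A plane diagram in general position is cut by horizontal lines into slices, each containing
  exactly one elementary piece (a cup, a cap, a crossing or a vertex) between vertical strands.
  A diagram records the objects at its bottom and at its top and, from bottom to top, its slices
  \<open>(l, g, r)\<close>: the piece \<open>g\<close> with the strands \<open>l\<close> to its left and \<open>r\<close> to its right.
  Plane isotopy becomes a congruence on such diagrams, generated by height exchange of far apart
  pieces and by straightening and rotation moves.
\<close>

datatype ('o, 'g) diagram =
  Diagram (bot: "'o list") (slices: "('o list \<times> 'g \<times> 'o list) list") (top: "'o list")

definition idd :: "'o list \<Rightarrow> ('o, 'g) diagram" where
  "idd a = Diagram a [] a"

definition dcomp :: "('o, 'g) diagram \<Rightarrow> ('o, 'g) diagram \<Rightarrow> ('o, 'g) diagram"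
    (infixl \<open>\<circ>\<^sub>D\<close> 65) where
  "D \<circ>\<^sub>D E = Diagram (bot E) (slices E @ slices D) (top D)"

definition dtensor :: "('o, 'g) diagram \<Rightarrow> ('o, 'g) diagram \<Rightarrow> ('o, 'g) diagram"
    (infixl \<open>\<otimes>\<^sub>D\<close> 70) where
  "D \<otimes>\<^sub>D E = Diagram (bot D @ bot E)
     (map (\<lambda>(l, g, r). (l, g, r @ bot E)) (slices D) @
      map (\<lambda>(l, g, r). (top D @ l, g, r)) (slices E))
     (top D @ top E)"

definition gen :: "('g \<Rightarrow> 'o list) \<Rightarrow> ('g \<Rightarrow> 'o list) \<Rightarrow> 'g \<Rightarrow> ('o, 'g) diagram" where
  "gen src tgt g = Diagram (src g) [([], g, [])] (tgt g)"

primrec stacks :: "('g \<Rightarrow> 'o list) \<Rightarrow> ('g \<Rightarrow> 'o list) \<Rightarrow>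
    'o list \<Rightarrow> ('o list \<times> 'g \<times> 'o list) list \<Rightarrow> 'o list \<Rightarrow> bool" where
  "stacks src tgt a [] b \<longleftrightarrow> a = b"
| "stacks src tgt a (s # ss) b \<longleftrightarrow>
     (case s of (l, g, r) \<Rightarrow> a = l @ src g @ r \<and> stacks src tgt (l @ tgt g @ r) ss b)"

definition is_diagram :: "('g \<Rightarrow> 'o list) \<Rightarrow> ('g \<Rightarrow> 'o list) \<Rightarrow> ('o, 'g) diagram \<Rightarrow> bool" where
  "is_diagram src tgt D \<longleftrightarrow> stacks src tgt (bot D) (slices D) (top D)"

text \<open>The congruence generated by a set of local moves, with height exchange built in.\<close>

inductive diagram_equiv :: "('g \<Rightarrow> 'o list) \<Rightarrow> ('g \<Rightarrow> 'o list) \<Rightarrow>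
    (('o, 'g) diagram \<Rightarrow> ('o, 'g) diagram \<Rightarrow> bool) \<Rightarrow>
    ('o, 'g) diagram \<Rightarrow> ('o, 'g) diagram \<Rightarrow> bool"
  for src tgt :: "'g \<Rightarrow> 'o list" and move :: "('o, 'g) diagram \<Rightarrow> ('o, 'g) diagram \<Rightarrow> bool" where
  move: "move D E \<Longrightarrow> diagram_equiv src tgt move D E"
| exchange: "is_diagram src tgt D \<Longrightarrow> is_diagram src tgt E \<Longrightarrow>
    diagram_equiv src tgt move
      ((idd (top D) \<otimes>\<^sub>D E) \<circ>\<^sub>D (D \<otimes>\<^sub>D idd (bot E)))
      ((D \<otimes>\<^sub>D idd (top E)) \<circ>\<^sub>D (idd (bot D) \<otimes>\<^sub>D E))"
| refl: "is_diagram src tgt D \<Longrightarrow> diagram_equiv src tgt move D D"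
| sym: "diagram_equiv src tgt move D E \<Longrightarrow> diagram_equiv src tgt move E D"
| trans: "diagram_equiv src tgt move D E \<Longrightarrow> diagram_equiv src tgt move E F \<Longrightarrow>
    diagram_equiv src tgt move D F"
| comp: "diagram_equiv src tgt move D D' \<Longrightarrow> diagram_equiv src tgt move E E' \<Longrightarrow> bot D = top E \<Longrightarrow>
    diagram_equiv src tgt move (D \<circ>\<^sub>D E) (D' \<circ>\<^sub>D E')"
| tensor: "diagram_equiv src tgt move D D' \<Longrightarrow> diagram_equiv src tgt move E E' \<Longrightarrow>
    diagram_equiv src tgt move (D \<otimes>\<^sub>D E) (D' \<otimes>\<^sub>D E')"


section \<open>Linear combinations of diagrams and tensor ideals\<close>

abbreviation lc :: "'d \<Rightarrow> 'd \<Rightarrow>\<^sub>0 'r::comm_ring_1" where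
  "lc D \<equiv> Poly_Mapping.single D 1"

definition scale :: "'r::comm_ring_1 \<Rightarrow> ('d \<Rightarrow>\<^sub>0 'r) \<Rightarrow> ('d \<Rightarrow>\<^sub>0 'r)" (infixr \<open>\<odot>\<close> 72) where
  "c \<odot> f = Poly_Mapping.map ((*) c) f"

definition lcomp :: "(('o, 'g) diagram \<Rightarrow>\<^sub>0 'r::comm_ring_1) \<Rightarrow> (('o, 'g) diagram \<Rightarrow>\<^sub>0 'r) \<Rightarrow>
    (('o, 'g) diagram \<Rightarrow>\<^sub>0 'r)" (infixl \<open>\<circ>\<^sub>L\<close> 68) where
  "f \<circ>\<^sub>L g = (\<Sum>D\<in>Poly_Mapping.keys f. \<Sum>E\<in>Poly_Mapping.keys g.
     Poly_Mapping.single (D \<circ>\<^sub>D E) (Poly_Mapping.lookup f D * Poly_Mapping.lookup g E))"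

definition ltensor :: "(('o, 'g) diagram \<Rightarrow>\<^sub>0 'r::comm_ring_1) \<Rightarrow> (('o, 'g) diagram \<Rightarrow>\<^sub>0 'r) \<Rightarrow>
    (('o, 'g) diagram \<Rightarrow>\<^sub>0 'r)" (infixl \<open>\<otimes>\<^sub>L\<close> 70) where
  "f \<otimes>\<^sub>L g = (\<Sum>D\<in>Poly_Mapping.keys f. \<Sum>E\<in>Poly_Mapping.keys g.
     Poly_Mapping.single (D \<otimes>\<^sub>D E) (Poly_Mapping.lookup f D * Poly_Mapping.lookup g E))"

definition hom :: "(('o, 'g) diagram \<Rightarrow> bool) \<Rightarrow> 'o list \<Rightarrow> 'o list \<Rightarrow>
    (('o, 'g) diagram \<Rightarrow>\<^sub>0 'r::comm_ring_1) set" where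
  "hom P a b = {f. \<forall>D\<in>Poly_Mapping.keys f. P D \<and> bot D = a \<and> top D = b}"

text \<open>
  \<open>P\<close> selects the diagrams of the category. The relation holds between \<open>a\<close>, \<open>b\<close> and \<open>f\<close> iff
  \<open>f\<close> lies in the component \<open>a \<rightarrow> b\<close> of the tensor ideal generated by the relators in \<open>Rel\<close>.
\<close>

inductive tensor_ideal :: "(('o, 'g) diagram \<Rightarrow> bool) \<Rightarrow> (('o, 'g) diagram \<Rightarrow>\<^sub>0 'r::comm_ring_1) set \<Rightarrow>
    'o list \<Rightarrow> 'o list \<Rightarrow> (('o, 'g) diagram \<Rightarrow>\<^sub>0 'r) \<Rightarrow> bool"
  for P :: "('o, 'g) diagram \<Rightarrow> bool" and Rel :: "(('o, 'g) diagram \<Rightarrow>\<^sub>0 'r::comm_ring_1) set" where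
  relator: "f \<in> Rel \<Longrightarrow> f \<in> hom P a b \<Longrightarrow> tensor_ideal P Rel a b f"
| zero: "tensor_ideal P Rel a b 0"
| add: "tensor_ideal P Rel a b f \<Longrightarrow> tensor_ideal P Rel a b g \<Longrightarrow> tensor_ideal P Rel a b (f + g)"
| scale: "tensor_ideal P Rel a b f \<Longrightarrow> tensor_ideal P Rel a b (c \<odot> f)"
| comp_left: "tensor_ideal P Rel a b f \<Longrightarrow> g \<in> hom P b c \<Longrightarrow> tensor_ideal P Rel a c (g \<circ>\<^sub>L f)"
| comp_right: "tensor_ideal P Rel b c f \<Longrightarrow> g \<in> hom P a b \<Longrightarrow> tensor_ideal P Rel a c (f \<circ>\<^sub>L g)"
| tensor_left: "tensor_ideal P Rel a b f \<Longrightarrow> g \<in> hom P c d \<Longrightarrow>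
    tensor_ideal P Rel (c @ a) (d @ b) (g \<otimes>\<^sub>L f)"
| tensor_right: "tensor_ideal P Rel a b f \<Longrightarrow> g \<in> hom P c d \<Longrightarrow>
    tensor_ideal P Rel (a @ c) (b @ d) (f \<otimes>\<^sub>L g)"


section \<open>Units\<close>

definition unit_inv :: "'r::comm_ring_1 \<Rightarrow> 'r" where
  "unit_inv x = (THE y. x * y = 1)"

definition unit_powi :: "'r::comm_ring_1 \<Rightarrow> int \<Rightarrow> 'r" where
  "unit_powi x k = (if 0 \<le> k then x ^ nat k else unit_inv x ^ nat (- k))"


section \<open>Oriented tangles and the HOMFLY-PT category\<close>

datatype dir = Up | Down

fun opp :: "dir \<Rightarrow> dir" where
  "opp Up = Down"
| "opp Down = Up"

text \<open>
  \<open>TCup s\<close> and \<open>TCap s\<close> are \<open>\<emptyset> \<rightarrow> s s*\<close> and \<open>s s* \<rightarrow> \<emptyset>\<close>. \<open>TCross a b p\<close> is the crossing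
  \<open>a b \<rightarrow> b a\<close>; the strand from bottom left to top right, which has direction \<open>a\<close>,
  is the over-strand iff \<open>p\<close>.
\<close>

datatype tgen = TCup dir | TCap dir | TCross dir dir bool

fun tsrc :: "tgen \<Rightarrow> dir list" where
  "tsrc (TCup s) = []"
| "tsrc (TCap s) = [s, opp s]"
| "tsrc (TCross a b p) = [a, b]"

fun ttgt :: "tgen \<Rightarrow> dir list" where
  "ttgt (TCup s) = [s, opp s]"
| "ttgt (TCap s) = []"
| "ttgt (TCross a b p) = [b, a]"

type_synonym tangle = "(dir, tgen) diagram"

abbreviation is_tangle :: "tangle \<Rightarrow> bool" where
  "is_tangle \<equiv> is_diagram tsrc ttgt"

abbreviation tcup :: "dir \<Rightarrow> tangle" where "tcup s \<equiv> gen tsrc ttgt (TCup s)"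
abbreviation tcap :: "dir \<Rightarrow> tangle" where "tcap s \<equiv> gen tsrc ttgt (TCap s)"
abbreviation tcross :: "dir \<Rightarrow> dir \<Rightarrow> bool \<Rightarrow> tangle" where
  "tcross a b p \<equiv> gen tsrc ttgt (TCross a b p)"

text \<open>
  Plane isotopy and Reidemeister moves. The move \<open>rotate\<close> turns a crossing clockwise by a right
  angle; the former bottom right strand, of direction \<open>b\<close>, then runs from bottom left to top right.
  In \<open>R3\<close> the flags \<open>p\<close>, \<open>q\<close>, \<open>r\<close> belong to the strand pairs (1,2), (1,3), (2,3); the premise says
  that they come from an ordering of the three strands by height.
\<close>

inductive tangle_move :: "tangle \<Rightarrow> tangle \<Rightarrow> bool" where
  zigzag_right: "tangle_move ((tcap s \<otimes>\<^sub>D idd [s]) \<circ>\<^sub>D (idd [s] \<otimes>\<^sub>D tcup (opp s))) (idd [s])"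
| zigzag_left: "tangle_move ((idd [s] \<otimes>\<^sub>D tcap (opp s)) \<circ>\<^sub>D (tcup s \<otimes>\<^sub>D idd [s])) (idd [s])"
| rotate: "tangle_move
    ((idd [opp a, b] \<otimes>\<^sub>D tcap a) \<circ>\<^sub>D (idd [opp a] \<otimes>\<^sub>D tcross a b p \<otimes>\<^sub>D idd [opp a])
      \<circ>\<^sub>D (tcup (opp a) \<otimes>\<^sub>D idd [b, opp a]))
    (tcross b (opp a) (\<not> p))"
| R1_right: "tangle_move
    ((idd [s] \<otimes>\<^sub>D tcap s) \<circ>\<^sub>D (tcross s s p \<otimes>\<^sub>D idd [opp s]) \<circ>\<^sub>D (idd [s] \<otimes>\<^sub>D tcup s)) (idd [s])"
| R1_left: "tangle_move
    ((tcap (opp s) \<otimes>\<^sub>D idd [s]) \<circ>\<^sub>D (idd [opp s] \<otimes>\<^sub>D tcross s s p) \<circ>\<^sub>D (tcup (opp s) \<otimes>\<^sub>D idd [s]))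
    (idd [s])"
| R2: "tangle_move (tcross b a (\<not> p) \<circ>\<^sub>D tcross a b p) (idd [a, b])"
| R3: "(p = r \<Longrightarrow> q = p) \<Longrightarrow> tangle_move
    ((tcross b c r \<otimes>\<^sub>D idd [a]) \<circ>\<^sub>D (idd [b] \<otimes>\<^sub>D tcross a c q) \<circ>\<^sub>D (tcross a b p \<otimes>\<^sub>D idd [c]))
    ((idd [c] \<otimes>\<^sub>D tcross a b p) \<circ>\<^sub>D (tcross a c q \<otimes>\<^sub>D idd [b]) \<circ>\<^sub>D (idd [a] \<otimes>\<^sub>D tcross b c r))"

abbreviation tangle_equiv :: "tangle \<Rightarrow> tangle \<Rightarrow> bool" where
  "tangle_equiv \<equiv> diagram_equiv tsrc ttgt tangle_move"

definition X_pos :: tangle where "X_pos = tcross Up Up True"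
definition X_neg :: tangle where "X_neg = tcross Up Up False"

definition homfly_relators :: "'r::comm_ring_1 \<Rightarrow> 'r \<Rightarrow> (tangle \<Rightarrow>\<^sub>0 'r) set" where
  "homfly_relators \<alpha> z =
     {lc D - lc E | D E. tangle_equiv D E} \<union>
     {\<alpha> \<odot> lc X_pos - unit_inv \<alpha> \<odot> lc X_neg - z \<odot> lc (idd [Up, Up])} \<union>
     {lc (tcap s \<circ>\<^sub>D tcup s) - ((\<alpha> - unit_inv \<alpha>) * unit_inv z) \<odot> lc (idd []) | s. True}"

text \<open>Equality of morphisms \<open>a \<rightarrow> b\<close> in the HOMFLY-PT category.\<close>

definition homfly_eq :: "'r::comm_ring_1 \<Rightarrow> 'r \<Rightarrow> dir list \<Rightarrow> dir list \<Rightarrow>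
    (tangle \<Rightarrow>\<^sub>0 'r) \<Rightarrow> (tangle \<Rightarrow>\<^sub>0 'r) \<Rightarrow> bool" where
  "homfly_eq \<alpha> z a b f g \<longleftrightarrow> tensor_ideal is_tangle (homfly_relators \<alpha> z) a b (f - g)"

definition oriented_link :: "tangle \<Rightarrow> bool" where
  "oriented_link \<Gamma> \<longleftrightarrow> is_tangle \<Gamma> \<and> bot \<Gamma> = [] \<and> top \<Gamma> = []"

text \<open>
  \<open>p\<close> is the HOMFLY-PT polynomial of \<open>\<Gamma>\<close>, i.e. the class of \<open>\<Gamma>\<close> is \<open>p\<close> times the class of the
  empty diagram; such a \<open>p\<close> exists and is unique because the endomorphism ring of the empty
  object is the ground ring.
\<close>

definition is_homfly_polynomial :: "'r::comm_ring_1 \<Rightarrow> 'r \<Rightarrow> tangle \<Rightarrow> 'r \<Rightarrow> bool" where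
  "is_homfly_polynomial \<alpha> z \<Gamma> p \<longleftrightarrow> homfly_eq \<alpha> z [] [] (lc \<Gamma>) (p \<odot> lc (idd []))"


section \<open>Plane trivalent graphs and the MOY category\<close>

datatype label = L1 | L2

type_synonym strand = "dir \<times> label"

text \<open>
  \<open>Merge s\<close> and \<open>Split s\<close> are vertices with all edges of direction \<open>s\<close>, two 1-labelled edges at the
  bottom and one 2-labelled edge at the top, or upside down. All other positions of a vertex arise
  by bending edges with cups and caps. Up to rotation these are the only trivalent vertices with
  labels 1 and 2 and equal incoming and outgoing sums.
\<close>

datatype ggen = GCup dir label | GCap dir label | Merge dir | Split dir

fun gsrc :: "ggen \<Rightarrow> strand list" where
  "gsrc (GCup s i) = []"
| "gsrc (GCap s i) = [(s, i), (opp s, i)]"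
| "gsrc (Merge s) = [(s, L1), (s, L1)]"
| "gsrc (Split s) = [(s, L2)]"

fun gtgt :: "ggen \<Rightarrow> strand list" where
  "gtgt (GCup s i) = [(s, i), (opp s, i)]"
| "gtgt (GCap s i) = []"
| "gtgt (Merge s) = [(s, L2)]"
| "gtgt (Split s) = [(s, L1), (s, L1)]"

type_synonym tgraph = "(strand, ggen) diagram"

abbreviation gcup :: "dir \<Rightarrow> label \<Rightarrow> tgraph" where "gcup s i \<equiv> gen gsrc gtgt (GCup s i)"
abbreviation gcap :: "dir \<Rightarrow> label \<Rightarrow> tgraph" where "gcap s i \<equiv> gen gsrc gtgt (GCap s i)"
abbreviation merge :: "dir \<Rightarrow> tgraph" where "merge s \<equiv> gen gsrc gtgt (Merge s)"
abbreviation split :: "dir \<Rightarrow> tgraph" where "split s \<equiv> gen gsrc gtgt (Split s)"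

text \<open>
  The last two moves turn a vertex by two right angles, counterclockwise and clockwise.
\<close>

inductive graph_move :: "tgraph \<Rightarrow> tgraph \<Rightarrow> bool" where
  zigzag_right: "graph_move
    ((gcap s i \<otimes>\<^sub>D idd [(s, i)]) \<circ>\<^sub>D (idd [(s, i)] \<otimes>\<^sub>D gcup (opp s) i)) (idd [(s, i)])"
| zigzag_left: "graph_move
    ((idd [(s, i)] \<otimes>\<^sub>D gcap (opp s) i) \<circ>\<^sub>D (gcup s i \<otimes>\<^sub>D idd [(s, i)])) (idd [(s, i)])"
| rotate_ccw: "graph_move
    ((gcap (opp s) L2 \<otimes>\<^sub>D idd [(opp s, L1), (opp s, L1)])
      \<circ>\<^sub>D (idd [(opp s, L2)] \<otimes>\<^sub>D merge s \<otimes>\<^sub>D idd [(opp s, L1), (opp s, L1)])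
      \<circ>\<^sub>D (idd [(opp s, L2)] \<otimes>\<^sub>D
           ((idd [(s, L1)] \<otimes>\<^sub>D gcup s L1 \<otimes>\<^sub>D idd [(opp s, L1)]) \<circ>\<^sub>D gcup s L1)))
    (split (opp s))"
| rotate_cw: "graph_move
    ((idd [(opp s, L1), (opp s, L1)] \<otimes>\<^sub>D gcap s L2)
      \<circ>\<^sub>D (idd [(opp s, L1), (opp s, L1)] \<otimes>\<^sub>D merge s \<otimes>\<^sub>D idd [(opp s, L2)])
      \<circ>\<^sub>D (((idd [(opp s, L1)] \<otimes>\<^sub>D gcup (opp s) L1 \<otimes>\<^sub>D idd [(s, L1)]) \<circ>\<^sub>D gcup (opp s) L1)
           \<otimes>\<^sub>D idd [(opp s, L2)]))
    (split (opp s))"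

abbreviation graph_isotopic :: "tgraph \<Rightarrow> tgraph \<Rightarrow> bool" where
  "graph_isotopic \<equiv> diagram_equiv gsrc gtgt graph_move"

text \<open>Morphisms of the category of trivalent graphs have only 1-labelled boundary edges.\<close>

definition is_tgraph :: "tgraph \<Rightarrow> bool" where
  "is_tgraph D \<longleftrightarrow> is_diagram gsrc gtgt D \<and> snd ` (set (bot D) \<union> set (top D)) \<subseteq> {L1}"

definition ids :: "dir list \<Rightarrow> tgraph" where
  "ids a = idd (map (\<lambda>s. (s, L1)) a)"

abbreviation cup :: "dir \<Rightarrow> tgraph" where "cup s \<equiv> gcup s L1"
abbreviation cap :: "dir \<Rightarrow> tgraph" where "cap s \<equiv> gcap s L1"

text \<open>\<open>S Up\<close> is the graph \<open>S\<close>, \<open>S Down\<close> is its dual.\<close>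

definition S :: "dir \<Rightarrow> tgraph" where
  "S s = split s \<circ>\<^sub>D merge s"

definition bracket :: "'r::comm_ring_1 \<Rightarrow> 'r \<Rightarrow> nat \<Rightarrow> int \<Rightarrow> 'r" where
  "bracket \<alpha> \<zeta> n k =
     (unit_inv \<alpha> * unit_powi (- \<zeta>) (k - int n) - \<alpha> * unit_powi (- \<zeta>) (int n - k))
       * unit_inv (\<zeta> - unit_inv \<zeta>)"

text \<open>
  For \<open>s = Up\<close> the last five families are the defining relations, for \<open>s = Down\<close> their duals.
\<close>

definition moy_relators :: "'r::comm_ring_1 \<Rightarrow> 'r \<Rightarrow> nat \<Rightarrow> (tgraph \<Rightarrow>\<^sub>0 'r) set" where
  "moy_relators \<alpha> \<zeta> n =
     {lc D - lc E | D E. graph_isotopic D E} \<union>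
     {lc (cap s \<circ>\<^sub>D cup s) - bracket \<alpha> \<zeta> n (int n) \<odot> lc (ids []) | s. True} \<union>
     {lc (S s \<circ>\<^sub>D S s) - (- (\<zeta> + unit_inv \<zeta>)) \<odot> lc (S s) | s. True} \<union>
     {lc ((cap (opp s) \<otimes>\<^sub>D ids [s]) \<circ>\<^sub>D (ids [opp s] \<otimes>\<^sub>D S s) \<circ>\<^sub>D (cup (opp s) \<otimes>\<^sub>D ids [s]))
        - bracket \<alpha> \<zeta> n (int n - 1) \<odot> lc (ids [s]) | s. True} \<union>
     {lc ((ids [s] \<otimes>\<^sub>D cap s \<otimes>\<^sub>D ids [opp s]) \<circ>\<^sub>D (S s \<otimes>\<^sub>D S (opp s))
            \<circ>\<^sub>D (ids [s] \<otimes>\<^sub>D cup s \<otimes>\<^sub>D ids [opp s]))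
        - (lc (cup s \<circ>\<^sub>D cap s) + bracket \<alpha> \<zeta> n (int n - 2) \<odot> lc (ids [s, opp s])) | s. True} \<union>
     {(lc ((S s \<otimes>\<^sub>D ids [s]) \<circ>\<^sub>D (ids [s] \<otimes>\<^sub>D S s) \<circ>\<^sub>D (S s \<otimes>\<^sub>D ids [s])) + lc (ids [s] \<otimes>\<^sub>D S s))
        - (lc ((ids [s] \<otimes>\<^sub>D S s) \<circ>\<^sub>D (S s \<otimes>\<^sub>D ids [s]) \<circ>\<^sub>D (ids [s] \<otimes>\<^sub>D S s)) + lc (S s \<otimes>\<^sub>D ids [s])) | s. True}"

text \<open>Equality of morphisms \<open>a \<rightarrow> b\<close> in the MOY category.\<close>

definition moy_eq :: "'r::comm_ring_1 \<Rightarrow> 'r \<Rightarrow> nat \<Rightarrow> strand list \<Rightarrow> strand list \<Rightarrow>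
    (tgraph \<Rightarrow>\<^sub>0 'r) \<Rightarrow> (tgraph \<Rightarrow>\<^sub>0 'r) \<Rightarrow> bool" where
  "moy_eq \<alpha> \<zeta> n a b f g \<longleftrightarrow> tensor_ideal is_tgraph (moy_relators \<alpha> \<zeta> n) a b (f - g)"


section \<open>The functor from tangles to the MOY category\<close>

text \<open>
  Values on \<open>X_pos\<close> and \<open>X_neg\<close>, and on their rotations by two right angles for \<open>s = Down\<close>.
\<close>

definition crossing_value :: "'r::comm_ring_1 \<Rightarrow> 'r \<Rightarrow> dir \<Rightarrow> bool \<Rightarrow> (tgraph \<Rightarrow>\<^sub>0 'r)" where
  "crossing_value \<alpha> \<zeta> s p =
     (if p then unit_inv \<alpha> \<odot> (unit_inv \<zeta> \<odot> lc (ids [s, s]) + lc (S s))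
      else \<alpha> \<odot> (\<zeta> \<odot> lc (ids [s, s]) + lc (S s)))"

text \<open>
  A rigid functor is determined by its values on the upward crossings: \<open>TCross Up Down p\<close> and
  \<open>TCross Down Up p\<close> are the rotations of \<open>TCross Up Up (\<not> p)\<close> by a right angle clockwise
  and counterclockwise.
\<close>

fun Z_gen :: "'r::comm_ring_1 \<Rightarrow> 'r \<Rightarrow> tgen \<Rightarrow> (tgraph \<Rightarrow>\<^sub>0 'r)" where
  "Z_gen \<alpha> \<zeta> (TCup s) = lc (cup s)"
| "Z_gen \<alpha> \<zeta> (TCap s) = lc (cap s)"
| "Z_gen \<alpha> \<zeta> (TCross Up Up p) = crossing_value \<alpha> \<zeta> Up p"
| "Z_gen \<alpha> \<zeta> (TCross Down Down p) = crossing_value \<alpha> \<zeta> Down p"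
| "Z_gen \<alpha> \<zeta> (TCross Up Down p) =
     lc (ids [Down, Up] \<otimes>\<^sub>D cap Up)
       \<circ>\<^sub>L (lc (ids [Down]) \<otimes>\<^sub>L crossing_value \<alpha> \<zeta> Up (\<not> p) \<otimes>\<^sub>L lc (ids [Down]))
       \<circ>\<^sub>L lc (cup Down \<otimes>\<^sub>D ids [Up, Down])"
| "Z_gen \<alpha> \<zeta> (TCross Down Up p) =
     lc (cap Down \<otimes>\<^sub>D ids [Up, Down])
       \<circ>\<^sub>L (lc (ids [Down]) \<otimes>\<^sub>L crossing_value \<alpha> \<zeta> Up (\<not> p) \<otimes>\<^sub>L lc (ids [Down]))
       \<circ>\<^sub>L lc (ids [Down, Up] \<otimes>\<^sub>D cup Up)"

primrec Z_slices :: "'r::comm_ring_1 \<Rightarrow> 'r \<Rightarrow> dir list \<Rightarrow> (dir list \<times> tgen \<times> dir list) list \<Rightarrow>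
    (tgraph \<Rightarrow>\<^sub>0 'r)" where
  "Z_slices \<alpha> \<zeta> b [] = lc (ids b)"
| "Z_slices \<alpha> \<zeta> b (s # ss) = (case s of (l, g, r) \<Rightarrow>
     Z_slices \<alpha> \<zeta> b ss \<circ>\<^sub>L (lc (ids l) \<otimes>\<^sub>L Z_gen \<alpha> \<zeta> g \<otimes>\<^sub>L lc (ids r)))"

definition Z :: "'r::comm_ring_1 \<Rightarrow> 'r \<Rightarrow> tangle \<Rightarrow> (tgraph \<Rightarrow>\<^sub>0 'r)" where
  "Z \<alpha> \<zeta> T = Z_slices \<alpha> \<zeta> (top T) (slices T)"

end

theory Submission
  imports Defs
begin

text \<open>
  The functor \<open>Z\<close> extends linearly to combinations of tangles and respects composition and
  tensor products, so it suffices that it sends the generators of the HOMFLY-PT ideal into the MOY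
  ideal. The skein relation holds on the nose, and the circle relation is the first MOY relation.
  The curl and braid relations give R1 and R3 on upward strands; the square relation, turned by
  a right angle, gives R2 for antiparallel strands.
  The other orientations of R3 arise from turning the triangle by a sixth of a full turn, which
  exchanges its two sides, and from conjugating with a crossing, which is invertible by R2.

  Planar isotopies between concrete diagrams are checked by a verified rewriting procedure on
  slices: both diagrams are rewritten to a common one.
\<close>

section \<open>Diagrams\<close>

text \<open>The values of \<open>Z_gen\<close> on crossings that are not upward are fixed by
  convention: \<open>S Down\<close> for two downward strands, a clockwise turn for one mixed
  crossing, a counterclockwise turn for the other. Compatibility with rotation is therefore a claim,
  and it rests on \<open>S Down\<close> being the half turn of \<open>S Up\<close> in both
  directions. The same fact links the square relation, where S and its dual stand side by side, with
  R2 for antiparallel strands, where two quarter-turned copies of S are stacked. Once the pictures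
  are matched, scalar identities remain. A curl takes the value 1, which explains the prefactors in
  \<open>crossing_value\<close>; [n] + [n-2] + (\<zeta> + 1/\<zeta>)[n-1] = 0 removes the unwanted
  term of antiparallel R2; and one identity compares the two sides of R3, for flags that come from a
  height order.\<close>

lemma opp_opp [simp]: "opp (opp s) = s"
  by (cases s) auto

lemma bot_dcomp [simp]: "bot (D \<circ>\<^sub>D E) = bot E"
  and top_dcomp [simp]: "top (D \<circ>\<^sub>D E) = top D"
  and bot_dtensor [simp]: "bot (D \<otimes>\<^sub>D E) = bot D @ bot E"
  and top_dtensor [simp]: "top (D \<otimes>\<^sub>D E) = top D @ top E"
  and bot_idd [simp]: "bot (idd a) = a"
  and top_idd [simp]: "top (idd a) = a"
  by (simp_all add: dcomp_def dtensor_def idd_def)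

lemma dcomp_assoc: "D \<circ>\<^sub>D E \<circ>\<^sub>D F = D \<circ>\<^sub>D (E \<circ>\<^sub>D F)"
  by (simp add: dcomp_def)

lemma dtensor_assoc: "D \<otimes>\<^sub>D E \<otimes>\<^sub>D F = D \<otimes>\<^sub>D (E \<otimes>\<^sub>D F)"
  by (auto simp: dtensor_def)

lemma idd_dcomp: "top D = b \<Longrightarrow> idd b \<circ>\<^sub>D D = D"
  and dcomp_idd: "bot D = a \<Longrightarrow> D \<circ>\<^sub>D idd a = D"
  by (cases D; simp add: dcomp_def idd_def)+

lemma idd_dtensor_idd: "idd a \<otimes>\<^sub>D idd b = idd (a @ b)"
  by (simp add: dtensor_def idd_def)

lemma idd_Nil_dtensor [simp]: "idd [] \<otimes>\<^sub>D D = D"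
  and dtensor_idd_Nil [simp]: "D \<otimes>\<^sub>D idd [] = D"
  by (cases D; simp add: dtensor_def idd_def case_prod_beta')+

text \<open>The tensor product is defined with the slices of \<open>D\<close> below those of
  \<open>E\<close>, so this is an equality and needs no exchange of heights.\<close>

lemma dtensor_decomp: "D \<otimes>\<^sub>D E = (idd (top D) \<otimes>\<^sub>D E) \<circ>\<^sub>D (D \<otimes>\<^sub>D idd (bot E))"
  by (simp add: dtensor_def idd_def dcomp_def)

lemma dcomp_dtensor_idd: "(D \<circ>\<^sub>D E) \<otimes>\<^sub>D idd r = (D \<otimes>\<^sub>D idd r) \<circ>\<^sub>D (E \<otimes>\<^sub>D idd r)"
  and idd_dtensor_dcomp: "idd l \<otimes>\<^sub>D (D \<circ>\<^sub>D E) = (idd l \<otimes>\<^sub>D D) \<circ>\<^sub>D (idd l \<otimes>\<^sub>D E)"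
  by (simp_all add: dtensor_def idd_def dcomp_def)

lemma stacks_append:
  "stacks src tgt a (ss @ ts) c \<longleftrightarrow> (\<exists>b. stacks src tgt a ss b \<and> stacks src tgt b ts c)"
  by (induction ss arbitrary: a) auto

lemma stacks_unique: "stacks src tgt a ss b \<Longrightarrow> stacks src tgt a ss b' \<Longrightarrow> b = b'"
  by (induction ss arbitrary: a) auto

lemma stacks_whisker_right:
  "stacks src tgt a ss b \<Longrightarrow> stacks src tgt (a @ r) (map (\<lambda>(l, g, r'). (l, g, r' @ r)) ss) (b @ r)"
proof (induction ss arbitrary: a)
  case (Cons s ss)
  obtain l g r' where s: "s = (l, g, r')" by (cases s)
  show ?case
    using Cons.prems Cons.IH[of "l @ tgt g @ r'"] by (simp add: s)
qed simp

lemma stacks_whisker_left: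
  "stacks src tgt a ss b \<Longrightarrow> stacks src tgt (l @ a) (map (\<lambda>(l', g, r). (l @ l', g, r)) ss) (l @ b)"
  by (induction ss arbitrary: a) auto

lemma is_diagram_idd [simp]: "is_diagram src tgt (idd a)"
  by (simp add: is_diagram_def idd_def)

lemma is_diagram_dcomp:
  "is_diagram src tgt D \<Longrightarrow> is_diagram src tgt E \<Longrightarrow> top E = bot D \<Longrightarrow> is_diagram src tgt (D \<circ>\<^sub>D E)"
  by (auto simp: is_diagram_def dcomp_def stacks_append)

lemma is_diagram_dtensor:
  "is_diagram src tgt D \<Longrightarrow> is_diagram src tgt E \<Longrightarrow> is_diagram src tgt (D \<otimes>\<^sub>D E)"
  unfolding is_diagram_def dtensor_def stacks_append diagram.sel
  by (blast intro: stacks_whisker_right stacks_whisker_left)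

lemma is_diagram_gen [simp]: "is_diagram src tgt (gen src tgt g)"
  by (simp add: is_diagram_def gen_def)

text \<open>\<open>diagram_equiv\<close> asks nothing of its moves. Typing is required of them
  separately in this form, which then propagates to the whole congruence.\<close>

definition parallel :: "('g \<Rightarrow> 'o list) \<Rightarrow> ('g \<Rightarrow> 'o list) \<Rightarrow> ('o, 'g) diagram \<Rightarrow> ('o, 'g) diagram \<Rightarrow> bool" where
  "parallel src tgt D E \<longleftrightarrow>
     is_diagram src tgt D \<and> is_diagram src tgt E \<and> bot D = bot E \<and> top D = top E"

lemma diagram_equiv_parallel:
  assumes "diagram_equiv src tgt move D E"
    and "\<And>D E. move D E \<Longrightarrow> parallel src tgt D E"
  shows "parallel src tgt D E"
  using assms(1)
proof (induction rule: diagram_equiv.induct)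
  case (exchange D E)
  then show ?case by (simp add: parallel_def is_diagram_dcomp is_diagram_dtensor)
qed (use assms(2) in \<open>auto simp: parallel_def is_diagram_dcomp is_diagram_dtensor\<close>)

text \<open>Serves to replace the tangle moves by the larger relation \<open>Z_cong\<close>, which
  is closed under the congruence.\<close>

lemma diagram_equiv_mono:
  assumes "diagram_equiv src tgt move D E"
    and "\<And>D E. move D E \<Longrightarrow> diagram_equiv src tgt move' D E"
  shows "diagram_equiv src tgt move' D E"
  using assms(1) by induction (use assms(2) in \<open>auto intro: diagram_equiv.intros\<close>)

section \<open>Rewriting of sliced diagrams\<close>

text \<open>A window of slices is the local diagram between identities, composed with what lies
  below and above it; the congruence rules do the rest.\<close>

lemma diagram_equiv_context:
  fixes src tgt :: "'g \<Rightarrow> 'o list"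
  assumes eq: "diagram_equiv src tgt move (Diagram p ss q) (Diagram p ts q)"
    and a: "stacks src tgt a xs (l @ p @ r)" and b: "stacks src tgt (l @ q @ r) ys b"
  shows "diagram_equiv src tgt move
    (Diagram a (xs @ map (\<lambda>(l', g, r'). (l @ l', g, r' @ r)) ss @ ys) b)
    (Diagram a (xs @ map (\<lambda>(l', g, r'). (l @ l', g, r' @ r)) ts @ ys) b)"
proof -
  have form: "Diagram a (xs @ map (\<lambda>(l', g, r'). (l @ l', g, r' @ r)) us @ ys) b =
      Diagram (l @ q @ r) ys b \<circ>\<^sub>D (idd l \<otimes>\<^sub>D Diagram p us q \<otimes>\<^sub>D idd r) \<circ>\<^sub>D Diagram a xs (l @ p @ r)"
    for us :: "('o list \<times> 'g \<times> 'o list) list"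
    by (auto simp: dcomp_def dtensor_def idd_def)
  show ?thesis
    unfolding form
    by (intro diagram_equiv.comp diagram_equiv.tensor eq diagram_equiv.refl)
      (use a b in \<open>auto simp: is_diagram_def idd_def dcomp_def dtensor_def\<close>)
qed

text \<open>This is the exchange rule with the strands \<open>m\<close> between the two pieces
  counted as part of the left factor.\<close>

lemma diagram_equiv_swap_slices:
  assumes "stacks src tgt a xs (l @ src g @ m @ src h @ r)"
    and "stacks src tgt (l @ tgt g @ m @ tgt h @ r) ys b"
  shows "diagram_equiv src tgt move
    (Diagram a (xs @ (l, g, m @ src h @ r) # (l @ tgt g @ m, h, r) # ys) b)
    (Diagram a (xs @ (l @ src g @ m, h, r) # (l, g, m @ tgt h @ r) # ys) b)"
proof -
  have "diagram_equiv src tgt move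
      ((idd (top (gen src tgt g \<otimes>\<^sub>D idd m)) \<otimes>\<^sub>D gen src tgt h) \<circ>\<^sub>D
        (gen src tgt g \<otimes>\<^sub>D idd m \<otimes>\<^sub>D idd (bot (gen src tgt h))))
      ((gen src tgt g \<otimes>\<^sub>D idd m \<otimes>\<^sub>D idd (top (gen src tgt h))) \<circ>\<^sub>D
        (idd (bot (gen src tgt g \<otimes>\<^sub>D idd m)) \<otimes>\<^sub>D gen src tgt h))"
    by (intro diagram_equiv.exchange is_diagram_dtensor) auto
  then have "diagram_equiv src tgt move
      (Diagram (src g @ m @ src h) [([], g, m @ src h), (tgt g @ m, h, [])] (tgt g @ m @ tgt h))
      (Diagram (src g @ m @ src h) [(src g @ m, h, []), ([], g, m @ tgt h)] (tgt g @ m @ tgt h))"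
    by (simp add: dcomp_def dtensor_def idd_def gen_def)
  from diagram_equiv_context[OF this, of a xs l r ys b] show ?thesis
    using assms by simp
qed

text \<open>
  \<open>Swap_Right k\<close> and \<open>Swap_Left k\<close> exchange the heights of slices \<open>k\<close> and \<open>k + 1\<close>, the piece of
  slice \<open>k + 1\<close> passing to the right or to the left of the other one. This matters for a cup
  above a cap. \<open>Apply k i j\<close> and \<open>Unapply k i j\<close> use the \<open>j\<close>-th rule above the first \<open>k\<close> slices
  and to the right of the first \<open>i\<close> strands.
\<close>

datatype step = Swap_Right nat | Swap_Left nat | Apply nat nat nat | Unapply nat nat nat

primrec level :: "('g \<Rightarrow> 'o list) \<Rightarrow> 'o list \<Rightarrow> ('o list \<times> 'g \<times> 'o list) list \<Rightarrow> 'o list" where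
  "level tgt a [] = a"
| "level tgt a (s # ss) = (case s of (l, g, r) \<Rightarrow> level tgt (l @ tgt g @ r) ss)"

text \<open>The strands \<open>m\<close> between the pieces are not stored in the slices. They are
  cut out of the left context of the upper slice, and the guard then confirms both contexts.\<close>

fun swap_right :: "('g \<Rightarrow> 'o list) \<Rightarrow> ('g \<Rightarrow> 'o list) \<Rightarrow>
    ('o list \<times> 'g \<times> 'o list) list \<Rightarrow> ('o list \<times> 'g \<times> 'o list) list option" where
  "swap_right src tgt ((l, g, r) # (l', h, r') # ss) =
     (let m = drop (length l + length (tgt g)) l' in
      if l' = l @ tgt g @ m \<and> r = m @ src h @ r'
      then Some ((l @ src g @ m, h, r') # (l, g, m @ tgt h @ r') # ss) else None)"
| "swap_right src tgt _ = None"

fun swap_left :: "('g \<Rightarrow> 'o list) \<Rightarrow> ('g \<Rightarrow> 'o list) \<Rightarrow>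
    ('o list \<times> 'g \<times> 'o list) list \<Rightarrow> ('o list \<times> 'g \<times> 'o list) list option" where
  "swap_left src tgt ((l, g, r) # (l', h, r') # ss) =
     (let m = drop (length l' + length (src h)) l in
      if l = l' @ src h @ m \<and> r' = m @ tgt g @ r
      then Some ((l', h, m @ src g @ r) # (l' @ tgt h @ m, g, r) # ss) else None)"
| "swap_left src tgt _ = None"

fun apply_rule :: "nat \<Rightarrow> ('o, 'g) diagram \<times> ('o, 'g) diagram \<Rightarrow> 'o list \<Rightarrow>
    ('o list \<times> 'g \<times> 'o list) list \<Rightarrow> ('o list \<times> 'g \<times> 'o list) list option" where
  "apply_rule i (Diagram p ss q, Diagram p' ts q') c us =
     (let l = take i c; r = drop (i + length p) c;
          wh = (\<lambda>(l', g, r'). (l @ l', g, r' @ r)) in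
      if p' = p \<and> q' = q \<and> c = l @ p @ r \<and> take (length ss) us = map wh ss
      then Some (map wh ts @ drop (length ss) us) else None)"

fun step_slices :: "('g \<Rightarrow> 'o list) \<Rightarrow> ('g \<Rightarrow> 'o list) \<Rightarrow> (('o, 'g) diagram \<times> ('o, 'g) diagram) list \<Rightarrow>
    step \<Rightarrow> 'o list \<Rightarrow> ('o list \<times> 'g \<times> 'o list) list \<Rightarrow> ('o list \<times> 'g \<times> 'o list) list option" where
  "step_slices src tgt rs (Swap_Right k) a ss =
     map_option ((@) (take k ss)) (swap_right src tgt (drop k ss))"
| "step_slices src tgt rs (Swap_Left k) a ss =
     map_option ((@) (take k ss)) (swap_left src tgt (drop k ss))"
| "step_slices src tgt rs (Apply k i j) a ss =
     map_option ((@) (take k ss)) (apply_rule i (rs ! j) (level tgt a (take k ss)) (drop k ss))"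
| "step_slices src tgt rs (Unapply k i j) a ss =
     map_option ((@) (take k ss)) (apply_rule i (snd (rs ! j), fst (rs ! j)) (level tgt a (take k ss)) (drop k ss))"

text \<open>For \<open>j\<close> beyond the list, \<open>rs ! j\<close> has no usable value, so the
  index is checked apart from the rewriting itself.\<close>

fun valid_step :: "'b list \<Rightarrow> step \<Rightarrow> bool" where
  "valid_step rs (Apply k i j) = (j < length rs)"
| "valid_step rs (Unapply k i j) = (j < length rs)"
| "valid_step rs _ = True"

primrec run_steps :: "('g \<Rightarrow> 'o list) \<Rightarrow> ('g \<Rightarrow> 'o list) \<Rightarrow> (('o, 'g) diagram \<times> ('o, 'g) diagram) list \<Rightarrow>
    step list \<Rightarrow> 'o list \<Rightarrow> ('o list \<times> 'g \<times> 'o list) list \<Rightarrow> ('o list \<times> 'g \<times> 'o list) list option" where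
  "run_steps src tgt rs [] a ss = Some ss"
| "run_steps src tgt rs (x # xs) a ss =
     (case step_slices src tgt rs x a ss of None \<Rightarrow> None | Some ts \<Rightarrow> run_steps src tgt rs xs a ts)"

lemma level_stacks: "stacks src tgt a ss b \<Longrightarrow> level tgt a ss = b"
  by (induction ss arbitrary: a) auto

lemma apply_rule_sound:
  fixes src tgt :: "'g \<Rightarrow> 'o list"
  assumes "diagram_equiv src tgt move D E" and par: "parallel src tgt D E"
    and "apply_rule i (D, E) c us = Some vs"
    and a: "stacks src tgt a xs c" and b: "stacks src tgt c us b"
  shows "diagram_equiv src tgt move (Diagram a (xs @ us) b) (Diagram a (xs @ vs) b)"
proof -
  obtain p ss q p' ts q' where D: "D = Diagram p ss q" and E: "E = Diagram p' ts q'"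
    by (metis diagram.exhaust)
  define l r where "l = take i c" and "r = drop (i + length p) c"
  define wh :: "'o list \<times> 'g \<times> 'o list \<Rightarrow> _" where "wh = (\<lambda>(l', g, r'). (l @ l', g, r' @ r))"
  have eqs: "p' = p" "q' = q" and c: "c = l @ p @ r"
    and us: "take (length ss) us = map wh ss" and vs: "vs = map wh ts @ drop (length ss) us"
    using assms(3) by (simp_all add: D E Let_def l_def r_def wh_def split: if_splits)
  define ys where "ys = drop (length ss) us"
  have us': "us = map wh ss @ ys"
    unfolding ys_def us[symmetric] by simp
  have "stacks src tgt p ss q"
    using par by (auto simp: parallel_def D is_diagram_def)
  from stacks_whisker_left[OF stacks_whisker_right[OF this, of r], of l]
  have "stacks src tgt c (map wh ss) (l @ q @ r)"
    by (simp add: c wh_def comp_def case_prod_beta')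
  \<comment> \<open>The object above the window is determined by the slices below it, so the
    remaining slices must start there.\<close>
  then have "stacks src tgt (l @ q @ r) ys b"
    using b by (auto simp: us' stacks_append dest: stacks_unique)
  with diagram_equiv_context[of src tgt move p ss q ts a xs l r ys b] show ?thesis
    using assms(1) a by (simp add: us' vs D E eqs ys_def[symmetric] c wh_def)
qed

lemma step_slices_sound:
  assumes rules: "\<And>D E. (D, E) \<in> set rs \<Longrightarrow> diagram_equiv src tgt move D E \<and> parallel src tgt D E"
    and valid: "valid_step rs x" and st: "stacks src tgt a ss b"
    and step: "step_slices src tgt rs x a ss = Some ts"
  shows "diagram_equiv src tgt move (Diagram a ss b) (Diagram a ts b)"
proof -
  have split: "\<exists>c. stacks src tgt a (take k ss) c \<and> stacks src tgt c (drop k ss) b" for k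
    using st stacks_append[of src tgt a "take k ss" "drop k ss" b] by simp
  show ?thesis
  proof (cases x)
    case (Swap_Right k)
    with step obtain vs where vs: "swap_right src tgt (drop k ss) = Some vs" "ts = take k ss @ vs"
      by auto
    then obtain l g r l' h r' us where us: "drop k ss = (l, g, r) # (l', h, r') # us"
      by (cases "(src, tgt, drop k ss)" rule: swap_right.cases) auto
    define m where "m = drop (length l + length (tgt g)) l'"
    have e: "l' = l @ tgt g @ m" "r = m @ src h @ r'"
      "vs = (l @ src g @ m, h, r') # (l, g, m @ tgt h @ r') # us"
      using vs(1) by (simp_all add: us Let_def m_def split: if_splits)
    have ss: "ss = take k ss @ (l, g, m @ src h @ r') # (l @ tgt g @ m, h, r') # us"
      using us e append_take_drop_id[of k ss] by simp
    show ?thesis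
      using diagram_equiv_swap_slices[of src tgt a "take k ss" l g m h r' us b move] split[of k] us
      by (subst ss) (auto simp: vs(2) e)
  next
    case (Swap_Left k)
    with step obtain vs where vs: "swap_left src tgt (drop k ss) = Some vs" "ts = take k ss @ vs"
      by auto
    then obtain l g r l' h r' us where us: "drop k ss = (l, g, r) # (l', h, r') # us"
      by (cases "(src, tgt, drop k ss)" rule: swap_left.cases) auto
    define m where "m = drop (length l' + length (src h)) l"
    have e: "l = l' @ src h @ m" "r' = m @ tgt g @ r"
      "vs = (l', h, m @ src g @ r) # (l' @ tgt h @ m, g, r) # us"
      using vs(1) by (simp_all add: us Let_def m_def split: if_splits)
    have ss: "ss = take k ss @ (l' @ src h @ m, g, r) # (l', h, m @ tgt g @ r) # us"
      using us e append_take_drop_id[of k ss] by simp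
    show ?thesis
      using diagram_equiv_swap_slices[of src tgt a "take k ss" l' h m g r us b move, THEN diagram_equiv.sym]
        split[of k] us
      by (subst ss) (auto simp: vs(2) e)
  next
    case (Apply k i j)
    obtain c where c: "stacks src tgt a (take k ss) c" "stacks src tgt c (drop k ss) b"
      using split by blast
    obtain D E where DE: "rs ! j = (D, E)" by force
    have "(D, E) \<in> set rs"
      using valid Apply by (simp flip: DE)
    moreover obtain vs where "apply_rule i (D, E) c (drop k ss) = Some vs" "ts = take k ss @ vs"
      using step Apply level_stacks[OF c(1)] DE by auto
    ultimately show ?thesis
      using apply_rule_sound[of src tgt move D E i c "drop k ss" vs a "take k ss" b] rules c by simp
  next
    case (Unapply k i j)
    obtain c where c: "stacks src tgt a (take k ss) c" "stacks src tgt c (drop k ss) b"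
      using split by blast
    obtain D E where DE: "rs ! j = (D, E)" by force
    have "(D, E) \<in> set rs"
      using valid Unapply by (simp flip: DE)
    then have "diagram_equiv src tgt move E D" "parallel src tgt E D"
      using rules diagram_equiv.sym by (fastforce simp: parallel_def)+
    moreover obtain vs where "apply_rule i (E, D) c (drop k ss) = Some vs" "ts = take k ss @ vs"
      using step Unapply level_stacks[OF c(1)] DE by auto
    ultimately show ?thesis
      using apply_rule_sound[of src tgt move E D i c "drop k ss" vs a "take k ss" b] c by simp
  qed
qed

lemma run_steps_sound:
  assumes moves: "\<And>D E. move D E \<Longrightarrow> parallel src tgt D E"
    and rules: "\<And>D E. (D, E) \<in> set rs \<Longrightarrow> diagram_equiv src tgt move D E"
    and "list_all (valid_step rs) xs" and "stacks src tgt a ss b"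
    and "run_steps src tgt rs xs a ss = Some ts"
  shows "diagram_equiv src tgt move (Diagram a ss b) (Diagram a ts b)"
  using assms(3-)
proof (induction xs arbitrary: ss)
  case Nil
  then show ?case
    by (simp add: diagram_equiv.refl is_diagram_def)
next
  case (Cons x xs)
  then obtain us where us: "step_slices src tgt rs x a ss = Some us"
    "run_steps src tgt rs xs a us = Some ts"
    by (auto split: option.splits)
  have 1: "diagram_equiv src tgt move (Diagram a ss b) (Diagram a us b)"
    using step_slices_sound[OF _ _ _ us(1), of move b] rules Cons.prems
    by (simp add: diagram_equiv_parallel[OF rules moves])
  \<comment> \<open>Congruent diagrams have the same ends and are well formed, so the next step
    again starts from a valid stack.\<close>
  then have "stacks src tgt a us b"
    using diagram_equiv_parallel[OF 1 moves] by (simp add: parallel_def is_diagram_def)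
  then show ?case
    using 1 Cons us(2) by (auto intro: diagram_equiv.trans)
qed

text \<open>An evaluable certificate: the step lists are supplied at each use and the simplifier
  checks everything, with the direction \<open>s\<close> left as a variable. The condition
  \<open>\<noteq> None\<close> keeps two failing runs from counting as agreement.\<close>

definition joins :: "('g \<Rightarrow> 'o list) \<Rightarrow> ('g \<Rightarrow> 'o list) \<Rightarrow> (('o, 'g) diagram \<times> ('o, 'g) diagram) list \<Rightarrow>
    step list \<Rightarrow> step list \<Rightarrow> ('o, 'g) diagram \<Rightarrow> ('o, 'g) diagram \<Rightarrow> bool" where
  "joins src tgt rs xs ys D E \<longleftrightarrow> list_all (valid_step rs) xs \<and> list_all (valid_step rs) ys \<and>
     is_diagram src tgt D \<and> is_diagram src tgt E \<and> bot D = bot E \<and> top D = top E \<and>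
     run_steps src tgt rs xs (bot D) (slices D) \<noteq> None \<and>
     run_steps src tgt rs xs (bot D) (slices D) = run_steps src tgt rs ys (bot E) (slices E)"

lemma joins_sound:
  assumes "\<And>D E. move D E \<Longrightarrow> parallel src tgt D E"
    and "\<And>D E. (D, E) \<in> set rs \<Longrightarrow> diagram_equiv src tgt move D E"
    and j: "joins src tgt rs xs ys D E"
  shows "diagram_equiv src tgt move D E"
proof -
  obtain ss where ss: "run_steps src tgt rs xs (bot D) (slices D) = Some ss"
    "run_steps src tgt rs ys (bot E) (slices E) = Some ss"
    using j unfolding joins_def by auto
  have "diagram_equiv src tgt move (Diagram (bot D) (slices D) (top D)) (Diagram (bot D) ss (top D))"
    and "diagram_equiv src tgt move (Diagram (bot E) (slices E) (top E)) (Diagram (bot E) ss (top E))"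
    using j run_steps_sound[OF assms(1,2) _ _ ss(1)] run_steps_sound[OF assms(1,2) _ _ ss(2)]
    unfolding joins_def is_diagram_def by metis+
  then show ?thesis
    using j by (auto simp: joins_def intro: diagram_equiv.trans diagram_equiv.sym)
qed

section \<open>Linear combinations of diagrams\<close>

lemma lookup_scale [simp]: "Poly_Mapping.lookup (c \<odot> f) D = c * Poly_Mapping.lookup f D"
  by (simp add: scale_def Poly_Mapping.map.rep_eq when_def)

lemma scale_add_right: "c \<odot> (f + g) = c \<odot> f + c \<odot> g"
  and scale_add_left: "(c + d) \<odot> f = c \<odot> f + d \<odot> f"
  and scale_diff_right: "c \<odot> (f - g) = c \<odot> f - c \<odot> g"
  and scale_scale: "c \<odot> d \<odot> f = (c * d) \<odot> f"
  and scale_one [simp]: "1 \<odot> f = f"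
  and scale_zero_left [simp]: "0 \<odot> f = 0"
  and scale_zero_right [simp]: "c \<odot> 0 = 0"
  and scale_minus_one: "(- 1) \<odot> f = - f"
  by (rule poly_mapping_eqI; simp add: algebra_simps lookup_add lookup_minus)+

lemma scale_single: "c \<odot> Poly_Mapping.single D d = Poly_Mapping.single D (c * d)"
  by (rule poly_mapping_eqI) (simp add: lookup_single when_def)

lemma scale_sum: "c \<odot> (\<Sum>i\<in>I. f i) = (\<Sum>i\<in>I. c \<odot> f i)"
  by (induction I rule: infinite_finite_induct) (simp_all add: scale_add_right)

text \<open>Both products of linear combinations are instances, so bilinearity is proved only
  once.\<close>

definition bilin :: "('a \<Rightarrow> 'b \<Rightarrow> 'c) \<Rightarrow> ('a \<Rightarrow>\<^sub>0 'r::comm_ring_1) \<Rightarrow> ('b \<Rightarrow>\<^sub>0 'r) \<Rightarrow> 'c \<Rightarrow>\<^sub>0 'r" where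
  "bilin h f g = (\<Sum>D\<in>Poly_Mapping.keys f. \<Sum>E\<in>Poly_Mapping.keys g.
     Poly_Mapping.single (h D E) (Poly_Mapping.lookup f D * Poly_Mapping.lookup g E))"

lemma lcomp_bilin: "f \<circ>\<^sub>L g = bilin (\<circ>\<^sub>D) f g"
  and ltensor_bilin: "f \<otimes>\<^sub>L g = bilin (\<otimes>\<^sub>D) f g"
  by (simp_all add: lcomp_def ltensor_def bilin_def)

text \<open>Keys may cancel in a sum or vanish under a scalar. Summing over common finite supersets
  makes the supports agree, and the additional terms are zero.\<close>

lemma bilin_superset:
  assumes "finite A" "finite B" "Poly_Mapping.keys f \<subseteq> A" "Poly_Mapping.keys g \<subseteq> B"
  shows "bilin h f g = (\<Sum>D\<in>A. \<Sum>E\<in>B.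
    Poly_Mapping.single (h D E) (Poly_Mapping.lookup f D * Poly_Mapping.lookup g E))"
proof -
  have "bilin h f g = (\<Sum>D\<in>Poly_Mapping.keys f. \<Sum>E\<in>B.
      Poly_Mapping.single (h D E) (Poly_Mapping.lookup f D * Poly_Mapping.lookup g E))"
    unfolding bilin_def using assms
    by (intro sum.cong sum.mono_neutral_left) (auto simp: in_keys_iff)
  also have "\<dots> = (\<Sum>D\<in>A. \<Sum>E\<in>B.
      Poly_Mapping.single (h D E) (Poly_Mapping.lookup f D * Poly_Mapping.lookup g E))"
    using assms by (intro sum.mono_neutral_left) (auto simp: in_keys_iff)
  finally show ?thesis .
qed

lemma keys_scale: "Poly_Mapping.keys (c \<odot> f) \<subseteq> Poly_Mapping.keys f"
  by (auto simp: in_keys_iff)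

lemma keys_diff_subset: "Poly_Mapping.keys (f - g) \<subseteq> Poly_Mapping.keys f \<union> Poly_Mapping.keys g"
  by (auto simp: in_keys_iff lookup_minus)

lemma bilin_add_left: "bilin h (f + f') g = bilin h f g + bilin h f' g"
proof -
  let ?A = "Poly_Mapping.keys f \<union> Poly_Mapping.keys f'" and ?B = "Poly_Mapping.keys g"
  show ?thesis
    using keys_add[of f f']
    by (simp add: bilin_superset[of ?A ?B] lookup_add distrib_right single_add sum.distrib)
qed

lemma bilin_add_right: "bilin h f (g + g') = bilin h f g + bilin h f g'"
proof -
  let ?A = "Poly_Mapping.keys f" and ?B = "Poly_Mapping.keys g \<union> Poly_Mapping.keys g'"
  show ?thesis
    using keys_add[of g g']
    by (simp add: bilin_superset[of ?A ?B] lookup_add distrib_left single_add sum.distrib)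
qed

lemma bilin_scale_left: "bilin h (c \<odot> f) g = c \<odot> bilin h f g"
  using keys_scale[of c f]
  by (simp add: bilin_superset[of "Poly_Mapping.keys f" "Poly_Mapping.keys g"] scale_sum scale_single
      mult.assoc)

lemma bilin_scale_right: "bilin h f (c \<odot> g) = c \<odot> bilin h f g"
  using keys_scale[of c g]
  by (simp add: bilin_superset[of "Poly_Mapping.keys f" "Poly_Mapping.keys g"] scale_sum scale_single
      mult.left_commute)

lemma bilin_diff_left: "bilin h (f - f') g = bilin h f g - bilin h f' g"
  using bilin_add_left[of h f "(-1) \<odot> f'" g] bilin_scale_left[of h "-1" f' g]
  by (simp add: scale_minus_one)

lemma bilin_diff_right: "bilin h f (g - g') = bilin h f g - bilin h f g'"
  using bilin_add_right[of h f g "(-1) \<odot> g'"] bilin_scale_right[of h f "-1" g']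
  by (simp add: scale_minus_one)

lemma bilin_zero_left [simp]: "bilin h 0 g = 0"
  and bilin_zero_right [simp]: "bilin h f 0 = 0"
  by (simp_all add: bilin_def)

lemma bilin_single: "bilin h (Poly_Mapping.single D c) (Poly_Mapping.single E d) =
    Poly_Mapping.single (h D E) (c * d)"
  by (simp add: bilin_superset[of "{D}" "{E}"])

lemma lcomp_simps:
  "(f + f') \<circ>\<^sub>L g = f \<circ>\<^sub>L g + f' \<circ>\<^sub>L g" "f \<circ>\<^sub>L (g + g') = f \<circ>\<^sub>L g + f \<circ>\<^sub>L g'"
  "(f - f') \<circ>\<^sub>L g = f \<circ>\<^sub>L g - f' \<circ>\<^sub>L g" "f \<circ>\<^sub>L (g - g') = f \<circ>\<^sub>L g - f \<circ>\<^sub>L g'"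
  "(c \<odot> f) \<circ>\<^sub>L g = c \<odot> (f \<circ>\<^sub>L g)" "f \<circ>\<^sub>L (c \<odot> g) = c \<odot> (f \<circ>\<^sub>L g)"
  "0 \<circ>\<^sub>L g = 0" "f \<circ>\<^sub>L 0 = 0"
  "lc D \<circ>\<^sub>L lc E = lc (D \<circ>\<^sub>D E)"
  by (simp_all add: lcomp_bilin bilin_add_left bilin_add_right bilin_scale_left bilin_scale_right
      bilin_diff_left bilin_diff_right bilin_single)

lemma ltensor_simps:
  "(f + f') \<otimes>\<^sub>L g = f \<otimes>\<^sub>L g + f' \<otimes>\<^sub>L g" "f \<otimes>\<^sub>L (g + g') = f \<otimes>\<^sub>L g + f \<otimes>\<^sub>L g'"
  "(f - f') \<otimes>\<^sub>L g = f \<otimes>\<^sub>L g - f' \<otimes>\<^sub>L g" "f \<otimes>\<^sub>L (g - g') = f \<otimes>\<^sub>L g - f \<otimes>\<^sub>L g'"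
  "(c \<odot> f) \<otimes>\<^sub>L g = c \<odot> (f \<otimes>\<^sub>L g)" "f \<otimes>\<^sub>L (c \<odot> g) = c \<odot> (f \<otimes>\<^sub>L g)"
  "0 \<otimes>\<^sub>L g = 0" "f \<otimes>\<^sub>L 0 = 0"
  "lc D \<otimes>\<^sub>L lc E = lc (D \<otimes>\<^sub>D E)"
  by (simp_all add: ltensor_bilin bilin_add_left bilin_add_right bilin_scale_left bilin_scale_right
      bilin_diff_left bilin_diff_right bilin_single)

section \<open>Hom spaces and induction over linear combinations\<close>

lemma hom_zero [simp]: "0 \<in> hom P a b"
  by (simp add: hom_def)

lemma hom_add: "f \<in> hom P a b \<Longrightarrow> g \<in> hom P a b \<Longrightarrow> f + g \<in> hom P a b"
  using keys_add[of f g] by (auto simp: hom_def)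

lemma hom_diff: "f \<in> hom P a b \<Longrightarrow> g \<in> hom P a b \<Longrightarrow> f - g \<in> hom P a b"
  using keys_diff_subset[of f g] by (auto simp: hom_def)

lemma hom_scale: "f \<in> hom P a b \<Longrightarrow> c \<odot> f \<in> hom P a b"
  using keys_scale[of c f] by (auto simp: hom_def)

lemma hom_lc: "P D \<Longrightarrow> bot D = a \<Longrightarrow> top D = b \<Longrightarrow> lc D \<in> hom P a b"
  by (auto simp: hom_def)

lemma linear_induct [consumes 1, case_names lc zero add scale]:
  assumes f: "Poly_Mapping.keys f \<subseteq> K"
    and lc: "\<And>D. D \<in> K \<Longrightarrow> Q (lc D)"
    and zero: "Q 0"
    and add: "\<And>f g. Poly_Mapping.keys f \<subseteq> K \<Longrightarrow> Poly_Mapping.keys g \<subseteq> K \<Longrightarrow> Q f \<Longrightarrow> Q g \<Longrightarrow> Q (f + g)"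
    and scale: "\<And>c f. Poly_Mapping.keys f \<subseteq> K \<Longrightarrow> Q f \<Longrightarrow> Q (c \<odot> f)"
  shows "Q f"
proof -
  \<comment> \<open>The support bound is carried along because the hypothesis \<open>add\<close>
    demands it of both summands.\<close>
  have "A \<subseteq> K \<Longrightarrow>
      Poly_Mapping.keys (\<Sum>D\<in>A. Poly_Mapping.lookup f D \<odot> lc D) \<subseteq> K \<and>
      Q (\<Sum>D\<in>A. Poly_Mapping.lookup f D \<odot> lc D)" if "finite A" for A
    using that
  proof (induction A rule: finite_induct)
    case (insert D A)
    have "Poly_Mapping.keys (Poly_Mapping.lookup f D \<odot> lc D) \<subseteq> K"
      using insert.prems by (auto simp: in_keys_iff lookup_single when_def split: if_splits)
    moreover have "Q (Poly_Mapping.lookup f D \<odot> lc D)"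
      using insert.prems by (intro scale lc) (auto split: if_splits)
    ultimately show ?case
      using insert keys_add[of "Poly_Mapping.lookup f D \<odot> lc D" "\<Sum>D\<in>A. Poly_Mapping.lookup f D \<odot> lc D"]
      by (auto intro!: add)
  qed (simp add: zero)
  moreover have "(\<Sum>D\<in>Poly_Mapping.keys f. Poly_Mapping.lookup f D \<odot> lc D) = f"
    by (rule poly_mapping_eqI)
      (simp add: lookup_sum lookup_single when_def in_keys_iff if_distrib[of "(*) _"] cong: if_cong)
  ultimately show ?thesis
    using f by (metis finite_keys)
qed

lemma hom_induct [consumes 1, case_names lc zero add scale]:
  assumes "f \<in> hom P a b"
    and "\<And>D. P D \<Longrightarrow> bot D = a \<Longrightarrow> top D = b \<Longrightarrow> Q (lc D)"
    and "Q 0"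
    and "\<And>f g. f \<in> hom P a b \<Longrightarrow> g \<in> hom P a b \<Longrightarrow> Q f \<Longrightarrow> Q g \<Longrightarrow> Q (f + g)"
    and "\<And>c f. f \<in> hom P a b \<Longrightarrow> Q f \<Longrightarrow> Q (c \<odot> f)"
  shows "Q f"
proof -
  have hom: "f \<in> hom P a b \<longleftrightarrow> Poly_Mapping.keys f \<subseteq> {D. P D \<and> bot D = a \<and> top D = b}" for f
    by (auto simp: hom_def)
  show ?thesis
    using assms unfolding hom by (induction rule: linear_induct) auto
qed

lemma linear_eqI:
  assumes "\<And>D. F (lc D) = G (lc D)"
    and "F 0 = 0" "G 0 = 0"
    and "\<And>f g. F (f + g) = F f + F g" "\<And>f g. G (f + g) = G f + G g"
    and "\<And>c f. F (c \<odot> f) = c \<odot> F f" "\<And>c f. G (c \<odot> f) = c \<odot> G f"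
  shows "F f = G f"
  by (rule linear_induct[of f UNIV]) (use assms in auto)

lemma lcomp_assoc: "f \<circ>\<^sub>L g \<circ>\<^sub>L h = f \<circ>\<^sub>L (g \<circ>\<^sub>L h)"
proof (rule linear_eqI[of _ _ f])
  fix D
  show "lc D \<circ>\<^sub>L g \<circ>\<^sub>L h = lc D \<circ>\<^sub>L (g \<circ>\<^sub>L h)"
  proof (rule linear_eqI[of _ _ g])
    fix E
    show "lc D \<circ>\<^sub>L lc E \<circ>\<^sub>L h = lc D \<circ>\<^sub>L (lc E \<circ>\<^sub>L h)"
      by (rule linear_eqI[of _ _ h]) (simp_all add: lcomp_simps dcomp_assoc)
  qed (simp_all add: lcomp_simps)
qed (simp_all add: lcomp_simps)

lemma ltensor_assoc: "f \<otimes>\<^sub>L g \<otimes>\<^sub>L h = f \<otimes>\<^sub>L (g \<otimes>\<^sub>L h)"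
proof (rule linear_eqI[of _ _ f])
  fix D
  show "lc D \<otimes>\<^sub>L g \<otimes>\<^sub>L h = lc D \<otimes>\<^sub>L (g \<otimes>\<^sub>L h)"
  proof (rule linear_eqI[of _ _ g])
    fix E
    show "lc D \<otimes>\<^sub>L lc E \<otimes>\<^sub>L h = lc D \<otimes>\<^sub>L (lc E \<otimes>\<^sub>L h)"
      by (rule linear_eqI[of _ _ h]) (simp_all add: ltensor_simps dtensor_assoc)
  qed (simp_all add: ltensor_simps)
qed (simp_all add: ltensor_simps)

lemma lc_idd_Nil_ltensor [simp]: "lc (idd []) \<otimes>\<^sub>L f = f"
  and ltensor_lc_idd_Nil [simp]: "f \<otimes>\<^sub>L lc (idd []) = f"
  by (rule linear_eqI[of _ _ f]; simp add: ltensor_simps)+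

lemma lcomp_ltensor_idd: "(f \<circ>\<^sub>L g) \<otimes>\<^sub>L lc (idd r) = (f \<otimes>\<^sub>L lc (idd r)) \<circ>\<^sub>L (g \<otimes>\<^sub>L lc (idd r))"
proof (rule linear_eqI[of _ _ f])
  fix D
  show "(lc D \<circ>\<^sub>L g) \<otimes>\<^sub>L lc (idd r) = (lc D \<otimes>\<^sub>L lc (idd r)) \<circ>\<^sub>L (g \<otimes>\<^sub>L lc (idd r))"
    by (rule linear_eqI[of _ _ g]) (simp_all add: lcomp_simps ltensor_simps dcomp_dtensor_idd)
qed (simp_all add: lcomp_simps ltensor_simps)

lemma idd_ltensor_lcomp: "lc (idd l) \<otimes>\<^sub>L (f \<circ>\<^sub>L g) = (lc (idd l) \<otimes>\<^sub>L f) \<circ>\<^sub>L (lc (idd l) \<otimes>\<^sub>L g)"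
proof (rule linear_eqI[of _ _ f])
  fix D
  show "lc (idd l) \<otimes>\<^sub>L (lc D \<circ>\<^sub>L g) = (lc (idd l) \<otimes>\<^sub>L lc D) \<circ>\<^sub>L (lc (idd l) \<otimes>\<^sub>L g)"
    by (rule linear_eqI[of _ _ g]) (simp_all add: lcomp_simps ltensor_simps idd_dtensor_dcomp)
qed (simp_all add: lcomp_simps ltensor_simps)

lemma idd_lcomp: "f \<in> hom P a b \<Longrightarrow> lc (idd b) \<circ>\<^sub>L f = f"
  by (induction rule: hom_induct) (simp_all add: lcomp_simps idd_dcomp)

lemma lcomp_idd: "f \<in> hom P a b \<Longrightarrow> f \<circ>\<^sub>L lc (idd a) = f"
  by (induction rule: hom_induct) (simp_all add: lcomp_simps dcomp_idd)

lemma ltensor_decomp: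
  assumes "f \<in> hom P a b" "g \<in> hom P c d"
  shows "f \<otimes>\<^sub>L g = (lc (idd b) \<otimes>\<^sub>L g) \<circ>\<^sub>L (f \<otimes>\<^sub>L lc (idd c))"
  using assms(1)
proof (induction rule: hom_induct)
  case D: (lc D)
  from assms(2) D show ?case
  proof (induction rule: hom_induct)
    case (lc E)
    then show ?case
      by (simp add: lcomp_simps ltensor_simps) (metis dtensor_decomp)
  qed (simp_all add: lcomp_simps ltensor_simps)
qed (simp_all add: lcomp_simps ltensor_simps)

text \<open>Closure under both products but not under identities, because \<open>is_tgraph\<close>
  rejects the identity of a 2-labelled strand.\<close>

definition monoidal :: "(('o, 'g) diagram \<Rightarrow> bool) \<Rightarrow> bool" where
  "monoidal P \<longleftrightarrow> (\<forall>D E. P D \<longrightarrow> P E \<longrightarrow> P (D \<otimes>\<^sub>D E) \<and> (bot D = top E \<longrightarrow> P (D \<circ>\<^sub>D E)))"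

lemma hom_lcomp:
  assumes "monoidal P" "f \<in> hom P b c" "g \<in> hom P a b"
  shows "f \<circ>\<^sub>L g \<in> hom P a c"
  using assms(2)
proof (induction rule: hom_induct)
  case D: (lc D)
  from assms(3) D assms(1) show ?case
    by (induction rule: hom_induct) (auto simp: lcomp_simps monoidal_def intro: hom_lc hom_add hom_scale)
qed (simp_all add: lcomp_simps hom_add hom_scale)

lemma hom_ltensor:
  assumes "monoidal P" "f \<in> hom P a b" "g \<in> hom P c d"
  shows "f \<otimes>\<^sub>L g \<in> hom P (a @ c) (b @ d)"
  using assms(2)
proof (induction rule: hom_induct)
  case D: (lc D)
  from assms(3) D assms(1) show ?case
    by (induction rule: hom_induct) (auto simp: ltensor_simps monoidal_def intro: hom_lc hom_add hom_scale)
qed (simp_all add: ltensor_simps hom_add hom_scale)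

lemma tensor_ideal_hom: "monoidal P \<Longrightarrow> tensor_ideal P Rel a b f \<Longrightarrow> f \<in> hom P a b"
  by (rotate_tac, induction rule: tensor_ideal.induct)
    (auto intro: hom_add hom_scale hom_lcomp hom_ltensor)

section \<open>Congruence modulo a tensor ideal\<close>

text \<open>Membership of \<open>f - g\<close> in the ideal does not make \<open>f\<close> and
  \<open>g\<close> themselves morphisms from \<open>a\<close> to \<open>b\<close>, yet the product
  rules of the ideal ask for this; hence the two \<open>hom\<close> conditions.\<close>

definition ideal_eq :: "(('o, 'g) diagram \<Rightarrow> bool) \<Rightarrow> (('o, 'g) diagram \<Rightarrow>\<^sub>0 'r::comm_ring_1) set \<Rightarrow>
    'o list \<Rightarrow> 'o list \<Rightarrow> (('o, 'g) diagram \<Rightarrow>\<^sub>0 'r) \<Rightarrow> (('o, 'g) diagram \<Rightarrow>\<^sub>0 'r) \<Rightarrow> bool" where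
  "ideal_eq P Rel a b f g \<longleftrightarrow> f \<in> hom P a b \<and> g \<in> hom P a b \<and> tensor_ideal P Rel a b (f - g)"

lemma ideal_eq_refl: "f \<in> hom P a b \<Longrightarrow> ideal_eq P Rel a b f f"
  by (simp add: ideal_eq_def tensor_ideal.zero)

lemma ideal_eq_sym: "ideal_eq P Rel a b f g \<Longrightarrow> ideal_eq P Rel a b g f"
  using tensor_ideal.scale[of P Rel a b "f - g" "-1"] by (simp add: ideal_eq_def scale_minus_one)

lemma ideal_eq_trans [trans]:
  "ideal_eq P Rel a b f g \<Longrightarrow> ideal_eq P Rel a b g h \<Longrightarrow> ideal_eq P Rel a b f h"
  using tensor_ideal.add[of P Rel a b "f - g" "g - h"] by (simp add: ideal_eq_def)

lemma ideal_eq_add: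
  "ideal_eq P Rel a b f f' \<Longrightarrow> ideal_eq P Rel a b g g' \<Longrightarrow> ideal_eq P Rel a b (f + g) (f' + g')"
  using tensor_ideal.add[of P Rel a b "f - f'" "g - g'"]
  by (simp add: ideal_eq_def hom_add algebra_simps)

lemma ideal_eq_scale: "ideal_eq P Rel a b f g \<Longrightarrow> ideal_eq P Rel a b (c \<odot> f) (c \<odot> g)"
  using tensor_ideal.scale[of P Rel a b "f - g" c]
  by (simp add: ideal_eq_def hom_scale scale_diff_right)

lemma ideal_eq_lcomp:
  assumes P: "monoidal P" and f: "ideal_eq P Rel b c f f'" and g: "ideal_eq P Rel a b g g'"
  shows "ideal_eq P Rel a c (f \<circ>\<^sub>L g) (f' \<circ>\<^sub>L g')"
proof -
  have "f \<circ>\<^sub>L g - f' \<circ>\<^sub>L g' = (f - f') \<circ>\<^sub>L g + f' \<circ>\<^sub>L (g - g')"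
    by (simp add: lcomp_simps)
  with f g hom_lcomp[OF P] show ?thesis
    unfolding ideal_eq_def
    by (auto intro: tensor_ideal.add tensor_ideal.comp_left tensor_ideal.comp_right)
qed

lemma ideal_eq_ltensor:
  assumes P: "monoidal P" and f: "ideal_eq P Rel a b f f'" and g: "ideal_eq P Rel c d g g'"
  shows "ideal_eq P Rel (a @ c) (b @ d) (f \<otimes>\<^sub>L g) (f' \<otimes>\<^sub>L g')"
proof -
  have "f \<otimes>\<^sub>L g - f' \<otimes>\<^sub>L g' = (f - f') \<otimes>\<^sub>L g + f' \<otimes>\<^sub>L (g - g')"
    by (simp add: ltensor_simps)
  with f g hom_ltensor[OF P] show ?thesis
    unfolding ideal_eq_def
    by (auto intro: tensor_ideal.add tensor_ideal.tensor_left tensor_ideal.tensor_right)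
qed

lemma ideal_eq_relator:
  "f - g \<in> Rel \<Longrightarrow> f \<in> hom P a b \<Longrightarrow> g \<in> hom P a b \<Longrightarrow> ideal_eq P Rel a b f g"
  by (simp add: ideal_eq_def hom_diff tensor_ideal.relator)

section \<open>The functor to the MOY category\<close>

lemma unit_inv_eq:
  assumes "(x::'r::comm_ring_1) * y = 1"
  shows "unit_inv x = y"
  unfolding unit_inv_def
proof (rule the_equality)
  fix y' assume "x * y' = 1"
  then have "y' = y' * (x * y)" using assms by simp
  also have "\<dots> = y"
    using \<open>x * y' = 1\<close> by (metis mult.assoc mult.commute mult_1)
  finally show "y' = y" .
qed (rule assms)

lemma mult_unit_inv: "(x::'r::comm_ring_1) dvd 1 \<Longrightarrow> x * unit_inv x = 1"
  by (metis dvdE unit_inv_eq)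

text \<open>The action of the functor on objects.\<close>

abbreviation thin :: "dir list \<Rightarrow> strand list" where
  "thin \<equiv> map (\<lambda>s. (s, L1))"

lemma ids_append: "ids a \<otimes>\<^sub>D ids b = ids (a @ b)"
  by (simp add: ids_def idd_dtensor_idd)

lemma bot_ids [simp]: "bot (ids a) = thin a"
  and top_ids [simp]: "top (ids a) = thin a"
  by (simp_all add: ids_def)

lemma monoidal_tangle: "monoidal is_tangle"
  by (auto simp: monoidal_def is_diagram_dtensor is_diagram_dcomp)

lemma monoidal_tgraph: "monoidal is_tgraph"
  by (auto simp: monoidal_def is_tgraph_def is_diagram_dtensor is_diagram_dcomp)

lemmas hom_tgraph_lcomp = hom_lcomp[OF monoidal_tgraph]
  and hom_tgraph_ltensor = hom_ltensor[OF monoidal_tgraph]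

lemma is_tgraph_ids [simp]: "is_tgraph (ids a)"
  by (auto simp: is_tgraph_def ids_def)

lemma hom_ids [simp]: "lc (ids a) \<in> hom is_tgraph (thin a) (thin a)"
  by (simp add: hom_lc)

lemma bot_gen [simp]: "bot (gen src tgt g) = src g"
  and top_gen [simp]: "top (gen src tgt g) = tgt g"
  by (simp_all add: gen_def)

lemma is_tgraph_S: "is_tgraph (S s)" "bot (S s) = thin [s, s]" "top (S s) = thin [s, s]"
  by (simp_all add: is_tgraph_def S_def is_diagram_dcomp)

lemma hom_crossing_value: "crossing_value \<alpha> \<zeta> s p \<in> hom is_tgraph (thin [s, s]) (thin [s, s])"
  unfolding crossing_value_def using hom_ids[of "[s, s]"] is_tgraph_S[of s]
  by (auto simp del: hom_ids intro!: hom_scale hom_add hom_lc)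

section \<open>Z as a strict monoidal functor on sliced tangles\<close>

lemma hom_Z_gen: "Z_gen \<alpha> \<zeta> g \<in> hom is_tgraph (thin (tsrc g)) (thin (ttgt g))"
proof (cases "(\<alpha>, \<zeta>, g)" rule: Z_gen.cases)
  case (5 \<alpha> \<zeta> p)
  have "lc (cup Down \<otimes>\<^sub>D ids [Up, Down]) \<in> hom is_tgraph (thin [Up, Down]) (thin [Down, Up, Up, Down])"
    "lc (ids [Down, Up] \<otimes>\<^sub>D cap Up) \<in> hom is_tgraph (thin [Down, Up, Up, Down]) (thin [Down, Up])"
    by (auto intro!: hom_lc simp: is_tgraph_def is_diagram_dtensor ids_def)
  moreover have "lc (ids [Down]) \<otimes>\<^sub>L crossing_value \<alpha> \<zeta> Up (\<not> p) \<otimes>\<^sub>L lc (ids [Down]) \<in>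
      hom is_tgraph (thin [Down, Up, Up, Down]) (thin [Down, Up, Up, Down])"
    using hom_tgraph_ltensor[OF hom_tgraph_ltensor[OF hom_ids[of "[Down]"] hom_crossing_value] hom_ids[of "[Down]"]]
    by simp
  ultimately show ?thesis
    using 5 by (auto intro: hom_tgraph_lcomp)
next
  case (6 \<alpha> \<zeta> p)
  have "lc (ids [Down, Up] \<otimes>\<^sub>D cup Up) \<in> hom is_tgraph (thin [Down, Up]) (thin [Down, Up, Up, Down])"
    "lc (cap Down \<otimes>\<^sub>D ids [Up, Down]) \<in> hom is_tgraph (thin [Down, Up, Up, Down]) (thin [Up, Down])"
    by (auto intro!: hom_lc simp: is_tgraph_def is_diagram_dtensor ids_def)
  moreover have "lc (ids [Down]) \<otimes>\<^sub>L crossing_value \<alpha> \<zeta> Up (\<not> p) \<otimes>\<^sub>L lc (ids [Down]) \<in>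
      hom is_tgraph (thin [Down, Up, Up, Down]) (thin [Down, Up, Up, Down])"
    using hom_tgraph_ltensor[OF hom_tgraph_ltensor[OF hom_ids[of "[Down]"] hom_crossing_value] hom_ids[of "[Down]"]]
    by simp
  ultimately show ?thesis
    using 6 by (auto intro: hom_tgraph_lcomp)
qed (use hom_crossing_value in \<open>auto intro!: hom_lc simp: is_tgraph_def\<close>)

lemma hom_Z_slices:
  "stacks tsrc ttgt a ss b \<Longrightarrow> Z_slices \<alpha> \<zeta> b ss \<in> hom is_tgraph (thin a) (thin b)"
proof (induction ss arbitrary: a)
  case (Cons s ss)
  obtain l g r where s: "s = (l, g, r)" by (cases s)
  have "lc (ids l) \<otimes>\<^sub>L Z_gen \<alpha> \<zeta> g \<otimes>\<^sub>L lc (ids r) \<in>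
      hom is_tgraph (thin (l @ tsrc g @ r)) (thin (l @ ttgt g @ r))"
    using hom_tgraph_ltensor[OF hom_tgraph_ltensor[OF hom_ids[of l] hom_Z_gen[of \<alpha> \<zeta> g]] hom_ids[of r]]
    by simp
  moreover have "Z_slices \<alpha> \<zeta> b ss \<in> hom is_tgraph (thin (l @ ttgt g @ r)) (thin b)"
    using Cons by (simp add: s del: map_append)
  ultimately show ?case
    using Cons.prems hom_tgraph_lcomp by (fastforce simp: s)
qed simp

lemma hom_Z: "is_tangle D \<Longrightarrow> Z \<alpha> \<zeta> D \<in> hom is_tgraph (thin (bot D)) (thin (top D))"
  by (simp add: Z_def is_diagram_def hom_Z_slices)

lemma Z_slices_append:
  assumes "stacks tsrc ttgt a ss b" "stacks tsrc ttgt b ts c"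
  shows "Z_slices \<alpha> \<zeta> c (ss @ ts) = Z_slices \<alpha> \<zeta> c ts \<circ>\<^sub>L Z_slices \<alpha> \<zeta> b ss"
  using assms
proof (induction ss arbitrary: a)
  case Nil
  then show ?case
    using lcomp_idd[OF hom_Z_slices[of b ts c \<alpha> \<zeta>]] by (simp add: ids_def)
next
  case (Cons s ss)
  then show ?case
    by (auto simp: lcomp_assoc split: prod.splits)
qed

text \<open>Z works slice by slice, so this is an equality of combinations of graphs, before any
  relation is imposed.\<close>

lemma Z_dcomp:
  "is_tangle D \<Longrightarrow> is_tangle E \<Longrightarrow> bot D = top E \<Longrightarrow> Z \<alpha> \<zeta> (D \<circ>\<^sub>D E) = Z \<alpha> \<zeta> D \<circ>\<^sub>L Z \<alpha> \<zeta> E"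
  by (simp add: Z_def is_diagram_def dcomp_def Z_slices_append)

lemma Z_idd [simp]: "Z \<alpha> \<zeta> (idd a) = lc (ids a)"
  by (simp add: Z_def idd_def)

lemma lcomp_ltensor_ids: "(f \<circ>\<^sub>L g) \<otimes>\<^sub>L lc (ids r) = (f \<otimes>\<^sub>L lc (ids r)) \<circ>\<^sub>L (g \<otimes>\<^sub>L lc (ids r))"
  and ids_ltensor_lcomp: "lc (ids l) \<otimes>\<^sub>L (f \<circ>\<^sub>L g) = (lc (ids l) \<otimes>\<^sub>L f) \<circ>\<^sub>L (lc (ids l) \<otimes>\<^sub>L g)"
  by (simp_all add: ids_def lcomp_ltensor_idd idd_ltensor_lcomp)

lemma Z_slices_whisker_right:
  "Z_slices \<alpha> \<zeta> (b @ r) (map (\<lambda>(l, g, r'). (l, g, r' @ r)) ss) = Z_slices \<alpha> \<zeta> b ss \<otimes>\<^sub>L lc (ids r)"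
proof (induction ss)
  case (Cons s ss)
  obtain l g r' where s: "s = (l, g, r')" by (cases s)
  have "(lc (ids (r' @ r)) :: _ \<Rightarrow>\<^sub>0 'a) = lc (ids r') \<otimes>\<^sub>L lc (ids r)"
    by (simp add: ltensor_simps ids_append)
  then show ?case
    using Cons by (simp add: s ltensor_assoc lcomp_ltensor_ids)
qed (simp add: ltensor_simps ids_append)

lemma Z_slices_whisker_left:
  "Z_slices \<alpha> \<zeta> (l @ b) (map (\<lambda>(l', g, r). (l @ l', g, r)) ss) = lc (ids l) \<otimes>\<^sub>L Z_slices \<alpha> \<zeta> b ss"
proof (induction ss)
  case (Cons s ss)
  obtain l' g r where s: "s = (l', g, r)" by (cases s)
  have "(lc (ids (l @ l')) :: _ \<Rightarrow>\<^sub>0 'a) = lc (ids l) \<otimes>\<^sub>L lc (ids l')"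
    by (simp add: ltensor_simps ids_append)
  then show ?case
    using Cons by (simp add: s ltensor_assoc ids_ltensor_lcomp)
qed (simp add: ltensor_simps ids_append)

lemma Z_dtensor_idd: "Z \<alpha> \<zeta> (D \<otimes>\<^sub>D idd r) = Z \<alpha> \<zeta> D \<otimes>\<^sub>L lc (ids r)"
  by (simp add: Z_def dtensor_def idd_def Z_slices_whisker_right)

lemma Z_idd_dtensor: "Z \<alpha> \<zeta> (idd l \<otimes>\<^sub>D D) = lc (ids l) \<otimes>\<^sub>L Z \<alpha> \<zeta> D"
  by (simp only: Z_def dtensor_def idd_def diagram.sel list.map append_Nil append_Nil2 Z_slices_whisker_left)

text \<open>Again an equality, because tangles and graphs both place the left tensor factor below
  the right one.\<close>

lemma Z_dtensor:
  assumes "is_tangle D" "is_tangle E"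
  shows "Z \<alpha> \<zeta> (D \<otimes>\<^sub>D E) = Z \<alpha> \<zeta> D \<otimes>\<^sub>L Z \<alpha> \<zeta> E"
proof -
  have "Z \<alpha> \<zeta> (D \<otimes>\<^sub>D E) = Z \<alpha> \<zeta> (idd (top D) \<otimes>\<^sub>D E) \<circ>\<^sub>L Z \<alpha> \<zeta> (D \<otimes>\<^sub>D idd (bot E))"
    using assms by (subst dtensor_decomp, subst Z_dcomp) (auto simp: is_diagram_dtensor)
  also have "\<dots> = Z \<alpha> \<zeta> D \<otimes>\<^sub>L Z \<alpha> \<zeta> E"
    using ltensor_decomp[OF hom_Z[OF assms(1)] hom_Z[OF assms(2)], of \<alpha> \<zeta> \<alpha> \<zeta>]
    by (simp add: Z_dtensor_idd Z_idd_dtensor ids_def)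
  finally show ?thesis .
qed

lemma Z_gen_tgen [simp]: "Z \<alpha> \<zeta> (gen tsrc ttgt g) = Z_gen \<alpha> \<zeta> g"
  using idd_lcomp[OF hom_Z_gen[of \<alpha> \<zeta> g]]
  by (simp add: Z_def gen_def ids_def)

section \<open>Linear extension of the functor\<close>

definition Z_linear :: "'r::comm_ring_1 \<Rightarrow> 'r \<Rightarrow> (tangle \<Rightarrow>\<^sub>0 'r) \<Rightarrow> (tgraph \<Rightarrow>\<^sub>0 'r)" where
  "Z_linear \<alpha> \<zeta> f = (\<Sum>D\<in>Poly_Mapping.keys f. Poly_Mapping.lookup f D \<odot> Z \<alpha> \<zeta> D)"

lemma Z_linear_superset:
  "finite A \<Longrightarrow> Poly_Mapping.keys f \<subseteq> A \<Longrightarrow> Z_linear \<alpha> \<zeta> f = (\<Sum>D\<in>A. Poly_Mapping.lookup f D \<odot> Z \<alpha> \<zeta> D)"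
  unfolding Z_linear_def by (intro sum.mono_neutral_left) (auto simp: in_keys_iff)

lemma Z_linear_add: "Z_linear \<alpha> \<zeta> (f + g) = Z_linear \<alpha> \<zeta> f + Z_linear \<alpha> \<zeta> g"
  using keys_add[of f g]
  by (simp add: Z_linear_superset[of "Poly_Mapping.keys f \<union> Poly_Mapping.keys g"] lookup_add
      scale_add_left sum.distrib)

lemma Z_linear_scale: "Z_linear \<alpha> \<zeta> (c \<odot> f) = c \<odot> Z_linear \<alpha> \<zeta> f"
  using keys_scale[of c f]
  by (simp add: Z_linear_superset[of "Poly_Mapping.keys f"] scale_sum scale_scale)

lemma Z_linear_zero: "Z_linear \<alpha> \<zeta> 0 = 0"
  by (simp add: Z_linear_def)

lemma Z_linear_diff: "Z_linear \<alpha> \<zeta> (f - g) = Z_linear \<alpha> \<zeta> f - Z_linear \<alpha> \<zeta> g"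
  using Z_linear_add[of \<alpha> \<zeta> "f - g" g] by simp

lemma Z_linear_lc: "Z_linear \<alpha> \<zeta> (lc D) = Z \<alpha> \<zeta> D"
  by (simp add: Z_linear_superset[of "{D}"])

lemmas Z_linear_simps = Z_linear_add Z_linear_scale Z_linear_zero Z_linear_diff Z_linear_lc

lemma hom_Z_linear: "f \<in> hom is_tangle a b \<Longrightarrow> Z_linear \<alpha> \<zeta> f \<in> hom is_tgraph (thin a) (thin b)"
  by (induction rule: hom_induct) (use hom_Z in \<open>auto simp: Z_linear_simps intro: hom_add hom_scale\<close>)

lemma Z_linear_lcomp:
  assumes "f \<in> hom is_tangle b c" "g \<in> hom is_tangle a b"
  shows "Z_linear \<alpha> \<zeta> (f \<circ>\<^sub>L g) = Z_linear \<alpha> \<zeta> f \<circ>\<^sub>L Z_linear \<alpha> \<zeta> g"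
  using assms(1)
proof (induction rule: hom_induct)
  case D: (lc D)
  from assms(2) D show ?case
    by (induction rule: hom_induct) (simp_all add: Z_linear_simps lcomp_simps Z_dcomp)
qed (simp_all add: Z_linear_simps lcomp_simps)

lemma Z_linear_ltensor:
  assumes "f \<in> hom is_tangle a b" "g \<in> hom is_tangle c d"
  shows "Z_linear \<alpha> \<zeta> (f \<otimes>\<^sub>L g) = Z_linear \<alpha> \<zeta> f \<otimes>\<^sub>L Z_linear \<alpha> \<zeta> g"
  using assms(1)
proof (induction rule: hom_induct)
  case D: (lc D)
  from assms(2) D show ?case
    by (induction rule: hom_induct) (simp_all add: Z_linear_simps ltensor_simps Z_dtensor)
qed (simp_all add: Z_linear_simps ltensor_simps)

text \<open>A relator enters the ideal with prescribed ends. They are the ends visible in its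
  formula unless the relator happens to be zero, which lies in every hom space.\<close>

lemma hom_unique: "f \<in> hom P a b \<Longrightarrow> f \<in> hom P a' b' \<Longrightarrow> f \<noteq> 0 \<Longrightarrow> a = a' \<and> b = b'"
  unfolding hom_def by (metis (mono_tags, lifting) all_not_in_conv keys_eq_empty mem_Collect_eq)

section \<open>Congruence of values in the MOY category\<close>

abbreviation moy_cong :: "'r::comm_ring_1 \<Rightarrow> 'r \<Rightarrow> nat \<Rightarrow> dir list \<Rightarrow> dir list \<Rightarrow>
    (tgraph \<Rightarrow>\<^sub>0 'r) \<Rightarrow> (tgraph \<Rightarrow>\<^sub>0 'r) \<Rightarrow> bool" where
  "moy_cong \<alpha> \<zeta> n a b \<equiv> ideal_eq is_tgraph (moy_relators \<alpha> \<zeta> n) (thin a) (thin b)"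

text \<open>Equal ends are part of the relation so that it can itself serve as the set of moves of
  \<open>diagram_equiv\<close>.\<close>

definition Z_cong :: "'r::comm_ring_1 \<Rightarrow> 'r \<Rightarrow> nat \<Rightarrow> tangle \<Rightarrow> tangle \<Rightarrow> bool" where
  "Z_cong \<alpha> \<zeta> n D E \<longleftrightarrow> parallel tsrc ttgt D E \<and>
     moy_cong \<alpha> \<zeta> n (bot D) (top D) (Z \<alpha> \<zeta> D) (Z \<alpha> \<zeta> E)"

lemma graph_isotopic_parallel: "graph_isotopic D E \<Longrightarrow> parallel gsrc gtgt D E"
proof (erule diagram_equiv_parallel)
  fix D E
  assume "graph_move D E"
  then show "parallel gsrc gtgt D E"
    by cases (simp_all add: parallel_def is_diagram_dcomp is_diagram_dtensor)
qed

text \<open>The isotopy may use pieces with 2-labelled ends on its way; only the two graphs that it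
  connects have to be morphisms of the category.\<close>

lemma moy_cong_isotopic:
  assumes "graph_isotopic D E" "bot D = thin a" "top D = thin b"
  shows "moy_cong \<alpha> \<zeta> n a b (lc D) (lc E)"
proof (rule ideal_eq_relator)
  show "lc D - lc E \<in> moy_relators \<alpha> \<zeta> n"
    using assms(1) by (auto simp: moy_relators_def)
  have par: "parallel gsrc gtgt D E"
    by (rule graph_isotopic_parallel[OF assms(1)])
  have thin: "snd ` (set (thin a) \<union> set (thin b)) \<subseteq> {L1}"
    by auto
  show "lc D \<in> hom is_tgraph (thin a) (thin b)"
    using par assms thin by (intro hom_lc) (simp_all add: is_tgraph_def parallel_def)
  show "lc E \<in> hom is_tgraph (thin a) (thin b)"
    using par thin by (intro hom_lc) (simp_all add: is_tgraph_def parallel_def flip: assms(2,3))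
qed

lemmas moy_cong_lcomp = ideal_eq_lcomp[OF monoidal_tgraph]
  and moy_cong_ltensor = ideal_eq_ltensor[OF monoidal_tgraph]

text \<open>The value of a tangle is a combination of graphs, so the exchange of heights between
  single graphs has to be extended bilinearly.\<close>

lemma moy_cong_exchange:
  assumes "f \<in> hom is_tgraph (thin a) (thin b)" "g \<in> hom is_tgraph (thin c) (thin d)"
  shows "moy_cong \<alpha> \<zeta> n (a @ c) (b @ d)
    ((lc (ids b) \<otimes>\<^sub>L g) \<circ>\<^sub>L (f \<otimes>\<^sub>L lc (ids c))) ((f \<otimes>\<^sub>L lc (ids d)) \<circ>\<^sub>L (lc (ids a) \<otimes>\<^sub>L g))"
  using assms(1)
proof (induction rule: hom_induct)
  case D: (lc D)
  from assms(2) show ?case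
  proof (induction rule: hom_induct)
    case (lc E)
    with D have "graph_isotopic
        ((idd (top D) \<otimes>\<^sub>D E) \<circ>\<^sub>D (D \<otimes>\<^sub>D idd (bot E)))
        ((D \<otimes>\<^sub>D idd (top E)) \<circ>\<^sub>D (idd (bot D) \<otimes>\<^sub>D E))"
      by (intro diagram_equiv.exchange) (auto simp: is_tgraph_def)
    with D lc show ?case
      using moy_cong_isotopic[of _ _ "a @ c" "b @ d" \<alpha> \<zeta> n] by (simp add: lcomp_simps ltensor_simps ids_def)
  qed (auto simp: lcomp_simps ltensor_simps intro: ideal_eq_refl ideal_eq_add ideal_eq_scale)
qed (auto simp: lcomp_simps ltensor_simps intro: ideal_eq_refl ideal_eq_add ideal_eq_scale)

text \<open>Z respects both products, and exchange holds in the quotient, so the congruence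
  generated by \<open>Z_cong\<close> is no larger than \<open>Z_cong\<close>. Invariance therefore
  only has to be checked on the moves, and invariances once proved can be used as moves.\<close>

lemma Z_cong_closed:
  "diagram_equiv tsrc ttgt (Z_cong \<alpha> \<zeta> n) D E \<Longrightarrow> Z_cong \<alpha> \<zeta> n D E"
proof (induction rule: diagram_equiv.induct)
  case (exchange D E)
  then have "Z_cong \<alpha> \<zeta> n ((idd (top D) \<otimes>\<^sub>D E) \<circ>\<^sub>D (D \<otimes>\<^sub>D idd (bot E)))
        ((D \<otimes>\<^sub>D idd (top E)) \<circ>\<^sub>D (idd (bot D) \<otimes>\<^sub>D E)) \<longleftrightarrow>
     moy_cong \<alpha> \<zeta> n (bot D @ bot E) (top D @ top E)
    ((lc (ids (top D)) \<otimes>\<^sub>L Z \<alpha> \<zeta> E) \<circ>\<^sub>L (Z \<alpha> \<zeta> D \<otimes>\<^sub>L lc (ids (bot E))))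
    ((Z \<alpha> \<zeta> D \<otimes>\<^sub>L lc (ids (top E))) \<circ>\<^sub>L (lc (ids (bot D)) \<otimes>\<^sub>L Z \<alpha> \<zeta> E))"
    by (simp add: Z_cong_def parallel_def is_diagram_dcomp is_diagram_dtensor Z_dcomp Z_dtensor)
  then show ?case
    using exchange moy_cong_exchange[OF hom_Z hom_Z] by blast
next
  case (refl D)
  then show ?case
    by (auto simp: Z_cong_def parallel_def hom_Z intro: ideal_eq_refl)
next
  case (sym D E)
  then show ?case
    by (auto simp: Z_cong_def parallel_def intro: ideal_eq_sym)
next
  case (trans D E F)
  then show ?case
    by (auto simp: Z_cong_def parallel_def intro: ideal_eq_trans)
next
  case (comp D D' E E')
  then show ?case
    by (auto simp: Z_cong_def parallel_def is_diagram_dcomp Z_dcomp intro: moy_cong_lcomp)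
next
  case (tensor D D' E E')
  then show ?case
    using moy_cong_ltensor[of "moy_relators \<alpha> \<zeta> n" "thin (bot D)" "thin (top D)" "Z \<alpha> \<zeta> D" "Z \<alpha> \<zeta> D'"
        "thin (bot E)" "thin (top E)" "Z \<alpha> \<zeta> E" "Z \<alpha> \<zeta> E'"]
    by (auto simp: Z_cong_def parallel_def is_diagram_dtensor Z_dtensor)
qed auto

section \<open>Scalars, and the image of the HOMFLY-PT ideal\<close>

locale moy_parameters =
  fixes \<alpha> \<zeta> :: "'r::comm_ring_1" and n :: nat
  assumes unit_\<alpha>: "\<alpha> dvd 1" and unit_\<zeta>: "\<zeta> dvd 1" and unit_z: "unit_inv \<zeta> - \<zeta> dvd 1"
begin

lemma mult_inv_\<alpha> [simp]: "\<alpha> * unit_inv \<alpha> = 1" "unit_inv \<alpha> * \<alpha> = 1"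
  and mult_inv_\<zeta> [simp]: "\<zeta> * unit_inv \<zeta> = 1" "unit_inv \<zeta> * \<zeta> = 1"
  using mult_unit_inv[OF unit_\<alpha>] mult_unit_inv[OF unit_\<zeta>] by (simp_all add: mult.commute)

text \<open>The inverse of \<open>z\<close>; the denominator \<zeta> - 1/\<zeta> of the brackets is
  the negative of \<open>z\<close>.\<close>

definition w where "w = unit_inv (unit_inv \<zeta> - \<zeta>)"

lemma mult_w: "(unit_inv \<zeta> - \<zeta>) * w = 1"
  using mult_unit_inv[OF unit_z] by (simp add: w_def)

lemma unit_inv_neg: "unit_inv (\<zeta> - unit_inv \<zeta>) = - w" "unit_inv (- \<zeta>) = - unit_inv \<zeta>"
  using mult_w by (auto intro!: unit_inv_eq simp: algebra_simps)

text \<open>The exponents of -\<zeta> depend only on the difference of \<open>k\<close> and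
  \<open>n\<close>, which is 0, 1 or 2 in the relations. The first value is the one that HOMFLY-PT
  assigns to the unknot.\<close>

lemma bracket_n: "bracket \<alpha> \<zeta> n (int n) = (\<alpha> - unit_inv \<alpha>) * w"
  and bracket_n_1: "bracket \<alpha> \<zeta> n (int n - 1) = (unit_inv \<alpha> * unit_inv \<zeta> - \<alpha> * \<zeta>) * w"
  and bracket_n_2: "bracket \<alpha> \<zeta> n (int n - 2) = (\<alpha> * \<zeta>\<^sup>2 - unit_inv \<alpha> * (unit_inv \<zeta>)\<^sup>2) * w"
  by (simp_all add: bracket_def unit_powi_def unit_inv_neg algebra_simps)

text \<open>The coefficients \<alpha> and 1/\<alpha> cancel the prefactors of the two crossings, and
  the two copies of S cancel each other.\<close>

lemma Z_skein:
  "\<alpha> \<odot> Z \<alpha> \<zeta> X_pos - unit_inv \<alpha> \<odot> Z \<alpha> \<zeta> X_neg - (unit_inv \<zeta> - \<zeta>) \<odot> lc (ids [Up, Up]) = 0"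
  by (rule poly_mapping_eqI)
    (simp add: X_pos_def X_neg_def crossing_value_def lookup_add lookup_minus left_diff_distrib
      flip: mult.assoc)

lemma Z_circle:
  "moy_cong \<alpha> \<zeta> n [] [] (Z \<alpha> \<zeta> (tcap s \<circ>\<^sub>D tcup s)) (((\<alpha> - unit_inv \<alpha>) * w) \<odot> lc (ids []))"
proof (rule ideal_eq_relator)
  have "Z \<alpha> \<zeta> (tcap s \<circ>\<^sub>D tcup s) = lc (cap s \<circ>\<^sub>D cup s)"
    by (simp add: Z_dcomp lcomp_simps)
  then show "Z \<alpha> \<zeta> (tcap s \<circ>\<^sub>D tcup s) - ((\<alpha> - unit_inv \<alpha>) * w) \<odot> lc (ids []) \<in> moy_relators \<alpha> \<zeta> n"
    by (auto simp: moy_relators_def bracket_n)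
  show "((\<alpha> - unit_inv \<alpha>) * w) \<odot> lc (ids []) \<in> hom is_tgraph (thin []) (thin [])"
    by (intro hom_scale hom_ids)
  show "Z \<alpha> \<zeta> (tcap s \<circ>\<^sub>D tcup s) \<in> hom is_tgraph (thin []) (thin [])"
    using hom_Z[of "tcap s \<circ>\<^sub>D tcup s"] by (simp add: is_diagram_dcomp)
qed

lemma Z_linear_ideal:
  assumes moves: "\<And>D E. tangle_move D E \<Longrightarrow> Z_cong \<alpha> \<zeta> n D E"
    and "tensor_ideal is_tangle (homfly_relators \<alpha> (unit_inv \<zeta> - \<zeta>)) a b f"
  shows "tensor_ideal is_tgraph (moy_relators \<alpha> \<zeta> n) (thin a) (thin b) (Z_linear \<alpha> \<zeta> f)"
  using assms(2)
proof (induction rule: tensor_ideal.induct)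
  case (relator f a b)
  \<comment> \<open>Each kind of relator is treated with the ends read off from its formula; they
    are identified with \<open>a\<close> and \<open>b\<close> afterwards.\<close>
  have "\<exists>a' b'. f \<in> hom is_tangle a' b' \<and>
      tensor_ideal is_tgraph (moy_relators \<alpha> \<zeta> n) (thin a') (thin b') (Z_linear \<alpha> \<zeta> f)"
    using relator(1) unfolding homfly_relators_def
  proof (elim UnE CollectE exE conjE singletonE)
    fix D E
    assume f: "f = lc D - lc E" and "tangle_equiv D E"
    then have "diagram_equiv tsrc ttgt (Z_cong \<alpha> \<zeta> n) D E"
      by (auto intro: diagram_equiv_mono diagram_equiv.move moves)
    then have "Z_cong \<alpha> \<zeta> n D E"
      by (rule Z_cong_closed)
    then show ?thesis
      unfolding f by (intro exI[of _ "bot D"] exI[of _ "top D"])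
        (auto simp: Z_cong_def parallel_def ideal_eq_def Z_linear_simps intro: hom_diff hom_lc)
  next
    assume f: "f = \<alpha> \<odot> lc X_pos - unit_inv \<alpha> \<odot> lc X_neg - (unit_inv \<zeta> - \<zeta>) \<odot> lc (idd [Up, Up])"
    have "f \<in> hom is_tangle [Up, Up] [Up, Up]"
      unfolding f by (auto intro!: hom_diff hom_scale hom_lc simp: X_pos_def X_neg_def)
    moreover have "Z_linear \<alpha> \<zeta> f = 0"
      using Z_skein by (simp add: f Z_linear_simps)
    ultimately show ?thesis
      using tensor_ideal.zero by metis
  next
    fix s
    assume f: "f = lc (tcap s \<circ>\<^sub>D tcup s)
      - ((\<alpha> - unit_inv \<alpha>) * unit_inv (unit_inv \<zeta> - \<zeta>)) \<odot> lc (idd [])"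
    have "f \<in> hom is_tangle [] []"
      unfolding f by (auto intro!: hom_diff hom_scale hom_lc simp: is_diagram_dcomp)
    moreover have "tensor_ideal is_tgraph (moy_relators \<alpha> \<zeta> n) (thin []) (thin []) (Z_linear \<alpha> \<zeta> f)"
      using Z_circle[of s] by (simp add: f Z_linear_simps ideal_eq_def w_def)
    ultimately show ?thesis
      by blast
  qed
  then show ?case
    using relator(2) hom_unique[of f is_tangle a b]
    by (cases "f = 0") (simp add: Z_linear_zero tensor_ideal.zero, metis)
next
  case (comp_left a b f g c)
  then show ?case
    using tensor_ideal_hom[OF monoidal_tangle comp_left(1)] hom_Z_linear[OF comp_left(2)]
    by (auto simp: Z_linear_lcomp intro: tensor_ideal.comp_left)
next
  case (comp_right b c f g a)
  then show ?case
    using tensor_ideal_hom[OF monoidal_tangle comp_right(1)] hom_Z_linear[OF comp_right(2)]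
    by (auto simp: Z_linear_lcomp intro: tensor_ideal.comp_right)
next
  case (tensor_left a b f g c d)
  then show ?case
    using tensor_ideal_hom[OF monoidal_tangle tensor_left(1)] hom_Z_linear[OF tensor_left(2)]
    by (auto simp: Z_linear_ltensor intro: tensor_ideal.tensor_left)
next
  case (tensor_right a b f g c d)
  then show ?case
    using tensor_ideal_hom[OF monoidal_tangle tensor_right(1)] hom_Z_linear[OF tensor_right(2)]
    by (auto simp: Z_linear_ltensor intro: tensor_ideal.tensor_right)
qed (auto simp: Z_linear_simps intro: tensor_ideal.zero tensor_ideal.add tensor_ideal.scale)

end

lemma graph_move_parallel: "graph_move D E \<Longrightarrow> parallel gsrc gtgt D E"
  by (rule graph_isotopic_parallel[OF diagram_equiv.move])

section \<open>Isotopies of trivalent graphs\<close>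

definition zigzags :: "strand \<Rightarrow> (tgraph \<times> tgraph) list" where
  "zigzags = (\<lambda>(s, i).
     [((gcap s i \<otimes>\<^sub>D idd [(s, i)]) \<circ>\<^sub>D (idd [(s, i)] \<otimes>\<^sub>D gcup (opp s) i), idd [(s, i)]),
      ((idd [(s, i)] \<otimes>\<^sub>D gcap (opp s) i) \<circ>\<^sub>D (gcup s i \<otimes>\<^sub>D idd [(s, i)]), idd [(s, i)])])"

text \<open>The order matters for reading the step lists below: an even index is a right zigzag and
  an odd one a left zigzag, with 0 to 3 for 1-labelled and 4 to 7 for 2-labelled strands.\<close>

definition graph_zigzags :: "dir \<Rightarrow> (tgraph \<times> tgraph) list" where
  "graph_zigzags s = zigzags (s, L1) @ zigzags (opp s, L1) @ zigzags (s, L2) @ zigzags (opp s, L2)"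

lemma zigzags_move: "(D, E) \<in> set (zigzags x) \<Longrightarrow> graph_move D E"
  by (auto simp: zigzags_def graph_move.zigzag_right graph_move.zigzag_left split: prod.splits)

lemma graph_zigzags_isotopic: "(D, E) \<in> set (graph_zigzags s) \<Longrightarrow> graph_isotopic D E"
  by (auto simp: graph_zigzags_def intro: diagram_equiv.move zigzags_move)

text \<open>The zigzag moves are the rules 0 to 7; the additional rules \<open>rs\<close> are numbered from 8.\<close>

lemma graph_isotopic_joins:
  assumes "joins gsrc gtgt (graph_zigzags s @ rs) xs ys D E"
    and "list_all (\<lambda>(D, E). graph_isotopic D E) rs"
  shows "graph_isotopic D E"
  using graph_move_parallel _ assms(1)
  by (rule joins_sound) (use assms(2) graph_zigzags_isotopic in \<open>auto simp: list_all_iff\<close>)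

lemmas joins_simps = joins_def graph_zigzags_def zigzags_def dcomp_def dtensor_def idd_def gen_def
  is_diagram_def Let_def

section \<open>Turning vertices and graphs\<close>

definition turn_merge_cw :: "dir \<Rightarrow> tgraph" where
  "turn_merge_cw s = (idd [(opp s, L1), (opp s, L1)] \<otimes>\<^sub>D gcap s L2)
      \<circ>\<^sub>D (idd [(opp s, L1), (opp s, L1)] \<otimes>\<^sub>D merge s \<otimes>\<^sub>D idd [(opp s, L2)])
      \<circ>\<^sub>D (((idd [(opp s, L1)] \<otimes>\<^sub>D gcup (opp s) L1 \<otimes>\<^sub>D idd [(s, L1)]) \<circ>\<^sub>D gcup (opp s) L1)
           \<otimes>\<^sub>D idd [(opp s, L2)])"

definition turn_merge_ccw :: "dir \<Rightarrow> tgraph" where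
  "turn_merge_ccw s = (gcap (opp s) L2 \<otimes>\<^sub>D idd [(opp s, L1), (opp s, L1)])
      \<circ>\<^sub>D (idd [(opp s, L2)] \<otimes>\<^sub>D merge s \<otimes>\<^sub>D idd [(opp s, L1), (opp s, L1)])
      \<circ>\<^sub>D (idd [(opp s, L2)] \<otimes>\<^sub>D
           ((idd [(s, L1)] \<otimes>\<^sub>D gcup s L1 \<otimes>\<^sub>D idd [(opp s, L1)]) \<circ>\<^sub>D gcup s L1))"

definition turn_split_cw :: "dir \<Rightarrow> tgraph" where
  "turn_split_cw s =
     (idd [(opp s, L2)] \<otimes>\<^sub>D (gcap s L1 \<circ>\<^sub>D (idd [(s, L1)] \<otimes>\<^sub>D gcap s L1 \<otimes>\<^sub>D idd [(opp s, L1)])))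
      \<circ>\<^sub>D (idd [(opp s, L2)] \<otimes>\<^sub>D split s \<otimes>\<^sub>D idd [(opp s, L1), (opp s, L1)])
      \<circ>\<^sub>D (gcup (opp s) L2 \<otimes>\<^sub>D idd [(opp s, L1), (opp s, L1)])"

definition turn_split_ccw :: "dir \<Rightarrow> tgraph" where
  "turn_split_ccw s =
     ((gcap (opp s) L1 \<circ>\<^sub>D (idd [(opp s, L1)] \<otimes>\<^sub>D gcap (opp s) L1 \<otimes>\<^sub>D idd [(s, L1)])) \<otimes>\<^sub>D idd [(opp s, L2)])
      \<circ>\<^sub>D (idd [(opp s, L1), (opp s, L1)] \<otimes>\<^sub>D split s \<otimes>\<^sub>D idd [(opp s, L2)])
      \<circ>\<^sub>D (idd [(opp s, L1), (opp s, L1)] \<otimes>\<^sub>D gcup s L2)"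

lemma turn_merge: "graph_isotopic (turn_merge_cw s) (split (opp s))"
  "graph_isotopic (turn_merge_ccw s) (split (opp s))"
  unfolding turn_merge_cw_def turn_merge_ccw_def
  by (rule diagram_equiv.move, rule graph_move.rotate_cw graph_move.rotate_ccw)+

text \<open>The moves only turn merges. Writing the split as a merge turned the opposite way makes
  two half turns undo each other by zigzags; the counterclockwise case is the mirror image.\<close>

lemma turn_split_cw: "graph_isotopic (turn_split_cw s) (merge (opp s))"
proof (rule diagram_equiv.sym, rule graph_isotopic_joins)
  show "joins gsrc gtgt (graph_zigzags s @ [(turn_merge_ccw (opp s), split (opp (opp s)))])
     [] [Unapply 1 1 8, Swap_Right 0, Swap_Right 1, Swap_Right 2, Apply 3 0 7, Swap_Right 2, Swap_Right 1, Apply 0 0 3, Swap_Right 1, Apply 0 1 3]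
     (merge (opp s)) (turn_split_cw s)"
    by (simp add: joins_simps turn_merge_ccw_def turn_split_cw_def)
qed (simp add: turn_merge[of "opp s", simplified])

lemma turn_split_ccw: "graph_isotopic (merge (opp s)) (turn_split_ccw s)"
proof (rule graph_isotopic_joins)
  show "joins gsrc gtgt (graph_zigzags s @ [(turn_merge_cw (opp s), split (opp (opp s)))])
     []
     [Unapply 1 2 8, Swap_Left 0, Swap_Left 1, Swap_Left 2, Apply 3 4 6, Swap_Left 2,
      Swap_Left 1, Apply 0 1 2, Swap_Left 1, Apply 0 0 2]
     (merge (opp s)) (turn_split_ccw s)"
    by (simp add: joins_simps turn_merge_cw_def turn_split_ccw_def)
qed (simp add: turn_merge[of "opp s", simplified])

text \<open>A quarter turn. The directions \<open>a b\<close> below and \<open>c d\<close> above are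
  those of the ends of \<open>D\<close>; the result goes from \<open>b, opp d\<close> to
  \<open>opp a, c\<close>.\<close>

definition turn_cw :: "dir \<Rightarrow> dir \<Rightarrow> dir \<Rightarrow> dir \<Rightarrow> tgraph \<Rightarrow> tgraph" where
  "turn_cw a b c d D = (ids [opp a, c] \<otimes>\<^sub>D cap d) \<circ>\<^sub>D (ids [opp a] \<otimes>\<^sub>D D \<otimes>\<^sub>D ids [opp d])
     \<circ>\<^sub>D (cup (opp a) \<otimes>\<^sub>D ids [b, opp d])"

definition turn_ccw :: "dir \<Rightarrow> dir \<Rightarrow> dir \<Rightarrow> dir \<Rightarrow> tgraph \<Rightarrow> tgraph" where
  "turn_ccw a b c d D = (cap (opp c) \<otimes>\<^sub>D ids [d, opp b]) \<circ>\<^sub>D (ids [opp c] \<otimes>\<^sub>D D \<otimes>\<^sub>D ids [opp b])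
     \<circ>\<^sub>D (ids [opp c, a] \<otimes>\<^sub>D cup b)"

definition turn_strand :: "dir \<Rightarrow> tgraph \<Rightarrow> tgraph" where
  "turn_strand s D = (ids [s] \<otimes>\<^sub>D cap (opp s)) \<circ>\<^sub>D (ids [s] \<otimes>\<^sub>D D \<otimes>\<^sub>D ids [s]) \<circ>\<^sub>D (cup s \<otimes>\<^sub>D ids [s])"

definition close_left :: "dir \<Rightarrow> tgraph" where
  "close_left s = (cap (opp s) \<otimes>\<^sub>D ids [s]) \<circ>\<^sub>D (ids [opp s] \<otimes>\<^sub>D S s) \<circ>\<^sub>D (cup (opp s) \<otimes>\<^sub>D ids [s])"

definition close_right :: "dir \<Rightarrow> tgraph" where
  "close_right s = (ids [s] \<otimes>\<^sub>D cap s) \<circ>\<^sub>D (S s \<otimes>\<^sub>D ids [opp s]) \<circ>\<^sub>D (ids [s] \<otimes>\<^sub>D cup s)"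

definition square :: "dir \<Rightarrow> tgraph" where
  "square s = (ids [s] \<otimes>\<^sub>D cap s \<otimes>\<^sub>D ids [opp s]) \<circ>\<^sub>D (S s \<otimes>\<^sub>D S (opp s))
            \<circ>\<^sub>D (ids [s] \<otimes>\<^sub>D cup s \<otimes>\<^sub>D ids [opp s])"

lemmas turn_simps = S_def ids_def turn_cw_def turn_ccw_def turn_strand_def close_left_def
  close_right_def square_def

text \<open>Both vertices of \<open>S (opp s)\<close> are replaced by half-turned ones. The
  2-labelled edge between them then runs through a single zigzag, and straightening it leaves
  \<open>S s\<close> turned twice.\<close>

lemma turn_S_cw: "graph_isotopic (S (opp s)) (turn_cw s (opp s) (opp s) s (turn_cw s s s s (S s)))"
proof (rule graph_isotopic_joins)
  show "joins gsrc gtgt (graph_zigzags s @ [(turn_merge_cw s, split (opp s)), (turn_split_cw s, merge (opp s))])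
     [Unapply 1 0 8, Unapply 0 0 9, Swap_Left 3, Swap_Left 2, Swap_Left 1, Swap_Left 0,
      Swap_Left 4, Swap_Left 3, Swap_Left 2, Swap_Left 1, Swap_Left 5, Swap_Left 4, Swap_Left 3,
      Swap_Left 2, Swap_Left 6, Swap_Left 5, Swap_Left 4, Apply 3 2 4]
     []
     (S (opp s)) (turn_cw s (opp s) (opp s) s (turn_cw s s s s (S s)))"
    by (simp add: joins_simps turn_simps turn_merge_cw_def turn_split_cw_def)
qed (simp add: turn_merge turn_split_cw)

lemma turn_S_ccw: "graph_isotopic (S (opp s)) (turn_ccw (opp s) s s (opp s) (turn_ccw s s s s (S s)))"
proof (rule graph_isotopic_joins)
  show "joins gsrc gtgt (graph_zigzags s @ [(turn_merge_ccw s, split (opp s)), (turn_split_ccw s, merge (opp s))])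
     [Unapply 1 0 8, Unapply 0 0 9, Swap_Right 3, Swap_Right 2, Swap_Right 1, Swap_Right 0,
      Swap_Right 4, Swap_Right 3, Swap_Right 2, Swap_Right 1, Swap_Right 5, Swap_Right 4,
      Swap_Right 3, Swap_Right 2, Swap_Right 6, Swap_Right 5, Swap_Right 4, Apply 3 2 5]
     []
     (S (opp s)) (turn_ccw (opp s) s s (opp s) (turn_ccw s s s s (S s)))"
    by (simp add: joins_simps turn_simps turn_merge_ccw_def turn_split_ccw_def)
qed (simp add: turn_merge turn_split_ccw[THEN diagram_equiv.sym])

text \<open>A crossing between strands of the same direction is a combination of two parallel
  strands and S, so each statement about a turned S needs its counterpart for two strands.\<close>

lemma turn_ids_cw_cw: "graph_isotopic (turn_cw s (opp s) (opp s) s (turn_cw s s s s (ids [s, s]))) (ids [opp s, opp s])"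
proof (rule graph_isotopic_joins)
  show "joins gsrc gtgt (graph_zigzags s @ [])
     [Swap_Right 1, Apply 0 0 3, Apply 0 1 3]
     []
     (turn_cw s (opp s) (opp s) s (turn_cw s s s s (ids [s, s]))) (ids [opp s, opp s])"
    by (simp add: joins_simps turn_simps)
qed simp

text \<open>\<open>S (opp s)\<close> is \<open>S s\<close> turned counterclockwise twice, and the
  clockwise turn undoes one of these two.\<close>

lemma turn_S_three_quarters: "graph_isotopic (turn_cw (opp s) (opp s) (opp s) (opp s) (S (opp s))) (turn_ccw s s s s (S s))"
proof (rule graph_isotopic_joins)
  show "joins gsrc gtgt (graph_zigzags s @ [((turn_ccw (opp s) s s (opp s) (turn_ccw s s s s (S s))), S (opp s))])
     [Unapply 1 1 8, Swap_Right 0, Swap_Right 1, Swap_Right 2, Swap_Right 3, Swap_Right 4,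
      Apply 5 0 1, Swap_Right 4, Swap_Right 3, Swap_Right 2, Swap_Right 1, Apply 0 1 1]
     []
     (turn_cw (opp s) (opp s) (opp s) (opp s) (S (opp s))) (turn_ccw s s s s (S s))"
    by (simp add: joins_simps turn_simps)
qed (simp add: turn_S_ccw[THEN diagram_equiv.sym])

lemma turn_ids_three_quarters: "graph_isotopic (turn_cw (opp s) (opp s) (opp s) (opp s) (ids [opp s, opp s])) (turn_ccw s s s s (ids [s, s]))"
proof (rule graph_isotopic_joins)
  show "joins gsrc gtgt (graph_zigzags s @ [])
     [Swap_Right 0]
     [Swap_Left 0]
     (turn_cw (opp s) (opp s) (opp s) (opp s) (ids [opp s, opp s])) (turn_ccw s s s s (ids [s, s]))"
    by (simp add: joins_simps turn_simps)
qed simp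

lemma turn_S_ccw_cw: "graph_isotopic (turn_cw (opp s) s s (opp s) (turn_ccw s s s s (S s))) (S s)"
proof (rule graph_isotopic_joins)
  show "joins gsrc gtgt (graph_zigzags s @ [])
     [Swap_Right 0, Swap_Right 1, Swap_Right 2, Apply 3 0 1, Swap_Right 2, Swap_Right 1,
      Apply 0 1 1]
     []
     (turn_cw (opp s) s s (opp s) (turn_ccw s s s s (S s))) (S s)"
    by (simp add: joins_simps turn_simps)
qed simp

lemma turn_ids_ccw_cw: "graph_isotopic (turn_cw (opp s) s s (opp s) (turn_ccw s s s s (ids [s, s]))) (ids [s, s])"
proof (rule graph_isotopic_joins)
  show "joins gsrc gtgt (graph_zigzags s @ [])
     [Swap_Right 0, Apply 1 0 1, Apply 0 1 1]
     []
     (turn_cw (opp s) s s (opp s) (turn_ccw s s s s (ids [s, s]))) (ids [s, s])"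
    by (simp add: joins_simps turn_simps)
qed simp

text \<open>Only the closure on the left is a defining relation. A half turn moves the closing arc
  to the other side, so the closure on the right follows from the dual relation.\<close>

lemma close_right_turn: "graph_isotopic (close_right s) (turn_strand s (close_left (opp s)))"
proof (rule graph_isotopic_joins)
  show "joins gsrc gtgt (graph_zigzags s @ [((turn_ccw (opp s) s s (opp s) (turn_ccw s s s s (S s))), S (opp s))])
     []
     [Unapply 2 2 8, Swap_Right 1, Swap_Right 2, Swap_Right 3, Swap_Right 4, Swap_Right 5,
      Apply 6 1 1, Swap_Right 0, Swap_Right 1, Swap_Right 2, Swap_Right 3, Apply 4 0 1,
      Swap_Right 4, Swap_Right 3, Swap_Right 2, Swap_Right 1, Apply 0 0 1]
     (close_right s) (turn_strand s (close_left (opp s)))"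
    by (simp add: joins_simps turn_simps)
qed (simp add: turn_S_ccw[THEN diagram_equiv.sym])

lemma turn_strand_ids: "graph_isotopic (turn_strand s (ids [opp s])) (ids [s])"
proof (rule graph_isotopic_joins)
  show "joins gsrc gtgt (graph_zigzags s @ [])
     [Apply 0 0 1]
     []
     (turn_strand s (ids [opp s])) (ids [s])"
    by (simp add: joins_simps turn_simps)
qed simp

text \<open>The left side is the product of the S-terms in R2 for antiparallel strands. Writing
  \<open>S (opp s)\<close> inside the square as \<open>S s\<close> turned twice shows that this
  stack is the square lying on its side.\<close>

lemma turned_square: "graph_isotopic ((turn_cw s s s s (S s)) \<circ>\<^sub>D (turn_ccw s s s s (S s))) (turn_cw s (opp s) s (opp s) (square s))"
proof (rule graph_isotopic_joins)
  show "joins gsrc gtgt (graph_zigzags s @ [((turn_ccw (opp s) s s (opp s) (turn_ccw s s s s (S s))), S (opp s))])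
     [Swap_Left 3, Swap_Left 2, Swap_Left 1, Swap_Left 0]
     [Unapply 4 3 8, Swap_Right 10, Swap_Right 9, Swap_Right 8, Swap_Right 7, Swap_Right 6,
      Swap_Right 5, Apply 4 5 1, Swap_Right 3, Swap_Right 2, Swap_Right 1, Swap_Right 4,
      Swap_Right 3, Swap_Right 2, Swap_Right 5, Swap_Right 4, Swap_Right 3, Swap_Right 6,
      Swap_Right 5, Swap_Right 4, Swap_Right 7, Swap_Right 6, Apply 5 2 1]
     ((turn_cw s s s s (S s)) \<circ>\<^sub>D (turn_ccw s s s s (S s))) (turn_cw s (opp s) s (opp s) (square s))"
    by (simp add: joins_simps turn_simps)
qed (simp add: turn_S_ccw[THEN diagram_equiv.sym])

lemma turned_square_opp: "graph_isotopic ((turn_ccw s s s s (S s)) \<circ>\<^sub>D (turn_cw s s s s (S s))) (turn_cw (opp s) s (opp s) s (square (opp s)))"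
proof (rule graph_isotopic_joins)
  show "joins gsrc gtgt (graph_zigzags s @ [((turn_ccw (opp s) s s (opp s) (turn_ccw s s s s (S s))), S (opp s))])
     [Swap_Left 3, Swap_Left 4, Swap_Left 5, Swap_Left 6]
     [Unapply 2 1 8, Swap_Right 0, Swap_Right 1, Swap_Right 2, Swap_Right 3, Swap_Right 4,
      Swap_Right 5, Apply 6 0 1, Swap_Right 5, Swap_Right 4, Swap_Right 3, Swap_Right 2,
      Swap_Right 1, Swap_Right 6, Swap_Right 5, Swap_Right 4, Swap_Right 3, Swap_Right 2,
      Swap_Right 7, Swap_Right 6, Swap_Right 5, Swap_Right 4, Apply 3 1 1]
     ((turn_ccw s s s s (S s)) \<circ>\<^sub>D (turn_cw s s s s (S s))) (turn_cw (opp s) s (opp s) s (square (opp s)))"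
    by (simp add: joins_simps turn_simps)
qed (simp add: turn_S_ccw[THEN diagram_equiv.sym])

lemma turn_cup_cap: "graph_isotopic (turn_cw s (opp s) s (opp s) (cup s \<circ>\<^sub>D cap s)) (ids [opp s, s])"
proof (rule graph_isotopic_joins)
  show "joins gsrc gtgt (graph_zigzags s @ [])
     [Apply 0 0 3, Apply 0 1 1]
     []
     (turn_cw s (opp s) s (opp s) (cup s \<circ>\<^sub>D cap s)) (ids [opp s, s])"
    by (simp add: joins_simps turn_simps)
qed simp

lemma turn_ids_opp: "graph_isotopic (turn_cw s (opp s) s (opp s) (ids [s, opp s])) (cup (opp s) \<circ>\<^sub>D cap (opp s))"
proof (rule graph_isotopic_joins)
  show "joins gsrc gtgt (graph_zigzags s @ [])
     [Swap_Right 0]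
     []
     (turn_cw s (opp s) s (opp s) (ids [s, opp s])) (cup (opp s) \<circ>\<^sub>D cap (opp s))"
    by (simp add: joins_simps turn_simps)
qed simp

text \<open>Here begin the other products of two turned crossings. Two identities enclose a circle;
  an identity and an S give a closed-up S, closed on the right for one order of the two turns and on
  the left for the other.\<close>

lemma turned_ids_ids: "graph_isotopic ((turn_cw s s s s (ids [s, s])) \<circ>\<^sub>D (turn_ccw s s s s (ids [s, s]))) (cup (opp s) \<circ>\<^sub>D (cap s \<circ>\<^sub>D cup s) \<circ>\<^sub>D cap (opp s))"
proof (rule graph_isotopic_joins)
  show "joins gsrc gtgt (graph_zigzags s @ [])
     [Swap_Right 2]
     [Swap_Right 0]
     ((turn_cw s s s s (ids [s, s])) \<circ>\<^sub>D (turn_ccw s s s s (ids [s, s]))) (cup (opp s) \<circ>\<^sub>D (cap s \<circ>\<^sub>D cup s) \<circ>\<^sub>D cap (opp s))"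
    by (simp add: joins_simps turn_simps)
qed simp

lemma turned_ids_ids_opp: "graph_isotopic ((turn_ccw s s s s (ids [s, s])) \<circ>\<^sub>D (turn_cw s s s s (ids [s, s]))) (cup s \<circ>\<^sub>D (cap (opp s) \<circ>\<^sub>D cup (opp s)) \<circ>\<^sub>D cap s)"
proof (rule graph_isotopic_joins)
  show "joins gsrc gtgt (graph_zigzags s @ [])
     [Swap_Left 2]
     [Swap_Left 0]
     ((turn_ccw s s s s (ids [s, s])) \<circ>\<^sub>D (turn_cw s s s s (ids [s, s]))) (cup s \<circ>\<^sub>D (cap (opp s) \<circ>\<^sub>D cup (opp s)) \<circ>\<^sub>D cap s)"
    by (simp add: joins_simps turn_simps)
qed simp

lemma turned_S_ids: "graph_isotopic ((turn_cw s s s s (S s)) \<circ>\<^sub>D (turn_ccw s s s s (ids [s, s]))) ((ids [opp s] \<otimes>\<^sub>D close_right s) \<circ>\<^sub>D (cup (opp s) \<circ>\<^sub>D cap (opp s)))"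
proof (rule graph_isotopic_joins)
  show "joins gsrc gtgt (graph_zigzags s @ [])
     [Swap_Left 0]
     [Swap_Right 1]
     ((turn_cw s s s s (S s)) \<circ>\<^sub>D (turn_ccw s s s s (ids [s, s]))) ((ids [opp s] \<otimes>\<^sub>D close_right s) \<circ>\<^sub>D (cup (opp s) \<circ>\<^sub>D cap (opp s)))"
    by (simp add: joins_simps turn_simps)
qed simp

lemma turned_ids_S: "graph_isotopic ((turn_cw s s s s (ids [s, s])) \<circ>\<^sub>D (turn_ccw s s s s (S s))) ((cup (opp s) \<circ>\<^sub>D cap (opp s)) \<circ>\<^sub>D (ids [opp s] \<otimes>\<^sub>D close_right s))"
proof (rule graph_isotopic_joins)
  show "joins gsrc gtgt (graph_zigzags s @ [])
     [Swap_Right 4]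
     [Swap_Left 3]
     ((turn_cw s s s s (ids [s, s])) \<circ>\<^sub>D (turn_ccw s s s s (S s))) ((cup (opp s) \<circ>\<^sub>D cap (opp s)) \<circ>\<^sub>D (ids [opp s] \<otimes>\<^sub>D close_right s))"
    by (simp add: joins_simps turn_simps)
qed simp

lemma turned_S_ids_opp: "graph_isotopic ((turn_ccw s s s s (S s)) \<circ>\<^sub>D (turn_cw s s s s (ids [s, s]))) ((close_left s \<otimes>\<^sub>D ids [opp s]) \<circ>\<^sub>D (cup s \<circ>\<^sub>D cap s))"
proof (rule graph_isotopic_joins)
  show "joins gsrc gtgt (graph_zigzags s @ [])
     [Swap_Right 0]
     [Swap_Left 1]
     ((turn_ccw s s s s (S s)) \<circ>\<^sub>D (turn_cw s s s s (ids [s, s]))) ((close_left s \<otimes>\<^sub>D ids [opp s]) \<circ>\<^sub>D (cup s \<circ>\<^sub>D cap s))"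
    by (simp add: joins_simps turn_simps)
qed simp

lemma turned_ids_S_opp: "graph_isotopic ((turn_ccw s s s s (ids [s, s])) \<circ>\<^sub>D (turn_cw s s s s (S s))) ((cup s \<circ>\<^sub>D cap s) \<circ>\<^sub>D (close_left s \<otimes>\<^sub>D ids [opp s]))"
proof (rule graph_isotopic_joins)
  show "joins gsrc gtgt (graph_zigzags s @ [])
     [Swap_Left 4]
     [Swap_Right 3]
     ((turn_ccw s s s s (ids [s, s])) \<circ>\<^sub>D (turn_cw s s s s (S s))) ((cup s \<circ>\<^sub>D cap s) \<circ>\<^sub>D (close_left s \<otimes>\<^sub>D ids [opp s]))"
    by (simp add: joins_simps turn_simps)
qed simp

section \<open>Invariance under the tangle moves\<close>

lemma ids_dcomp: "top D = thin a \<Longrightarrow> ids a \<circ>\<^sub>D D = D"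
  and dcomp_ids: "bot D = thin a \<Longrightarrow> D \<circ>\<^sub>D ids a = D"
  by (simp_all add: ids_def idd_dcomp dcomp_idd)

section \<open>Quarter turns of linear combinations\<close>

definition turn_cw_linear :: "dir \<Rightarrow> dir \<Rightarrow> dir \<Rightarrow> dir \<Rightarrow> (tgraph \<Rightarrow>\<^sub>0 'r::comm_ring_1) \<Rightarrow> (tgraph \<Rightarrow>\<^sub>0 'r)" where
  "turn_cw_linear a b c d f = lc (ids [opp a, c] \<otimes>\<^sub>D cap d)
     \<circ>\<^sub>L (lc (ids [opp a]) \<otimes>\<^sub>L f \<otimes>\<^sub>L lc (ids [opp d])) \<circ>\<^sub>L lc (cup (opp a) \<otimes>\<^sub>D ids [b, opp d])"

definition turn_ccw_linear :: "dir \<Rightarrow> dir \<Rightarrow> dir \<Rightarrow> dir \<Rightarrow> (tgraph \<Rightarrow>\<^sub>0 'r::comm_ring_1) \<Rightarrow> (tgraph \<Rightarrow>\<^sub>0 'r)" where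
  "turn_ccw_linear a b c d f = lc (cap (opp c) \<otimes>\<^sub>D ids [d, opp b])
     \<circ>\<^sub>L (lc (ids [opp c]) \<otimes>\<^sub>L f \<otimes>\<^sub>L lc (ids [opp b])) \<circ>\<^sub>L lc (ids [opp c, a] \<otimes>\<^sub>D cup b)"

lemma turn_linear_simps:
  "turn_cw_linear a b c d (f + g) = turn_cw_linear a b c d f + turn_cw_linear a b c d g"
  "turn_cw_linear a b c d (k \<odot> f) = k \<odot> turn_cw_linear a b c d f"
  "turn_cw_linear a b c d (lc D) = lc (turn_cw a b c d D)"
  "turn_ccw_linear a b c d (f + g) = turn_ccw_linear a b c d f + turn_ccw_linear a b c d g"
  "turn_ccw_linear a b c d (k \<odot> f) = k \<odot> turn_ccw_linear a b c d f"
  "turn_ccw_linear a b c d (lc D) = lc (turn_ccw a b c d D)"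
  by (simp_all add: turn_cw_linear_def turn_ccw_linear_def turn_cw_def turn_ccw_def lcomp_simps ltensor_simps)

lemma is_tgraph_gen:
  "snd ` set (gsrc g) \<subseteq> {L1} \<Longrightarrow> snd ` set (gtgt g) \<subseteq> {L1} \<Longrightarrow> is_tgraph (gen gsrc gtgt g)"
  by (simp add: is_tgraph_def image_Un)

lemma is_tgraph_dcomp: "is_tgraph D \<Longrightarrow> is_tgraph E \<Longrightarrow> bot D = top E \<Longrightarrow> is_tgraph (D \<circ>\<^sub>D E)"
  and is_tgraph_dtensor: "is_tgraph D \<Longrightarrow> is_tgraph E \<Longrightarrow> is_tgraph (D \<otimes>\<^sub>D E)"
  using monoidal_tgraph by (auto simp: monoidal_def)

lemmas is_tgraph_intros = is_tgraph_gen is_tgraph_dcomp is_tgraph_dtensor is_tgraph_S is_tgraph_ids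

lemma moy_cong_turn_cw:
  assumes "moy_cong \<alpha> \<zeta> n [a, b] [c, d] f g"
  shows "moy_cong \<alpha> \<zeta> n [b, opp d] [opp a, c] (turn_cw_linear a b c d f) (turn_cw_linear a b c d g)"
proof -
  have "moy_cong \<alpha> \<zeta> n [opp a, c, d, opp d] [opp a, c]
      (lc (ids [opp a, c] \<otimes>\<^sub>D cap d)) (lc (ids [opp a, c] \<otimes>\<^sub>D cap d))"
    by (intro ideal_eq_refl hom_lc) (auto intro!: is_tgraph_intros)
  moreover have "moy_cong \<alpha> \<zeta> n [b, opp d] [opp a, a, b, opp d]
      (lc (cup (opp a) \<otimes>\<^sub>D ids [b, opp d])) (lc (cup (opp a) \<otimes>\<^sub>D ids [b, opp d]))"
    by (intro ideal_eq_refl hom_lc) (auto intro!: is_tgraph_intros)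
  moreover have "moy_cong \<alpha> \<zeta> n [opp a, a, b, opp d] [opp a, c, d, opp d]
      (lc (ids [opp a]) \<otimes>\<^sub>L f \<otimes>\<^sub>L lc (ids [opp d])) (lc (ids [opp a]) \<otimes>\<^sub>L g \<otimes>\<^sub>L lc (ids [opp d]))"
    using moy_cong_ltensor[OF moy_cong_ltensor[OF ideal_eq_refl[OF hom_ids[of "[opp a]"]] assms]
        ideal_eq_refl[OF hom_ids[of "[opp d]"]]]
    by simp
  ultimately show ?thesis
    unfolding turn_cw_linear_def by (blast intro: moy_cong_lcomp)
qed

text \<open>The flag is negated because after a quarter turn it is the other strand that runs from
  bottom left to top right.\<close>

lemma Z_gen_turn:
  "Z_gen \<alpha> \<zeta> (TCross Up Down p) = turn_cw_linear Up Up Up Up (crossing_value \<alpha> \<zeta> Up (\<not> p))"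
  "Z_gen \<alpha> \<zeta> (TCross Down Up p) = turn_ccw_linear Up Up Up Up (crossing_value \<alpha> \<zeta> Up (\<not> p))"
  "Z_gen \<alpha> \<zeta> (TCross s s p) = crossing_value \<alpha> \<zeta> s p"
  by (simp_all add: turn_cw_linear_def turn_ccw_linear_def) (cases s; simp)

text \<open>With \<open>Z_cong\<close> as the set of moves, the rewriting procedure may use every
  invariance proved so far as a rule on tangles.\<close>

lemma Z_cong_joins:
  assumes "joins tsrc ttgt rs xs ys D E" and "\<And>D E. (D, E) \<in> set rs \<Longrightarrow> Z_cong \<alpha> \<zeta> n D E"
  shows "Z_cong \<alpha> \<zeta> n D E"
proof (rule Z_cong_closed, rule joins_sound[OF _ _ assms(1)])
  show "parallel tsrc ttgt D E" if "Z_cong \<alpha> \<zeta> n D E" for D E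
    using that by (simp add: Z_cong_def)
qed (simp add: diagram_equiv.move assms(2))

lemma is_tangle_intros: "is_tangle (idd a)" "is_tangle (gen tsrc ttgt g)"
  "is_tangle D \<Longrightarrow> is_tangle E \<Longrightarrow> top E = bot D \<Longrightarrow> is_tangle (D \<circ>\<^sub>D E)"
  "is_tangle D \<Longrightarrow> is_tangle E \<Longrightarrow> is_tangle (D \<otimes>\<^sub>D E)"
  by (simp_all add: is_diagram_dcomp is_diagram_dtensor)

lemma Z_zigzag:
  "Z_cong \<alpha> \<zeta> n ((tcap s \<otimes>\<^sub>D idd [s]) \<circ>\<^sub>D (idd [s] \<otimes>\<^sub>D tcup (opp s))) (idd [s])"
  "Z_cong \<alpha> \<zeta> n ((idd [s] \<otimes>\<^sub>D tcap (opp s)) \<circ>\<^sub>D (tcup s \<otimes>\<^sub>D idd [s])) (idd [s])"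
proof -
  have "graph_isotopic ((cap s \<otimes>\<^sub>D ids [s]) \<circ>\<^sub>D (ids [s] \<otimes>\<^sub>D cup (opp s))) (ids [s])"
    "graph_isotopic ((ids [s] \<otimes>\<^sub>D cap (opp s)) \<circ>\<^sub>D (cup s \<otimes>\<^sub>D ids [s])) (ids [s])"
    unfolding ids_def list.map by (intro diagram_equiv.move graph_move.intros)+
  from this[THEN moy_cong_isotopic[of _ _ "[s]" "[s]" \<alpha> \<zeta> n]]
  show "Z_cong \<alpha> \<zeta> n ((tcap s \<otimes>\<^sub>D idd [s]) \<circ>\<^sub>D (idd [s] \<otimes>\<^sub>D tcup (opp s))) (idd [s])"
    "Z_cong \<alpha> \<zeta> n ((idd [s] \<otimes>\<^sub>D tcap (opp s)) \<circ>\<^sub>D (tcup s \<otimes>\<^sub>D idd [s])) (idd [s])"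
    by (simp_all add: Z_cong_def parallel_def is_tangle_intros Z_dcomp Z_dtensor lcomp_simps ltensor_simps)
qed

context moy_parameters
begin

section \<open>The defining relations as congruences, and coefficient identities\<close>

abbreviation cong :: "dir list \<Rightarrow> dir list \<Rightarrow> (tgraph \<Rightarrow>\<^sub>0 'r) \<Rightarrow> (tgraph \<Rightarrow>\<^sub>0 'r) \<Rightarrow> bool" where
  "cong \<equiv> moy_cong \<alpha> \<zeta> n"

lemma moy_circle: "cong [] [] (lc (cap s \<circ>\<^sub>D cup s)) (bracket \<alpha> \<zeta> n (int n) \<odot> lc (ids []))"
  by (rule ideal_eq_relator)
    (auto simp: moy_relators_def intro!: is_tgraph_intros hom_lc hom_scale)

lemma moy_S_S: "cong [s, s] [s, s] (lc (S s \<circ>\<^sub>D S s)) ((- (\<zeta> + unit_inv \<zeta>)) \<odot> lc (S s))"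
proof (rule ideal_eq_relator)
  show "lc (S s \<circ>\<^sub>D S s) - (- (\<zeta> + unit_inv \<zeta>)) \<odot> lc (S s) \<in> moy_relators \<alpha> \<zeta> n"
    unfolding moy_relators_def by blast
qed (auto simp: is_tgraph_S intro!: is_tgraph_intros hom_lc hom_scale)

lemma moy_close_left: "cong [s] [s] (lc (close_left s)) (bracket \<alpha> \<zeta> n (int n - 1) \<odot> lc (ids [s]))"
proof (rule ideal_eq_relator)
  show "lc (close_left s) - bracket \<alpha> \<zeta> n (int n - 1) \<odot> lc (ids [s]) \<in> moy_relators \<alpha> \<zeta> n"
    unfolding moy_relators_def close_left_def by blast
qed (auto simp: close_left_def is_tgraph_S intro!: is_tgraph_intros hom_lc hom_scale)

lemma moy_square: "cong [s, opp s] [s, opp s] (lc (square s))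
  (lc (cup s \<circ>\<^sub>D cap s) + bracket \<alpha> \<zeta> n (int n - 2) \<odot> lc (ids [s, opp s]))"
proof (rule ideal_eq_relator)
  show "lc (square s) - (lc (cup s \<circ>\<^sub>D cap s) + bracket \<alpha> \<zeta> n (int n - 2) \<odot> lc (ids [s, opp s]))
      \<in> moy_relators \<alpha> \<zeta> n"
    unfolding moy_relators_def square_def by blast
qed (auto simp: square_def is_tgraph_S intro!: is_tgraph_intros hom_lc hom_scale hom_add)

lemma moy_braid: "cong [s, s, s] [s, s, s]
  (lc ((S s \<otimes>\<^sub>D ids [s]) \<circ>\<^sub>D (ids [s] \<otimes>\<^sub>D S s) \<circ>\<^sub>D (S s \<otimes>\<^sub>D ids [s])) + lc (ids [s] \<otimes>\<^sub>D S s))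
  (lc ((ids [s] \<otimes>\<^sub>D S s) \<circ>\<^sub>D (S s \<otimes>\<^sub>D ids [s]) \<circ>\<^sub>D (ids [s] \<otimes>\<^sub>D S s)) + lc (S s \<otimes>\<^sub>D ids [s]))"
proof (rule ideal_eq_relator)
  show "lc ((S s \<otimes>\<^sub>D ids [s]) \<circ>\<^sub>D (ids [s] \<otimes>\<^sub>D S s) \<circ>\<^sub>D (S s \<otimes>\<^sub>D ids [s])) + lc (ids [s] \<otimes>\<^sub>D S s) -
      (lc ((ids [s] \<otimes>\<^sub>D S s) \<circ>\<^sub>D (S s \<otimes>\<^sub>D ids [s]) \<circ>\<^sub>D (ids [s] \<otimes>\<^sub>D S s)) + lc (S s \<otimes>\<^sub>D ids [s]))
      \<in> moy_relators \<alpha> \<zeta> n"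
    unfolding moy_relators_def by blast
qed (auto simp: is_tgraph_S intro!: is_tgraph_intros hom_lc hom_add)

text \<open>A crossing has the form \<kappa> (\<tau> id + S). Negating the flag inverts both
  scalars, which is what makes the opposite crossing its inverse.\<close>

definition \<kappa> :: "bool \<Rightarrow> 'r" where "\<kappa> p = (if p then unit_inv \<alpha> else \<alpha>)"
definition \<tau> :: "bool \<Rightarrow> 'r" where "\<tau> p = (if p then unit_inv \<zeta> else \<zeta>)"

lemma crossing_value: "crossing_value \<alpha> \<zeta> s p = \<kappa> p \<odot> (\<tau> p \<odot> lc (ids [s, s]) + lc (S s))"
  by (simp add: crossing_value_def \<kappa>_def \<tau>_def)

lemma \<kappa>_mult [simp]: "\<kappa> p * \<kappa> (\<not> p) = 1" "\<kappa> (\<not> p) * \<kappa> p = 1"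
  and \<tau>_mult [simp]: "\<tau> p * \<tau> (\<not> p) = 1" "\<tau> (\<not> p) * \<tau> p = 1"
  and \<tau>_add: "\<tau> p + \<tau> (\<not> p) = \<zeta> + unit_inv \<zeta>"
  by (simp_all add: \<kappa>_def \<tau>_def)

text \<open>The coefficient of a curl: the identity closes up to a strand with a circle, S to a
  multiple of the strand. The terms with \<alpha> squared or its inverse cancel, and \<kappa>
  normalises the remaining (1/\<zeta> - \<zeta>) w to 1.\<close>

lemma curl_coefficient:
  "\<kappa> p * (\<tau> p * bracket \<alpha> \<zeta> n (int n) + bracket \<alpha> \<zeta> n (int n - 1)) = 1"
proof -
  have "unit_inv \<alpha> * (unit_inv \<zeta> * ((\<alpha> - unit_inv \<alpha>) * w) + (unit_inv \<alpha> * unit_inv \<zeta> - \<alpha> * \<zeta>) * w) =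
      (unit_inv \<alpha> * \<alpha>) * ((unit_inv \<zeta> - \<zeta>) * w)"
    "\<alpha> * (\<zeta> * ((\<alpha> - unit_inv \<alpha>) * w) + (unit_inv \<alpha> * unit_inv \<zeta> - \<alpha> * \<zeta>) * w) =
      (unit_inv \<alpha> * \<alpha>) * ((unit_inv \<zeta> - \<zeta>) * w)"
    by (simp_all add: algebra_simps del: mult_inv_\<alpha> mult_inv_\<zeta>)
  then show ?thesis
    by (simp add: \<kappa>_def \<tau>_def bracket_n bracket_n_1 mult_w)
qed

text \<open>The three-term recursion of quantum integers at -\<zeta>. The left side is the
  coefficient of the cup-cap graph in R2 for antiparallel strands.\<close>

lemma bracket_recurrence:
  "bracket \<alpha> \<zeta> n (int n) + bracket \<alpha> \<zeta> n (int n - 2) + (\<tau> p + \<tau> (\<not> p)) * bracket \<alpha> \<zeta> n (int n - 1) = 0"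
proof -
  have "(\<alpha> - unit_inv \<alpha>) * w + (\<alpha> * \<zeta>\<^sup>2 - unit_inv \<alpha> * (unit_inv \<zeta>)\<^sup>2) * w
      + (\<zeta> + unit_inv \<zeta>) * ((unit_inv \<alpha> * unit_inv \<zeta> - \<alpha> * \<zeta>) * w)
      = (1 - \<zeta> * unit_inv \<zeta>) * ((\<alpha> - unit_inv \<alpha>) * w)"
    by (simp add: algebra_simps power2_eq_square del: mult_inv_\<alpha> mult_inv_\<zeta>)
  then show ?thesis
    by (simp add: bracket_n bracket_n_1 bracket_n_2 \<tau>_add)
qed

text \<open>For distinct \<open>p\<close> and \<open>r\<close>, \<tau> p + \<tau> r = \<zeta> +
  1/\<zeta> and \<tau> p * \<tau> r = 1. If all three flags agree, \<tau> q (\<zeta> + 1/\<zeta>) is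
  the square of \<tau> q plus 1. The excluded case, \<open>p = r\<close> with \<open>q\<close>
  different, is the one that no ordering by height produces.\<close>

lemma reidemeister3_coefficient:
  assumes "p = r \<Longrightarrow> q = p"
  shows "\<tau> q * \<tau> p + \<tau> r * \<tau> q + 1 = \<tau> p * \<tau> r + \<tau> q * (\<zeta> + unit_inv \<zeta>)"
  using assms mult_inv_\<zeta>
  by (cases p; cases q; cases r) (simp_all add: \<tau>_def algebra_simps)

section \<open>The first Reidemeister move\<close>

lemma moy_close_right: "cong [s] [s] (lc (close_right s)) (bracket \<alpha> \<zeta> n (int n - 1) \<odot> lc (ids [s]))"
proof -
  let ?X = "ids [s] \<otimes>\<^sub>D cap (opp s)" and ?Y = "cup s \<otimes>\<^sub>D ids [s]"
  let ?T = "\<lambda>f. lc ?X \<circ>\<^sub>L (lc (ids [s]) \<otimes>\<^sub>L f \<otimes>\<^sub>L lc (ids [s])) \<circ>\<^sub>L lc ?Y"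
  have T: "?T (lc D) = lc (turn_strand s D)" "?T (k \<odot> f) = k \<odot> ?T f" for D k f
    by (simp_all add: turn_strand_def lcomp_simps ltensor_simps)
  have "cong [s, opp s, s] [s, opp s, s]
      (lc (ids [s]) \<otimes>\<^sub>L lc (close_left (opp s)) \<otimes>\<^sub>L lc (ids [s]))
      (lc (ids [s]) \<otimes>\<^sub>L (bracket \<alpha> \<zeta> n (int n - 1) \<odot> lc (ids [opp s])) \<otimes>\<^sub>L lc (ids [s]))"
    using moy_cong_ltensor[OF moy_cong_ltensor[OF ideal_eq_refl[OF hom_ids[of "[s]"]] moy_close_left[of "opp s"]]
        ideal_eq_refl[OF hom_ids[of "[s]"]]]
    by simp
  moreover have "cong [s, opp s, s] [s] (lc ?X) (lc ?X)" "cong [s] [s, opp s, s] (lc ?Y) (lc ?Y)"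
    by (intro ideal_eq_refl hom_lc; auto intro!: is_tgraph_intros)+
  ultimately have "cong [s] [s] (?T (lc (close_left (opp s))))
      (?T (bracket \<alpha> \<zeta> n (int n - 1) \<odot> lc (ids [opp s])))"
    by (blast intro: moy_cong_lcomp)
  then have "cong [s] [s] (lc (turn_strand s (close_left (opp s))))
      (bracket \<alpha> \<zeta> n (int n - 1) \<odot> lc (turn_strand s (ids [opp s])))"
    by (simp only: T)
  moreover have "cong [s] [s] (lc (close_right s)) (lc (turn_strand s (close_left (opp s))))"
    by (rule moy_cong_isotopic[OF close_right_turn]) (simp_all add: close_right_def)
  moreover have "cong [s] [s] (bracket \<alpha> \<zeta> n (int n - 1) \<odot> lc (turn_strand s (ids [opp s])))
      (bracket \<alpha> \<zeta> n (int n - 1) \<odot> lc (ids [s]))"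
    by (rule ideal_eq_scale, rule moy_cong_isotopic[OF turn_strand_ids]) (simp_all add: turn_strand_def)
  ultimately show ?thesis
    by (blast intro: ideal_eq_trans)
qed

lemma Z_reidemeister1:
  "Z_cong \<alpha> \<zeta> n
    ((idd [s] \<otimes>\<^sub>D tcap s) \<circ>\<^sub>D (tcross s s p \<otimes>\<^sub>D idd [opp s]) \<circ>\<^sub>D (idd [s] \<otimes>\<^sub>D tcup s)) (idd [s])"
  "Z_cong \<alpha> \<zeta> n
    ((tcap (opp s) \<otimes>\<^sub>D idd [s]) \<circ>\<^sub>D (idd [opp s] \<otimes>\<^sub>D tcross s s p) \<circ>\<^sub>D (tcup (opp s) \<otimes>\<^sub>D idd [s]))
    (idd [s])"
proof -
  let ?n = "bracket \<alpha> \<zeta> n (int n)" and ?m = "bracket \<alpha> \<zeta> n (int n - 1)"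
  let ?k = "lc (ids [s]) :: tgraph \<Rightarrow>\<^sub>0 'r"
  have circle: "cong [s] [s] (lc (ids [s] \<otimes>\<^sub>D (cap s \<circ>\<^sub>D cup s))) (?n \<odot> ?k)"
    "cong [s] [s] (lc ((cap (opp s) \<circ>\<^sub>D cup (opp s)) \<otimes>\<^sub>D ids [s])) (?n \<odot> ?k)"
    using moy_cong_ltensor[OF ideal_eq_refl[OF hom_ids[of "[s]"]] moy_circle[of s]]
      moy_cong_ltensor[OF moy_circle[of "opp s"] ideal_eq_refl[OF hom_ids[of "[s]"]]]
    by (simp_all add: ltensor_simps ids_append)
  have "cong [s] [s] (\<kappa> p \<odot> (\<tau> p \<odot> lc C + lc D)) ?k"
    if "cong [s] [s] (lc C) (?n \<odot> ?k)" "cong [s] [s] (lc D) (?m \<odot> ?k)" for C D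
  proof -
    have "cong [s] [s] (\<kappa> p \<odot> (\<tau> p \<odot> lc C + lc D)) (\<kappa> p \<odot> (\<tau> p \<odot> ?n \<odot> ?k + ?m \<odot> ?k))"
      using that by (intro ideal_eq_scale ideal_eq_add)
    also have "\<kappa> p \<odot> (\<tau> p \<odot> ?n \<odot> ?k + ?m \<odot> ?k) = (\<kappa> p * (\<tau> p * ?n + ?m)) \<odot> ?k"
      by (simp add: scale_scale flip: scale_add_left)
    finally show ?thesis
      by (simp add: curl_coefficient)
  qed
  note curl = this[OF circle(1) moy_close_right[of s]] this[OF circle(2) moy_close_left[of s]]
  \<comment> \<open>The identity term of a curl has literally the same slices as a strand next to a
    circle, so no isotopy is involved.\<close>
  have "(ids [s] \<otimes>\<^sub>D cap s) \<circ>\<^sub>D (ids [s, s] \<otimes>\<^sub>D ids [opp s]) \<circ>\<^sub>D (ids [s] \<otimes>\<^sub>D cup s)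
      = ids [s] \<otimes>\<^sub>D (cap s \<circ>\<^sub>D cup s)"
    "(cap (opp s) \<otimes>\<^sub>D ids [s]) \<circ>\<^sub>D (ids [opp s] \<otimes>\<^sub>D ids [s, s]) \<circ>\<^sub>D (cup (opp s) \<otimes>\<^sub>D ids [s])
      = (cap (opp s) \<circ>\<^sub>D cup (opp s)) \<otimes>\<^sub>D ids [s]"
    by (simp_all add: dcomp_def dtensor_def ids_def idd_def gen_def)
  with curl show "Z_cong \<alpha> \<zeta> n
    ((idd [s] \<otimes>\<^sub>D tcap s) \<circ>\<^sub>D (tcross s s p \<otimes>\<^sub>D idd [opp s]) \<circ>\<^sub>D (idd [s] \<otimes>\<^sub>D tcup s)) (idd [s])"
   "Z_cong \<alpha> \<zeta> n
    ((tcap (opp s) \<otimes>\<^sub>D idd [s]) \<circ>\<^sub>D (idd [opp s] \<otimes>\<^sub>D tcross s s p) \<circ>\<^sub>D (tcup (opp s) \<otimes>\<^sub>D idd [s]))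
    (idd [s])"
    by (simp_all add: Z_cong_def parallel_def is_tangle_intros Z_dcomp Z_dtensor Z_gen_turn crossing_value
        lcomp_simps ltensor_simps close_right_def close_left_def)
qed

section \<open>Rotation of crossings\<close>

lemma moy_cong_crossing:
  assumes "graph_isotopic D D'" "graph_isotopic E E'"
    and "bot D = thin a" "top D = thin b" "bot E = thin a" "top E = thin b"
  shows "cong a b (k \<odot> (t \<odot> lc D + lc E)) (k \<odot> (t \<odot> lc D' + lc E'))"
  using assms by (intro ideal_eq_scale ideal_eq_add moy_cong_isotopic)

text \<open>The cases follow a crossing through a full turn. The first quarter is the definition of
  the value on \<open>TCross Up Down\<close>; the second reaches the downward crossing by the half
  turn of S; the third compares with the counterclockwise definition of
  \<open>TCross Down Up\<close>; the last one undoes that definition.\<close>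

lemma Z_rotate:
  "Z_cong \<alpha> \<zeta> n
    ((idd [opp a, b] \<otimes>\<^sub>D tcap a) \<circ>\<^sub>D (idd [opp a] \<otimes>\<^sub>D tcross a b p \<otimes>\<^sub>D idd [opp a])
      \<circ>\<^sub>D (tcup (opp a) \<otimes>\<^sub>D idd [b, opp a]))
    (tcross b (opp a) (\<not> p))"
proof -
  have "cong [b, opp a] [opp a, b] (turn_cw_linear a b b a (Z_gen \<alpha> \<zeta> (TCross a b p)))
      (Z_gen \<alpha> \<zeta> (TCross b (opp a) (\<not> p)))"
  proof (cases a; cases b)
    assume ab: "a = Up" "b = Up"
    have "turn_cw_linear a b b a (Z_gen \<alpha> \<zeta> (TCross a b p)) = Z_gen \<alpha> \<zeta> (TCross b (opp a) (\<not> p))"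
      by (simp add: ab Z_gen_turn del: Z_gen.simps)
    then show ?thesis
      using hom_Z_gen[of \<alpha> \<zeta> "TCross b (opp a) (\<not> p)"] by (simp add: ideal_eq_refl del: Z_gen.simps)
  next
    assume ab: "a = Up" "b = Down"
    show ?thesis
      using moy_cong_crossing[OF turn_ids_cw_cw[of Up] turn_S_cw[of Up, THEN diagram_equiv.sym], of "[Down, Down]" "[Down, Down]"]
      by (simp add: ab Z_gen_turn crossing_value turn_linear_simps turn_cw_def del: Z_gen.simps)
  next
    assume ab: "a = Down" "b = Down"
    show ?thesis
      using moy_cong_crossing[OF turn_ids_three_quarters[of Up] turn_S_three_quarters[of Up], of "[Down, Up]" "[Up, Down]"]
      by (simp add: ab Z_gen_turn crossing_value turn_linear_simps turn_cw_def del: Z_gen.simps)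
  next
    assume ab: "a = Down" "b = Up"
    show ?thesis
      using moy_cong_crossing[OF turn_ids_ccw_cw[of Up] turn_S_ccw_cw[of Up], of "[Up, Up]" "[Up, Up]"]
      by (simp add: ab Z_gen_turn crossing_value turn_linear_simps turn_cw_def del: Z_gen.simps)
  qed
  then show ?thesis
    by (simp add: Z_cong_def parallel_def is_tangle_intros Z_dcomp Z_dtensor lcomp_simps ltensor_simps
        turn_cw_linear_def del: Z_gen.simps(3-))
qed

section \<open>The second Reidemeister move\<close>

lemma lcomp_crossings:
  "(k \<odot> (t \<odot> lc D + lc E)) \<circ>\<^sub>L (k' \<odot> (t' \<odot> lc D' + lc E')) = (k * k') \<odot>
     ((t * t') \<odot> lc (D \<circ>\<^sub>D D') + t \<odot> lc (D \<circ>\<^sub>D E') + t' \<odot> lc (E \<circ>\<^sub>D D') + lc (E \<circ>\<^sub>D E'))"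
  by (rule poly_mapping_eqI) (simp add: lcomp_simps lookup_add algebra_simps)

text \<open>In (1/\<tau> id + S)(\<tau> id + S) the linear terms add up to (\<zeta> + 1/\<zeta>) S,
  which the relation for the square of S cancels.\<close>

lemma Z_reidemeister2_parallel:
  "Z_cong \<alpha> \<zeta> n (tcross s s (\<not> p) \<circ>\<^sub>D tcross s s p) (idd [s, s])"
proof -
  let ?I = "lc (ids [s, s]) :: tgraph \<Rightarrow>\<^sub>0 'r" and ?S = "lc (S s) :: tgraph \<Rightarrow>\<^sub>0 'r"
  let ?R = "?I + (\<tau> p + \<tau> (\<not> p)) \<odot> ?S"
  have "Z \<alpha> \<zeta> (tcross s s (\<not> p) \<circ>\<^sub>D tcross s s p) = ?R + lc (S s \<circ>\<^sub>D S s)"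
    by (simp add: Z_dcomp Z_gen_turn crossing_value lcomp_crossings ids_dcomp dcomp_ids is_tgraph_S
        scale_add_left)
  also have "cong [s, s] [s, s] (?R + lc (S s \<circ>\<^sub>D S s)) (?R + (- (\<zeta> + unit_inv \<zeta>)) \<odot> ?S)"
    by (intro ideal_eq_add moy_S_S ideal_eq_refl hom_add hom_scale hom_lc) (simp_all add: is_tgraph_S)
  also have "?R + (- (\<zeta> + unit_inv \<zeta>)) \<odot> ?S = ?I"
    by (rule poly_mapping_eqI) (simp add: lookup_add \<tau>_add algebra_simps)
  finally show ?thesis
    by (simp add: Z_cong_def parallel_def is_tangle_intros)
qed

text \<open>The four graphs are the products of turned identities (I) and turned copies of S (T),
  and \<open>K\<close> is a cup above a cap. The coefficient of \<open>K\<close> in the sum vanishes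
  by \<open>bracket_recurrence\<close>.\<close>

lemma reidemeister2_antiparallel:
  fixes K :: tgraph
  assumes "cong a a (lc II) (bracket \<alpha> \<zeta> n (int n) \<odot> lc K)"
    and "cong a a (lc IT) (bracket \<alpha> \<zeta> n (int n - 1) \<odot> lc K)"
    and "cong a a (lc TI) (bracket \<alpha> \<zeta> n (int n - 1) \<odot> lc K)"
    and "cong a a (lc TT) (lc (ids a) + bracket \<alpha> \<zeta> n (int n - 2) \<odot> lc K)"
  shows "cong a a (lc II + \<tau> (\<not> p) \<odot> lc IT + \<tau> p \<odot> lc TI + lc TT) (lc (ids a))"
proof -
  let ?n = "bracket \<alpha> \<zeta> n (int n)" and ?m = "bracket \<alpha> \<zeta> n (int n - 1)"
    and ?k = "bracket \<alpha> \<zeta> n (int n - 2)"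
  have "cong a a (lc II + \<tau> (\<not> p) \<odot> lc IT + \<tau> p \<odot> lc TI + lc TT)
      (?n \<odot> lc K + \<tau> (\<not> p) \<odot> ?m \<odot> lc K + \<tau> p \<odot> ?m \<odot> lc K + (lc (ids a) + ?k \<odot> lc K))"
    using assms by (intro ideal_eq_add ideal_eq_scale)
  also have "?n \<odot> lc K + \<tau> (\<not> p) \<odot> ?m \<odot> lc K + \<tau> p \<odot> ?m \<odot> lc K + (lc (ids a) + ?k \<odot> lc K)
      = lc (ids a) + (?n + ?k + (\<tau> p + \<tau> (\<not> p)) * ?m) \<odot> lc K"
    by (rule poly_mapping_eqI) (simp add: lookup_add algebra_simps)
  finally show ?thesis
    by (simp add: bracket_recurrence)
qed

lemma moy_cong_isotopic_trans:
  "graph_isotopic D E \<Longrightarrow> bot E = thin a \<Longrightarrow> top E = thin b \<Longrightarrow> cong a b (lc E) f \<Longrightarrow> cong a b (lc D) f"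
  using moy_cong_isotopic[of D E a b \<alpha> \<zeta> n] graph_isotopic_parallel[of D E]
  by (auto simp: parallel_def intro: ideal_eq_trans)

lemma moy_circle_inside:
  "cong [opp s, s] [opp s, s] (lc (cup (opp s) \<circ>\<^sub>D (cap s \<circ>\<^sub>D cup s) \<circ>\<^sub>D cap (opp s)))
    (bracket \<alpha> \<zeta> n (int n) \<odot> lc (cup (opp s) \<circ>\<^sub>D cap (opp s)))"
proof -
  have "cong [opp s, s] [opp s, s] (lc (cup (opp s)) \<circ>\<^sub>L lc (cap s \<circ>\<^sub>D cup s) \<circ>\<^sub>L lc (cap (opp s)))
      (lc (cup (opp s)) \<circ>\<^sub>L (bracket \<alpha> \<zeta> n (int n) \<odot> lc (ids [])) \<circ>\<^sub>L lc (cap (opp s)))"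
    by (intro moy_cong_lcomp[where b = "thin []"] moy_circle ideal_eq_refl hom_lc)
      (auto intro!: is_tgraph_intros)
  then show ?thesis
    by (simp add: lcomp_simps dcomp_ids)
qed

lemma moy_close_right_inside:
  "cong [opp s, s] [opp s, s] (lc ((ids [opp s] \<otimes>\<^sub>D close_right s) \<circ>\<^sub>D (cup (opp s) \<circ>\<^sub>D cap (opp s))))
    (bracket \<alpha> \<zeta> n (int n - 1) \<odot> lc (cup (opp s) \<circ>\<^sub>D cap (opp s)))"
  "cong [opp s, s] [opp s, s] (lc ((cup (opp s) \<circ>\<^sub>D cap (opp s)) \<circ>\<^sub>D (ids [opp s] \<otimes>\<^sub>D close_right s)))
    (bracket \<alpha> \<zeta> n (int n - 1) \<odot> lc (cup (opp s) \<circ>\<^sub>D cap (opp s)))"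
proof -
  let ?K = "lc (cup (opp s) \<circ>\<^sub>D cap (opp s)) :: tgraph \<Rightarrow>\<^sub>0 'r"
  have K: "cong [opp s, s] [opp s, s] ?K ?K"
    by (intro ideal_eq_refl hom_lc) (auto intro!: is_tgraph_intros)
  have C: "cong [opp s, s] [opp s, s] (lc (ids [opp s]) \<otimes>\<^sub>L lc (close_right s))
      (lc (ids [opp s]) \<otimes>\<^sub>L (bracket \<alpha> \<zeta> n (int n - 1) \<odot> lc (ids [s])))"
    using moy_cong_ltensor[OF ideal_eq_refl[OF hom_ids[of "[opp s]"]] moy_close_right[of s]] by simp
  show "cong [opp s, s] [opp s, s] (lc ((ids [opp s] \<otimes>\<^sub>D close_right s) \<circ>\<^sub>D (cup (opp s) \<circ>\<^sub>D cap (opp s))))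
    (bracket \<alpha> \<zeta> n (int n - 1) \<odot> lc (cup (opp s) \<circ>\<^sub>D cap (opp s)))"
    using moy_cong_lcomp[OF C K] by (simp add: lcomp_simps ltensor_simps ids_append ids_dcomp)
  show "cong [opp s, s] [opp s, s] (lc ((cup (opp s) \<circ>\<^sub>D cap (opp s)) \<circ>\<^sub>D (ids [opp s] \<otimes>\<^sub>D close_right s)))
    (bracket \<alpha> \<zeta> n (int n - 1) \<odot> lc (cup (opp s) \<circ>\<^sub>D cap (opp s)))"
    using moy_cong_lcomp[OF K C] by (simp add: lcomp_simps ltensor_simps ids_append dcomp_ids)
qed

lemma moy_close_left_inside:
  "cong [s, opp s] [s, opp s] (lc ((close_left s \<otimes>\<^sub>D ids [opp s]) \<circ>\<^sub>D (cup s \<circ>\<^sub>D cap s)))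
    (bracket \<alpha> \<zeta> n (int n - 1) \<odot> lc (cup s \<circ>\<^sub>D cap s))"
  "cong [s, opp s] [s, opp s] (lc ((cup s \<circ>\<^sub>D cap s) \<circ>\<^sub>D (close_left s \<otimes>\<^sub>D ids [opp s])))
    (bracket \<alpha> \<zeta> n (int n - 1) \<odot> lc (cup s \<circ>\<^sub>D cap s))"
proof -
  let ?K = "lc (cup s \<circ>\<^sub>D cap s) :: tgraph \<Rightarrow>\<^sub>0 'r"
  have K: "cong [s, opp s] [s, opp s] ?K ?K"
    by (intro ideal_eq_refl hom_lc) (auto intro!: is_tgraph_intros)
  have C: "cong [s, opp s] [s, opp s] (lc (close_left s) \<otimes>\<^sub>L lc (ids [opp s]))
      ((bracket \<alpha> \<zeta> n (int n - 1) \<odot> lc (ids [s])) \<otimes>\<^sub>L lc (ids [opp s]))"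
    using moy_cong_ltensor[OF moy_close_left[of s] ideal_eq_refl[OF hom_ids[of "[opp s]"]]] by simp
  show "cong [s, opp s] [s, opp s] (lc ((close_left s \<otimes>\<^sub>D ids [opp s]) \<circ>\<^sub>D (cup s \<circ>\<^sub>D cap s)))
    (bracket \<alpha> \<zeta> n (int n - 1) \<odot> lc (cup s \<circ>\<^sub>D cap s))"
    using moy_cong_lcomp[OF C K] by (simp add: lcomp_simps ltensor_simps ids_append ids_dcomp)
  show "cong [s, opp s] [s, opp s] (lc ((cup s \<circ>\<^sub>D cap s) \<circ>\<^sub>D (close_left s \<otimes>\<^sub>D ids [opp s])))
    (bracket \<alpha> \<zeta> n (int n - 1) \<odot> lc (cup s \<circ>\<^sub>D cap s))"
    using moy_cong_lcomp[OF K C] by (simp add: lcomp_simps ltensor_simps ids_append dcomp_ids)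
qed

text \<open>The square relation after a quarter turn, which exchanges the roles of its two terms.\<close>

lemma moy_turned_square:
  "cong [opp s, s] [opp s, s] (lc (turn_cw s (opp s) s (opp s) (square s)))
    (lc (ids [opp s, s]) + bracket \<alpha> \<zeta> n (int n - 2) \<odot> lc (cup (opp s) \<circ>\<^sub>D cap (opp s)))"
proof -
  have "cong [opp s, s] [opp s, s] (lc (turn_cw s (opp s) s (opp s) (square s)))
      (lc (turn_cw s (opp s) s (opp s) (cup s \<circ>\<^sub>D cap s)) +
       bracket \<alpha> \<zeta> n (int n - 2) \<odot> lc (turn_cw s (opp s) s (opp s) (ids [s, opp s])))"
    using moy_cong_turn_cw[OF moy_square[of s]] by (simp add: turn_linear_simps)
  also have "cong [opp s, s] [opp s, s] \<dots>
      (lc (ids [opp s, s]) + bracket \<alpha> \<zeta> n (int n - 2) \<odot> lc (cup (opp s) \<circ>\<^sub>D cap (opp s)))"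
    by (intro ideal_eq_add ideal_eq_scale moy_cong_isotopic turn_cup_cap turn_ids_opp)
      (simp_all add: turn_cw_def)
  finally show ?thesis .
qed

lemma Z_reidemeister2: "Z_cong \<alpha> \<zeta> n (tcross b a (\<not> p) \<circ>\<^sub>D tcross a b p) (idd [a, b])"
proof (cases "a = b")
  case True
  then show ?thesis
    using Z_reidemeister2_parallel by simp
next
  case False
  let ?R = "turn_cw Up Up Up Up" and ?L = "turn_ccw Up Up Up Up"
  let ?I = "ids [Up, Up]" and ?S = "S Up"
  have 1: "cong [Up, Down] [Up, Down]
      (lc (?L ?I \<circ>\<^sub>D ?R ?I) + \<tau> p \<odot> lc (?L ?I \<circ>\<^sub>D ?R ?S) + \<tau> (\<not> p) \<odot> lc (?L ?S \<circ>\<^sub>D ?R ?I)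
        + lc (?L ?S \<circ>\<^sub>D ?R ?S))
      (lc (ids [Up, Down]))"
  \<comment> \<open>A mixed crossing is the turn of an upward crossing with the opposite flag, hence
    the negated \<open>p\<close>.\<close>
  proof (rule reidemeister2_antiparallel[where p = "\<not> p" and K = "cup Up \<circ>\<^sub>D cap Up", simplified not_not])
    show "cong [Up, Down] [Up, Down] (lc (?L ?I \<circ>\<^sub>D ?R ?I)) (bracket \<alpha> \<zeta> n (int n) \<odot> lc (cup Up \<circ>\<^sub>D cap Up))"
      using moy_circle_inside[of Down] by (intro moy_cong_isotopic_trans[OF turned_ids_ids_opp[of Up]]) (simp_all add: close_left_def turn_cw_def)
    show "cong [Up, Down] [Up, Down] (lc (?L ?I \<circ>\<^sub>D ?R ?S)) (bracket \<alpha> \<zeta> n (int n - 1) \<odot> lc (cup Up \<circ>\<^sub>D cap Up))"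
      using moy_close_left_inside[of Up] by (intro moy_cong_isotopic_trans[OF turned_ids_S_opp[of Up]]) (simp_all add: close_left_def turn_cw_def)
    show "cong [Up, Down] [Up, Down] (lc (?L ?S \<circ>\<^sub>D ?R ?I)) (bracket \<alpha> \<zeta> n (int n - 1) \<odot> lc (cup Up \<circ>\<^sub>D cap Up))"
      using moy_close_left_inside[of Up] by (intro moy_cong_isotopic_trans[OF turned_S_ids_opp[of Up]]) (simp_all add: close_left_def turn_cw_def)
    show "cong [Up, Down] [Up, Down] (lc (?L ?S \<circ>\<^sub>D ?R ?S)) (lc (ids [Up, Down]) + bracket \<alpha> \<zeta> n (int n - 2) \<odot> lc (cup Up \<circ>\<^sub>D cap Up))"
      using moy_turned_square[of Down] by (intro moy_cong_isotopic_trans[OF turned_square_opp[of Up]]) (simp_all add: close_left_def turn_cw_def)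
  qed
  have 2: "cong [Down, Up] [Down, Up]
      (lc (?R ?I \<circ>\<^sub>D ?L ?I) + \<tau> p \<odot> lc (?R ?I \<circ>\<^sub>D ?L ?S) + \<tau> (\<not> p) \<odot> lc (?R ?S \<circ>\<^sub>D ?L ?I)
        + lc (?R ?S \<circ>\<^sub>D ?L ?S))
      (lc (ids [Down, Up]))"
  proof (rule reidemeister2_antiparallel[where p = "\<not> p" and K = "cup Down \<circ>\<^sub>D cap Down", simplified not_not])
    show "cong [Down, Up] [Down, Up] (lc (?R ?I \<circ>\<^sub>D ?L ?I)) (bracket \<alpha> \<zeta> n (int n) \<odot> lc (cup Down \<circ>\<^sub>D cap Down))"
      using moy_circle_inside[of Up] by (intro moy_cong_isotopic_trans[OF turned_ids_ids[of Up]]) (simp_all add: close_right_def turn_cw_def)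
    show "cong [Down, Up] [Down, Up] (lc (?R ?I \<circ>\<^sub>D ?L ?S)) (bracket \<alpha> \<zeta> n (int n - 1) \<odot> lc (cup Down \<circ>\<^sub>D cap Down))"
      using moy_close_right_inside[of Up] by (intro moy_cong_isotopic_trans[OF turned_ids_S[of Up]]) (simp_all add: close_right_def turn_cw_def)
    show "cong [Down, Up] [Down, Up] (lc (?R ?S \<circ>\<^sub>D ?L ?I)) (bracket \<alpha> \<zeta> n (int n - 1) \<odot> lc (cup Down \<circ>\<^sub>D cap Down))"
      using moy_close_right_inside[of Up] by (intro moy_cong_isotopic_trans[OF turned_S_ids[of Up]]) (simp_all add: close_right_def turn_cw_def)
    show "cong [Down, Up] [Down, Up] (lc (?R ?S \<circ>\<^sub>D ?L ?S)) (lc (ids [Down, Up]) + bracket \<alpha> \<zeta> n (int n - 2) \<odot> lc (cup Down \<circ>\<^sub>D cap Down))"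
      using moy_turned_square[of Up] by (intro moy_cong_isotopic_trans[OF turned_square[of Up]]) (simp_all add: close_right_def turn_cw_def)
  qed
  from False consider "a = Up" "b = Down" | "a = Down" "b = Up"
    by (cases a; cases b) auto
  then have "cong [a, b] [a, b] (Z_gen \<alpha> \<zeta> (TCross b a (\<not> p)) \<circ>\<^sub>L Z_gen \<alpha> \<zeta> (TCross a b p)) (lc (ids [a, b]))"
    using 1 2
    by cases (simp_all add: Z_gen_turn crossing_value turn_linear_simps lcomp_crossings del: Z_gen.simps)
  then show ?thesis
    by (simp add: Z_cong_def parallel_def is_tangle_intros Z_dcomp del: Z_gen.simps)
qed

section \<open>The third Reidemeister move\<close>

definition reidemeister3 :: "dir \<Rightarrow> dir \<Rightarrow> dir \<Rightarrow> bool \<Rightarrow> bool \<Rightarrow> bool \<Rightarrow> bool" where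
  "reidemeister3 a b c p q r \<longleftrightarrow> Z_cong \<alpha> \<zeta> n
    ((tcross b c r \<otimes>\<^sub>D idd [a]) \<circ>\<^sub>D (idd [b] \<otimes>\<^sub>D tcross a c q) \<circ>\<^sub>D (tcross a b p \<otimes>\<^sub>D idd [c]))
    ((idd [c] \<otimes>\<^sub>D tcross a b p) \<circ>\<^sub>D (tcross a c q \<otimes>\<^sub>D idd [b]) \<circ>\<^sub>D (idd [a] \<otimes>\<^sub>D tcross b c r))"

lemma reidemeister3_up:
  assumes "p = r \<Longrightarrow> q = p"
  shows "reidemeister3 Up Up Up p q r"
proof -
  let ?u = "[Up, Up, Up]" and ?k = "\<kappa> r * \<kappa> q * \<kappa> p"
  let ?A = "S Up \<otimes>\<^sub>D ids [Up]" and ?B = "ids [Up] \<otimes>\<^sub>D S Up"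
  let ?I = "lc (ids ?u) :: tgraph \<Rightarrow>\<^sub>0 'r"
  \<comment> \<open>The summand -1 in the coefficient of \<open>?B\<close> makes up for the
    \<open>lc ?B\<close> that \<open>?f\<close> groups with the triple product, so that
    \<open>moy_braid\<close> applies to that group as it stands.\<close>
  let ?P = "(\<tau> r * \<tau> q * \<tau> p) \<odot> ?I + (\<tau> q * \<tau> p + \<tau> r * \<tau> q) \<odot> lc ?A + (\<tau> r * \<tau> p - 1) \<odot> lc ?B
    + \<tau> p \<odot> lc (?A \<circ>\<^sub>D ?B) + \<tau> r \<odot> lc (?B \<circ>\<^sub>D ?A)"
  let ?Q = "(\<tau> r * \<tau> q * \<tau> p) \<odot> ?I + (\<tau> q * \<tau> r + \<tau> p * \<tau> q) \<odot> lc ?B + (\<tau> p * \<tau> r) \<odot> lc ?A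
    + \<tau> p \<odot> lc (?A \<circ>\<^sub>D ?B) + \<tau> r \<odot> lc (?B \<circ>\<^sub>D ?A)"
  let ?f = "?k \<odot> (?P + \<tau> q \<odot> lc (?A \<circ>\<^sub>D ?A) + (lc (?A \<circ>\<^sub>D ?B \<circ>\<^sub>D ?A) + lc ?B))"
  let ?g = "?k \<odot> (?Q + \<tau> q \<odot> lc (?B \<circ>\<^sub>D ?B) + lc (?B \<circ>\<^sub>D ?A \<circ>\<^sub>D ?B))"
  let ?d = "- (\<zeta> + unit_inv \<zeta>)"
  have hom: "lc ?A \<in> hom is_tgraph (thin ?u) (thin ?u)" "lc ?B \<in> hom is_tgraph (thin ?u) (thin ?u)"
    by (auto intro!: hom_lc is_tgraph_intros simp: is_tgraph_S)
  have hom': "(lc (D \<circ>\<^sub>D E) :: _ \<Rightarrow>\<^sub>0 'r) \<in> hom is_tgraph (thin ?u) (thin ?u)"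
    if "(lc D :: _ \<Rightarrow>\<^sub>0 'r) \<in> hom is_tgraph (thin ?u) (thin ?u)"
      "(lc E :: _ \<Rightarrow>\<^sub>0 'r) \<in> hom is_tgraph (thin ?u) (thin ?u)" for D E
    using hom_tgraph_lcomp[OF that] by (simp add: lcomp_simps)
  have AA: "cong ?u ?u (lc (?A \<circ>\<^sub>D ?A)) (?d \<odot> lc ?A)"
    using moy_cong_ltensor[OF moy_S_S[of Up] ideal_eq_refl[OF hom_ids[of "[Up]"]]]
    by (simp add: ltensor_simps ids_def dcomp_dtensor_idd)
  have BB: "cong ?u ?u (lc (?B \<circ>\<^sub>D ?B)) (?d \<odot> lc ?B)"
    using moy_cong_ltensor[OF ideal_eq_refl[OF hom_ids[of "[Up]"]] moy_S_S[of Up]]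
    by (simp add: ltensor_simps ids_def idd_dtensor_dcomp)
  have "cong ?u ?u ?f (?k \<odot> (?P + \<tau> q \<odot> ?d \<odot> lc ?A + (lc (?B \<circ>\<^sub>D ?A \<circ>\<^sub>D ?B) + lc ?A)))"
    by (intro ideal_eq_scale ideal_eq_add AA moy_braid ideal_eq_refl hom_add hom_scale hom hom' hom_ids)
  also have "?k \<odot> (?P + \<tau> q \<odot> ?d \<odot> lc ?A + (lc (?B \<circ>\<^sub>D ?A \<circ>\<^sub>D ?B) + lc ?A)) =
      ?k \<odot> (?Q + \<tau> q \<odot> ?d \<odot> lc ?B + lc (?B \<circ>\<^sub>D ?A \<circ>\<^sub>D ?B))"
    (is "?k \<odot> ?X = ?k \<odot> ?Y")
  proof -
    \<comment> \<open>All other terms agree, and the excess of \<open>?A\<close> equals the deficit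
      of \<open>?B\<close>, so a single scalar has to vanish.\<close>
    have "Poly_Mapping.lookup ?X D - Poly_Mapping.lookup ?Y D =
        (\<tau> q * \<tau> p + \<tau> r * \<tau> q + 1 - (\<tau> p * \<tau> r + \<tau> q * (\<zeta> + unit_inv \<zeta>))) *
          (Poly_Mapping.lookup (lc ?A) D - Poly_Mapping.lookup (lc ?B) D)" for D
      by (simp add: lookup_add algebra_simps)
    then show ?thesis
      using reidemeister3_coefficient[OF assms]
      by (intro arg_cong[of _ _ "\<lambda>f. ?k \<odot> f"] poly_mapping_eqI) simp
  qed
  also have "cong ?u ?u \<dots> ?g"
    by (intro ideal_eq_scale ideal_eq_add BB[THEN ideal_eq_sym] ideal_eq_refl hom_add hom_scale hom hom' hom_ids)
  finally have fg: "cong ?u ?u ?f ?g" .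
  let ?L = "(tcross Up Up r \<otimes>\<^sub>D idd [Up]) \<circ>\<^sub>D (idd [Up] \<otimes>\<^sub>D tcross Up Up q) \<circ>\<^sub>D (tcross Up Up p \<otimes>\<^sub>D idd [Up])"
  let ?R = "(idd [Up] \<otimes>\<^sub>D tcross Up Up p) \<circ>\<^sub>D (tcross Up Up q \<otimes>\<^sub>D idd [Up]) \<circ>\<^sub>D (idd [Up] \<otimes>\<^sub>D tcross Up Up r)"
  have simps: "ids ?u \<circ>\<^sub>D D = D" "D \<circ>\<^sub>D ids ?u = D" if "bot D = thin ?u" "top D = thin ?u" for D
    using that ids_dcomp[of D ?u] dcomp_ids[of D ?u] by simp_all
  have "Z \<alpha> \<zeta> ?L = ?f"
    by (rule poly_mapping_eqI)
      (simp add: Z_dcomp Z_dtensor is_tangle_intros Z_gen_turn crossing_value lcomp_simps ltensor_simps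
        ids_append simps is_tgraph_S lookup_add algebra_simps del: Z_gen.simps)
  moreover have "Z \<alpha> \<zeta> ?R = ?g"
    by (rule poly_mapping_eqI)
      (simp add: Z_dcomp Z_dtensor is_tangle_intros Z_gen_turn crossing_value lcomp_simps ltensor_simps
        ids_append simps is_tgraph_S lookup_add algebra_simps del: Z_gen.simps)
  ultimately show ?thesis
    using fg by (simp add: reidemeister3_def Z_cong_def parallel_def is_tangle_intros del: Z_gen.simps)
qed

definition tangle_zigzags :: "dir \<Rightarrow> (tangle \<times> tangle) list" where
  "tangle_zigzags s =
     [((tcap s \<otimes>\<^sub>D idd [s]) \<circ>\<^sub>D (idd [s] \<otimes>\<^sub>D tcup (opp s)), idd [s]),
      ((idd [s] \<otimes>\<^sub>D tcap (opp s)) \<circ>\<^sub>D (tcup s \<otimes>\<^sub>D idd [s]), idd [s])]"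

definition turn_crossing :: "dir \<Rightarrow> dir \<Rightarrow> bool \<Rightarrow> tangle \<times> tangle" where
  "turn_crossing a b p =
    ((idd [opp a, b] \<otimes>\<^sub>D tcap a) \<circ>\<^sub>D (idd [opp a] \<otimes>\<^sub>D tcross a b p \<otimes>\<^sub>D idd [opp a])
      \<circ>\<^sub>D (tcup (opp a) \<otimes>\<^sub>D idd [b, opp a]), tcross b (opp a) (\<not> p))"

text \<open>Turning the whole triangle by a sixth of a full turn.\<close>

lemma reidemeister3_turn:
  assumes "reidemeister3 a b c p q r"
  shows "reidemeister3 b c (opp a) r (\<not> p) (\<not> q)"
  unfolding reidemeister3_def
proof (rule Z_cong_joins)
  let ?rules = "tangle_zigzags a @ tangle_zigzags (opp a) @ [turn_crossing a b p, turn_crossing a c q,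
    ((tcross b c r \<otimes>\<^sub>D idd [a]) \<circ>\<^sub>D (idd [b] \<otimes>\<^sub>D tcross a c q) \<circ>\<^sub>D (tcross a b p \<otimes>\<^sub>D idd [c]),
    (idd [c] \<otimes>\<^sub>D tcross a b p) \<circ>\<^sub>D (tcross a c q \<otimes>\<^sub>D idd [b]) \<circ>\<^sub>D (idd [a] \<otimes>\<^sub>D tcross b c r))]"
  \<comment> \<open>Rules 4 and 5 express both crossings of the reversed strand as turned crossings
    of the original one. After a zigzag (rule 0) has straightened that strand, the old triangle
    stands free in the middle, and rule 6 is the given instance of R3.\<close>
  show "joins tsrc ttgt ?rules
     [Unapply 2 0 5, Unapply 1 1 4, Swap_Left 3, Swap_Left 2, Swap_Left 1, Swap_Left 4,
      Swap_Left 3, Swap_Left 2, Swap_Left 5, Swap_Left 4, Apply 3 2 0, Swap_Left 0]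
     [Unapply 1 0 4, Unapply 0 1 5, Swap_Left 2, Swap_Left 1, Swap_Left 0, Swap_Left 3,
      Swap_Left 2, Swap_Left 1, Swap_Left 4, Swap_Left 3, Apply 2 2 0, Swap_Left 3, Apply 1 1 6]
     ((tcross c (opp a) (\<not> q) \<otimes>\<^sub>D idd [b]) \<circ>\<^sub>D (idd [c] \<otimes>\<^sub>D tcross b (opp a) (\<not> p)) \<circ>\<^sub>D (tcross b c r \<otimes>\<^sub>D idd [opp a]))
     ((idd [opp a] \<otimes>\<^sub>D tcross b c r) \<circ>\<^sub>D (tcross b (opp a) (\<not> p) \<otimes>\<^sub>D idd [c]) \<circ>\<^sub>D (idd [b] \<otimes>\<^sub>D tcross c (opp a) (\<not> q)))"
    by (simp add: joins_simps tangle_zigzags_def turn_crossing_def)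
  show "Z_cong \<alpha> \<zeta> n D E" if "(D, E) \<in> set ?rules" for D E
    using that Z_zigzag[of \<alpha> \<zeta> n a] Z_zigzag[of \<alpha> \<zeta> n "opp a"] Z_rotate[of a b p] Z_rotate[of a c q] assms
    by (auto simp: tangle_zigzags_def turn_crossing_def reidemeister3_def)
qed

text \<open>Multiplication with the inverse of the crossing of the first two strands on both sides.\<close>

lemma reidemeister3_swap:
  assumes "reidemeister3 a b c p q r"
  shows "reidemeister3 b a c (\<not> p) r q"
  unfolding reidemeister3_def
proof (rule Z_cong_joins)
  let ?rules = "[(tcross b a (\<not> p) \<circ>\<^sub>D tcross a b p, idd [a, b]), (tcross a b p \<circ>\<^sub>D tcross b a (\<not> p), idd [b, a]),
    ((tcross b c r \<otimes>\<^sub>D idd [a]) \<circ>\<^sub>D (idd [b] \<otimes>\<^sub>D tcross a c q) \<circ>\<^sub>D (tcross a b p \<otimes>\<^sub>D idd [c]),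
    (idd [c] \<otimes>\<^sub>D tcross a b p) \<circ>\<^sub>D (tcross a c q \<otimes>\<^sub>D idd [b]) \<circ>\<^sub>D (idd [a] \<otimes>\<^sub>D tcross b c r))]"
  \<comment> \<open>A cancelling pair of crossings is inserted on top of one side and at the bottom
    of the other; one use of the given R3 between them makes the two equal.\<close>
  show "joins tsrc ttgt ?rules [Unapply 3 1 0, Unapply 1 0 2] [Unapply 0 0 1]
     ((tcross a c q \<otimes>\<^sub>D idd [b]) \<circ>\<^sub>D (idd [a] \<otimes>\<^sub>D tcross b c r) \<circ>\<^sub>D (tcross b a (\<not> p) \<otimes>\<^sub>D idd [c]))
     ((idd [c] \<otimes>\<^sub>D tcross b a (\<not> p)) \<circ>\<^sub>D (tcross b c r \<otimes>\<^sub>D idd [a]) \<circ>\<^sub>D (idd [b] \<otimes>\<^sub>D tcross a c q))"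
    by (simp add: joins_simps)
  show "Z_cong \<alpha> \<zeta> n D E" if "(D, E) \<in> set ?rules" for D E
    using that Z_reidemeister2[of b a p] Z_reidemeister2[of a b "\<not> p"] assms
    by (auto simp: reidemeister3_def)
qed

text \<open>Turning takes directions \<open>a b c\<close> to \<open>b c (opp a)\<close>. Starting
  from three upward strands this reaches six of the eight orientations. The two with alternating
  directions form an orbit of their own and are reached by swapping the first two strands.\<close>

lemma Z_reidemeister3:
  assumes "p = r \<Longrightarrow> q = p"
  shows "reidemeister3 a b c p q r"
proof -
  \<comment> \<open>All admissible flags are taken at once, because turning and swapping change the
    flags but preserve admissibility.\<close>
  define R where "R a b c \<longleftrightarrow> (\<forall>p q r. (p = r \<longrightarrow> q = p) \<longrightarrow> reidemeister3 a b c p q r)" for a b c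
  have turn: "R b c (opp a)" if "R a b c" for a b c
    unfolding R_def
  proof (intro allI impI)
    fix p q r :: bool
    assume pqr: "p = r \<longrightarrow> q = p"
    have "reidemeister3 a b c (\<not> q) (\<not> r) p"
      by (rule that[unfolded R_def, rule_format]) (use pqr in auto)
    from reidemeister3_turn[OF this] show "reidemeister3 b c (opp a) p q r"
      by simp
  qed
  have swap: "R b a c" if "R a b c" for a b c
    unfolding R_def
  proof (intro allI impI)
    fix p q r :: bool
    assume pqr: "p = r \<longrightarrow> q = p"
    have "reidemeister3 a b c (\<not> p) r q"
      by (rule that[unfolded R_def, rule_format]) (use pqr in auto)
    from reidemeister3_swap[OF this] show "reidemeister3 b a c p q r"
      by simp
  qed
  have 0: "R Up Up Up"
    using reidemeister3_up by (simp add: R_def)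
  note 1 = turn[OF 0, simplified]
  note 2 = turn[OF 1, simplified]
  note 3 = turn[OF 2, simplified]
  note 4 = turn[OF 3, simplified]
  note 5 = turn[OF 4, simplified]
  have "R a b c"
    using 0 1 2 3 4 5 swap[OF 2] swap[OF 5] by (cases a; cases b; cases c) simp_all
  then show ?thesis
    using assms by (simp add: R_def)
qed

lemma Z_cong_tangle_move: "tangle_move D E \<Longrightarrow> Z_cong \<alpha> \<zeta> n D E"
proof (induction rule: tangle_move.induct)
  case (R3 p r q b c a)
  then show ?case
    using Z_reidemeister3[of p r q a b c] by (simp add: reidemeister3_def)
qed (rule Z_zigzag Z_rotate Z_reidemeister1 Z_reidemeister2)+

end

theorem corollary3p3p1:
  fixes \<alpha> z \<zeta> \<phi> :: "'r::comm_ring_1" and n :: nat and \<Gamma> :: tangle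
  assumes "\<alpha> dvd 1" and "z dvd 1" and "\<zeta> dvd 1"
    and "unit_inv \<zeta> - \<zeta> = z"
    and "n \<ge> 2"
    and "oriented_link \<Gamma>"
    and "is_homfly_polynomial \<alpha> z \<Gamma> \<phi>"
  shows "moy_eq \<alpha> \<zeta> n [] [] (Z \<alpha> \<zeta> \<Gamma>) (\<phi> \<odot> lc (ids []))"
proof -
  interpret moy_parameters \<alpha> \<zeta> n
    using assms by unfold_locales simp_all
  show ?thesis
    \<comment> \<open>That \<phi> is the polynomial of the link means that this difference lies in
      the HOMFLY-PT ideal; its image under \<open>Z_linear\<close> is the difference in the
      claim.\<close>
    using Z_linear_ideal[OF Z_cong_tangle_move, of "[]" "[]" "lc \<Gamma> - \<phi> \<odot> lc (idd [])"] assms(4,7)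
    by (simp add: moy_eq_def is_homfly_polynomial_def homfly_eq_def Z_linear_simps)
qed

end
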